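(* Let $g\geq 2$. The Rauzy–Veech group of any component of a stratum of abelian differentials on surfaces of genus $g$ is a Zariski dense subgroup of $Sp(2g,\mathbb{Z})$, i.e. it is a subgroup of $Sp(2g,\mathbb{Z})$ which is Zariski dense in $Sp(2g,\mathbb{R})$.
   Context: Rauzy–Veech group: Let $\mathcal{A}$ be a finite alphabet. To a component of a stratum there is associated a Rauzy class of irreducible permutations $\pi=(\pi_t,\pi_b)$ (pairs of bijections $\mathcal{A}\to\{1,\dots,|\mathcal{A}|\}$), whose suspensions lie in the component; it is the vertex set of the Rauzy diagram, whose arrows are the top and bottom Rauzy moves. To an arrow $\gamma:\pi\to\pi'$ with winner $\alpha$ and loser $\beta$ one associates the matrix $B_\gamma=\mathrm{Id}+E_{\beta\alpha}\in SL(\mathcal{A},\mathbb{Z})$, and to a path the corresponding product of matrices. Let $\Omega_\pi$ be the antisymmetric matrix with $(\Omega_\pi)_{\alpha\beta}=1$ if $\pi_t(\alpha)<\pi_t(\beta)$ and $\pi_b(\alpha)>\pi_b(\beta)$, $=-1$ if $\pi_t(\alpha)>\pi_t(\beta)$ and $\pi_b(\alpha)<\pi_b(\beta)$, and $0$ otherwise; then $B_\gamma\Omega_\pi B_\gamma^T=\Omega_{\pi'}$. The $2g$-dimensional space $\Omega_\pi(\mathbb{R}^{\mathcal{A}})$, with the lattice $\Omega_\pi(\mathbb{Z}^{\mathcal{A}})$ and the symplectic form $(\Omega_\pi u,\Omega_\pi v)\mapsto u^T\Omega_\pi v$, is identified with the absolute homology of $S$ with its integral lattice and intersection form. The Rauzy–Veech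 group (at a vertex $\pi$) is the group generated by the restrictions of the matrices $B_\gamma$ to $\Omega_\pi(\mathbb{R}^{\mathcal{A}})$, where $\gamma$ ranges over the closed paths in the Rauzy diagram based at $\pi$; it is a subgroup of $Sp(2g,\mathbb{Z})$. *)

theory Defs
  imports "HOL-Analysis.Analysis" "HOL-Algebra.Bij" "HOL-Algebra.Generated_Groups"
begin

section \<open>Permutation pairs and Rauzy diagrams\<close>

text \<open>A pair consists of the top and the bottom bijection from the alphabet to \<open>{1..d}\<close>, where
  the alphabet is a finite type with \<open>d\<close> elements.\<close>

type_synonym 'a perm_pair = "('a \<Rightarrow> nat) \<times> ('a \<Rightarrow> nat)"

definition perm_pair :: "'a::finite perm_pair \<Rightarrow> bool" where
  "perm_pair \<pi> \<longleftrightarrow>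
     bij_betw (fst \<pi>) UNIV {1..CARD('a)} \<and> bij_betw (snd \<pi>) UNIV {1..CARD('a)}"

definition irreducible_pair :: "'a::finite perm_pair \<Rightarrow> bool" where
  "irreducible_pair \<pi> \<longleftrightarrow> perm_pair \<pi> \<and>
     (\<forall>k. 1 \<le> k \<and> k < CARD('a) \<longrightarrow> {\<xi>. fst \<pi> \<xi> \<le> k} \<noteq> {\<xi>. snd \<pi> \<xi> \<le> k})"

text \<open>In one row, move the letter \<open>\<beta>\<close>, which occupies the last position, to the position
  immediately after \<open>\<alpha>\<close>.\<close>

definition move_after :: "('a \<Rightarrow> nat) \<Rightarrow> 'a \<Rightarrow> 'a \<Rightarrow> 'a \<Rightarrow> nat" where
  "move_after p \<alpha> \<beta> \<xi> =
     (if p \<xi> \<le> p \<alpha> then p \<xi> else if \<xi> = \<beta> then p \<alpha> + 1 else p \<xi> + 1)"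

text \<open>\<open>rauzy_arrow \<pi> \<alpha> \<beta> \<pi>'\<close>: there is an arrow from \<open>\<pi>\<close> to \<open>\<pi>'\<close> with winner \<open>\<alpha>\<close> and loser \<open>\<beta>\<close>.\<close>

inductive rauzy_arrow :: "'a::finite perm_pair \<Rightarrow> 'a \<Rightarrow> 'a \<Rightarrow> 'a perm_pair \<Rightarrow> bool" where
  top: "t \<alpha> = CARD('a) \<Longrightarrow> b \<beta> = CARD('a) \<Longrightarrow>
     rauzy_arrow (t, b) \<alpha> \<beta> (t, move_after b \<alpha> \<beta>)"
| bottom: "b \<alpha> = CARD('a) \<Longrightarrow> t \<beta> = CARD('a) \<Longrightarrow>
     rauzy_arrow (t, b) \<alpha> \<beta> (move_after t \<alpha> \<beta>, b)"

definition arrow_matrix :: "'a::finite \<Rightarrow> 'a \<Rightarrow> real^'a^'a" where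
  "arrow_matrix \<alpha> \<beta> =
     mat 1 + (\<chi> \<xi> \<eta>. if \<xi> = \<beta> \<and> \<eta> = \<alpha> then 1 else 0)"

text \<open>\<open>rauzy_path \<pi> B \<pi>'\<close>: some directed path from \<open>\<pi>\<close> to \<open>\<pi>'\<close> has matrix \<open>B\<close>. The matrix of the
  last arrow is the leftmost factor, so that \<open>B \<Omega>\<^sub>\<pi> B\<^sup>T = \<Omega>\<^sub>\<pi>\<^sub>'\<close>.\<close>

inductive rauzy_path :: "'a::finite perm_pair \<Rightarrow> real^'a^'a \<Rightarrow> 'a perm_pair \<Rightarrow> bool"
  for \<pi> where
  refl: "rauzy_path \<pi> (mat 1) \<pi>"
| step: "rauzy_path \<pi> B \<pi>' \<Longrightarrow> rauzy_arrow \<pi>' \<alpha> \<beta> \<pi>'' \<Longrightarrow>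
     rauzy_path \<pi> (arrow_matrix \<alpha> \<beta> ** B) \<pi>''"

definition rauzy_class :: "'a::finite perm_pair set \<Rightarrow> bool" where
  "rauzy_class R \<longleftrightarrow> (\<exists>\<pi>. irreducible_pair \<pi> \<and> R = {\<pi>'. \<exists>B. rauzy_path \<pi> B \<pi>'})"


section \<open>The genus of the suspensions\<close>

text \<open>A suspension of \<open>\<pi>\<close> is obtained from a polygon with \<open>2d\<close> sides. Its vertices are
  \<open>(True, i)\<close>, resp. \<open>(False, i)\<close>, for the \<open>i\<close>-th vertex of the upper, resp. lower, boundary line,
  \<open>0 \<le> i \<le> d\<close>; the two lines share their endpoints. The upper and the lower side with the same
  label are identified by a translation, hence so are their left endpoints and their right
  endpoints.\<close>

definition polygon_vertices :: "'a::finite perm_pair \<Rightarrow> (bool \<times> nat) set" where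
  "polygon_vertices \<pi> = UNIV \<times> {0..CARD('a)}"

definition vertex_gluing :: "'a::finite perm_pair \<Rightarrow> ((bool \<times> nat) \<times> (bool \<times> nat)) set" where
  "vertex_gluing \<pi> =
     {((True, 0), (False, 0)), ((True, CARD('a)), (False, CARD('a)))}
     \<union> {((True, fst \<pi> \<xi> - 1), (False, snd \<pi> \<xi> - 1)) | \<xi>. True}
     \<union> {((True, fst \<pi> \<xi>), (False, snd \<pi> \<xi>)) | \<xi>. True}"

definition surface_vertices :: "'a::finite perm_pair \<Rightarrow> (bool \<times> nat) set set" where
  "surface_vertices \<pi> =
     polygon_vertices \<pi> // (vertex_gluing \<pi> \<union> (vertex_gluing \<pi>)\<inverse>)\<^sup>*"

text \<open>The glued polygon is a cell structure with \<open>d\<close> edges and one face.\<close>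

definition euler_char :: "'a::finite perm_pair \<Rightarrow> int" where
  "euler_char \<pi> = int (card (surface_vertices \<pi>)) - int CARD('a) + 1"

definition has_genus :: "'a::finite perm_pair \<Rightarrow> nat \<Rightarrow> bool" where
  "has_genus \<pi> g \<longleftrightarrow> euler_char \<pi> = 2 - 2 * int g"


section \<open>Homology\<close>

definition Omega :: "'a::finite perm_pair \<Rightarrow> real^'a^'a" where
  "Omega \<pi> = (\<chi> \<alpha> \<beta>.
     if fst \<pi> \<alpha> < fst \<pi> \<beta> \<and> snd \<pi> \<alpha> > snd \<pi> \<beta> then 1
     else if fst \<pi> \<alpha> > fst \<pi> \<beta> \<and> snd \<pi> \<alpha> < snd \<pi> \<beta> then -1
     else 0)"

definition homology_space :: "'a::finite perm_pair \<Rightarrow> (real^'a) set" where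
  "homology_space \<pi> = range (\<lambda>v. Omega \<pi> *v v)"

definition homology_lattice :: "'a::finite perm_pair \<Rightarrow> (real^'a) set" where
  "homology_lattice \<pi> = (\<lambda>v. Omega \<pi> *v v) ` {v. \<forall>\<alpha>. v $ \<alpha> \<in> \<int>}"

text \<open>\<open>(\<Omega>\<^sub>\<pi> u, \<Omega>\<^sub>\<pi> v) \<mapsto> u\<^sup>T \<Omega>\<^sub>\<pi> v\<close>; by antisymmetry of \<open>\<Omega>\<^sub>\<pi>\<close> the value does not depend on the choice
  of \<open>u\<close> and \<open>v\<close>. Only meaningful for \<open>x\<close> and \<open>y\<close> in \<open>homology_space \<pi>\<close>.\<close>

definition intersection_form :: "'a::finite perm_pair \<Rightarrow> real^'a \<Rightarrow> real^'a \<Rightarrow> real" where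
  "intersection_form \<pi> x y =
     (THE r. \<exists>u v. x = Omega \<pi> *v u \<and> y = Omega \<pi> *v v \<and> r = u \<bullet> (Omega \<pi> *v v))"


section \<open>The Rauzy--Veech group\<close>

text \<open>The generators are the restrictions of the matrices of closed paths, as bijections of
  \<open>homology_space \<pi>\<close>.\<close>

definition rauzy_veech_group :: "'a::finite perm_pair \<Rightarrow> (real^'a \<Rightarrow> real^'a) set" where
  "rauzy_veech_group \<pi> =
     generate (BijGroup (homology_space \<pi>))
       {restrict (\<lambda>x. B *v x) (homology_space \<pi>) | B. rauzy_path \<pi> B \<pi>}"


section \<open>Symplectic groups\<close>

text \<open>Matrices of size \<open>2g\<close> are indexed by \<open>'g + 'g\<close>, where \<open>'g\<close> has \<open>g\<close> elements.\<close>

definition symplectic_J :: "real^('g::finite + 'g)^('g + 'g)" where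
  "symplectic_J = (\<chi> i j. case (i, j) of
     (Inl k, Inr l) \<Rightarrow> if k = l then 1 else 0
   | (Inr k, Inl l) \<Rightarrow> if k = l then -1 else 0
   | _ \<Rightarrow> 0)"

definition Sp_real :: "(real^('g::finite + 'g)^('g + 'g)) monoid" where
  "Sp_real = \<lparr>carrier = {M. transpose M ** symplectic_J ** M = symplectic_J},
     monoid.mult = (**), one = mat 1\<rparr>"

definition Sp_int :: "(real^('g::finite + 'g)^('g + 'g)) monoid" where
  "Sp_int = Sp_real\<lparr>carrier := {M \<in> carrier Sp_real. \<forall>i j. M $ i $ j \<in> \<int>}\<rparr>"

definition symplectic_lattice_basis ::
    "'a::finite perm_pair \<Rightarrow> ('g::finite + 'g \<Rightarrow> real^'a) \<Rightarrow> bool" where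
  "symplectic_lattice_basis \<pi> e \<longleftrightarrow>
     inj e \<and> independent (range e) \<and>
     {\<Sum>i\<in>UNIV. c i *\<^sub>R e i | c. \<forall>i. c i \<in> \<int>} = homology_lattice \<pi> \<and>
     (\<forall>i j. intersection_form \<pi> (e i) (e j) = symplectic_J $ i $ j)"

definition rauzy_veech_matrices ::
    "'a::finite perm_pair \<Rightarrow> ('g::finite + 'g \<Rightarrow> real^'a) \<Rightarrow> (real^('g + 'g)^('g + 'g)) set" where
  "rauzy_veech_matrices \<pi> e =
     {M. \<exists>f \<in> rauzy_veech_group \<pi>. \<forall>j. f (e j) = (\<Sum>i\<in>UNIV. M $ i $ j *\<^sub>R e i)}"


section \<open>Zariski density\<close>

definition zariski_closed :: "'v::real_normed_vector set \<Rightarrow> bool" where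
  "zariski_closed Z \<longleftrightarrow>
     (\<exists>P. (\<forall>p\<in>P. real_polynomial_function p) \<and> Z = {x. \<forall>p\<in>P. p x = 0})"

text \<open>Density in \<open>H\<close> with respect to the topology that \<open>H\<close> inherits from the ambient affine
  space.\<close>

definition zariski_dense_in :: "'v::real_normed_vector set \<Rightarrow> 'v set \<Rightarrow> bool" where
  "zariski_dense_in G H \<longleftrightarrow>
     G \<subseteq> H \<and> (\<forall>Z. zariski_closed Z \<and> G \<subseteq> Z \<longrightarrow> H \<subseteq> Z)"

end

theory Submission
  imports Defs
begin

text \<open>
  The group is shown to contain enough symplectic transvections. If \<open>\<alpha>\<close> is the last letter of one row
  of \<open>\<pi>\<close>, repeating the move won by \<open>\<alpha>\<close> rotates the letters to the right of \<open>\<alpha>\<close> in the other row, so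
  that it closes up, and the matrix of this loop is \<open>1 + \<Omega> e\<^sub>\<alpha> e\<^sub>\<alpha>\<^sup>T\<close> or its inverse
  (\<open>top_loop\<close>): a transvection along \<open>\<Omega> e\<^sub>\<alpha>\<close>. Let \<open>U\<^sub>\<pi>\<close> be the set of the vectors \<open>u\<close> such that
  \<open>1 + \<Omega>\<^sub>\<pi> u u\<^sup>T\<close> belongs to the group at \<open>\<pi>\<close>. Conjugation by a path with matrix \<open>B\<close> from \<open>\<pi>\<close> to \<open>\<pi>'\<close>
  shows that \<open>u \<in> U\<^sub>\<pi>\<^sub>'\<close> iff \<open>B\<^sup>T u \<in> U\<^sub>\<pi>\<close>. For one arrow with winner \<open>\<alpha>\<close> and loser \<open>\<beta>\<close> the matrix \<open>B\<^sup>T\<close> fixes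
  all basis vectors except \<open>e\<^sub>\<beta>\<close>, which it sends to \<open>e\<^sub>\<beta> + e\<^sub>\<alpha>\<close>; and since \<open>\<Omega>\<^sub>\<beta>\<^sub>\<alpha> = \<plusminus>1\<close>, the transvections along
  \<open>\<Omega> e\<^sub>\<alpha>\<close> and \<open>\<Omega> e\<^sub>\<beta>\<close> generate the one along \<open>\<Omega> (e\<^sub>\<beta> + e\<^sub>\<alpha>)\<close>. Hence the set of letters \<open>\<xi>\<close> with \<open>e\<^sub>\<xi> \<in> U\<^sub>\<pi>\<close> is constant
  on the Rauzy class. It contains the last letters of every vertex of the class, and by irreducibility
  every letter comes last somewhere (\<open>every_letter_last\<close>). So the group contains the transvections along
  all \<open>\<Omega> e\<^sub>\<xi>\<close>.

  These vectors span the homology, and they cannot be split into two orthogonal families, because the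
  inversion graph of an irreducible pair is connected. Such transvections generate a Zariski dense
  group (\<open>transvections_dense\<close>): the closure contains the one-parameter groups of the given transvections;
  the set of the vectors whose one-parameter group lies in the closure is stable under scaling, closed
  under limits along lines, and under sums of two non-orthogonal vectors; so, among the subspaces inside this set that
  contain a fixed one of the given vectors, one of maximal dimension is everything; and all
  transvections together generate the symplectic group.

  It remains to see that the homology with its lattice is symplectic of dimension \<open>2 g\<close>. A vector \<open>u\<close>
  assigns heights to the polygon vertices, namely the partial sums of \<open>u\<close> along each row, and \<open>\<Omega> u\<close>
  consists of the differences of the heights of identified vertices. Therefore
  \<open>ker \<Omega>\<close> is the space of the functions on the vertices of the surface that vanish at a base point, which gives
  the dimension; and if \<open>\<Omega> u\<close> is integral, then subtracting from \<open>u\<close> the element of \<open>ker \<Omega>\<close> given by the fractional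
  parts of the heights makes \<open>u\<close> integral, so that the lattice is saturated in \<open>\<int>\<^sup>d\<close>
  (\<open>homology_lattice_saturated\<close>). Saturation makes the form unimodular, and a symplectic basis is built
  one hyperbolic pair at a time.
\<close>

section \<open>Rank-one matrices\<close>

text \<open>The matrix \<open>x y\<^sup>T\<close>.\<close>

definition outer :: "real^'n \<Rightarrow> real^'m \<Rightarrow> real^'m^'n" where
  "outer x y = (\<chi> i j. x $ i * y $ j)"

lemma outer_mult_vec: "outer x y *v z = (y \<bullet> z) *\<^sub>R x"
  by (simp add: outer_def matrix_vector_mult_def vec_eq_iff inner_vec_def sum_distrib_left mult_ac)

lemma matrix_mult_outer: "A ** outer x y = outer (A *v x) y"
  by (simp add: outer_def matrix_matrix_mult_def matrix_vector_mult_def vec_eq_iff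
      sum_distrib_right mult.assoc)

lemma outer_mult_matrix: "outer x y ** A = outer x (transpose A *v y)"
  by (simp add: outer_def matrix_matrix_mult_def matrix_vector_mult_def vec_eq_iff transpose_def
      sum_distrib_left mult_ac)

lemma transpose_outer: "transpose (outer x y) = outer y x"
  by (simp add: outer_def transpose_def vec_eq_iff mult.commute)

lemma outer_add_left: "outer (x + y) z = outer x z + outer y z"
  and outer_add_right: "outer z (x + y) = outer z x + outer z y"
  and outer_minus_left: "outer (- x) z = - outer x z"
  and outer_scale_left: "outer (c *\<^sub>R x) z = c *\<^sub>R outer x z"
  and outer_scale_right: "outer z (c *\<^sub>R x) = c *\<^sub>R outer z x"
  by (simp_all add: outer_def vec_eq_iff algebra_simps)

lemma transpose_add: "transpose (A + B) = transpose A + transpose (B :: real^'n^'m)"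
  by (simp add: transpose_def vec_eq_iff)

lemma matrix_add_rdistrib: "(A + B) ** (C :: real^'k^'n) = A ** C + B ** (C :: real^'k^'n)"
  by (simp add: matrix_matrix_mult_def vec_eq_iff sum.distrib distrib_right)

lemma arrow_matrix_outer: "arrow_matrix \<alpha> \<beta> = mat 1 + outer (axis \<beta> 1) (axis \<alpha> 1)"
  by (auto simp: arrow_matrix_def outer_def vec_eq_iff axis_def)

lemma matrix_vector_mult_axis_nth: "(A *v axis j (1::real)) $ i = A $ i $ j"
  by (simp add: matrix_vector_mult_def axis_def if_distrib[of "\<lambda>x. _ * x"] cong: if_cong)

section \<open>Elementary properties of the moves\<close>

lemma perm_iff:
  fixes p :: "'a::finite \<Rightarrow> nat"
  shows "bij_betw p UNIV {1..CARD('a)} \<longleftrightarrow> inj p \<and> (\<forall>\<xi>. 1 \<le> p \<xi> \<and> p \<xi> \<le> CARD('a))"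
proof -
  have "p ` UNIV = {1..CARD('a)}" if "inj p" "\<forall>\<xi>. 1 \<le> p \<xi> \<and> p \<xi> \<le> CARD('a)"
    using that by (intro card_subset_eq) (auto simp: card_image)
  moreover have "1 \<le> p \<xi> \<and> p \<xi> \<le> CARD('a)" if "p ` UNIV = {1..CARD('a)}" for \<xi>
    using that by (metis atLeastAtMost_iff rangeI)
  ultimately show ?thesis unfolding bij_betw_def by blast
qed

lemmas perm_iff' = perm_iff[unfolded One_nat_def]

lemma perm_pairD:
  fixes t b :: "'a::finite \<Rightarrow> nat"
  assumes "perm_pair (t, b)"
  shows "inj t" "inj b" "1 \<le> t \<xi>" "t \<xi> \<le> CARD('a)" "1 \<le> b \<xi>" "b \<xi> \<le> CARD('a)"
  using assms by (auto simp: perm_pair_def perm_iff')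

lemma perm_at:
  fixes p :: "'a::finite \<Rightarrow> nat"
  assumes "bij_betw p UNIV {1..CARD('a)}" "1 \<le> k" "k \<le> CARD('a)"
  obtains \<xi> where "p \<xi> = k"
  using assms by (metis atLeastAtMost_iff bij_betw_imp_surj_on imageE)

lemma card_initial:
  fixes p :: "'a::finite \<Rightarrow> nat"
  assumes p: "bij_betw p UNIV {1..CARD('a)}" and n: "n \<le> CARD('a)"
  shows "card {\<xi>. p \<xi> \<le> n} = n"
proof -
  have "p ` {\<xi>. p \<xi> \<le> n} = {1..n}"
  proof (rule subset_antisym)
    show "p ` {\<xi>. p \<xi> \<le> n} \<subseteq> {1..n}" using p by (auto simp: perm_iff')
    show "{1..n} \<subseteq> p ` {\<xi>. p \<xi> \<le> n}"
    proof
      fix k assume k: "k \<in> {1..n}"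
      then obtain \<xi> where "p \<xi> = k" using n perm_at[OF p, of k] by force
      with k show "k \<in> p ` {\<xi>. p \<xi> \<le> n}" by auto
    qed
  qed
  moreover have "inj_on p {\<xi>. p \<xi> \<le> n}" using p by (meson bij_betw_def inj_on_subset subset_UNIV)
  ultimately show ?thesis by (metis card_atLeastAtMost card_image diff_Suc_1)
qed

lemma perm_move_after:
  fixes p :: "'a::finite \<Rightarrow> nat"
  assumes p: "bij_betw p UNIV {1..CARD('a)}" and \<beta>: "p \<beta> = CARD('a)"
  shows "bij_betw (move_after p \<alpha> \<beta>) UNIV {1..CARD('a)}"
proof -
  have i: "inj p" and r: "\<And>\<xi>. 1 \<le> p \<xi> \<and> p \<xi> \<le> CARD('a)"
    using p by (auto simp: perm_iff')
  have lt: "p \<xi> < CARD('a)" if "\<xi> \<noteq> \<beta>" for \<xi>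
    using r[of \<xi>] that i \<beta> by (metis injD le_neq_implies_less)
  have "inj (move_after p \<alpha> \<beta>)"
    by (rule injI) (auto simp: move_after_def split: if_splits dest: injD[OF i])
  moreover have "1 \<le> move_after p \<alpha> \<beta> \<xi> \<and> move_after p \<alpha> \<beta> \<xi> \<le> CARD('a)" for \<xi>
    using r[of \<xi>] r[of \<alpha>] r[of \<beta>] lt[of \<xi>] lt[of \<alpha>] by (auto simp: move_after_def \<beta>)
  ultimately show ?thesis unfolding perm_iff by blast
qed

lemma swap_arrow: "rauzy_arrow \<pi> \<alpha> \<beta> \<pi>' \<Longrightarrow> rauzy_arrow (prod.swap \<pi>) \<alpha> \<beta> (prod.swap \<pi>')"
  by (induction rule: rauzy_arrow.induct) (auto intro: rauzy_arrow.intros)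

lemma swap_path: "rauzy_path \<pi> B \<pi>' \<Longrightarrow> rauzy_path (prod.swap \<pi>) B (prod.swap \<pi>')"
  by (induction rule: rauzy_path.induct) (auto intro: rauzy_path.intros swap_arrow)

lemma swap_Omega: "Omega (prod.swap \<pi>) = - Omega \<pi>"
  by (auto simp: Omega_def vec_eq_iff)

lemma swap_irreducible: "irreducible_pair (prod.swap \<pi>) \<longleftrightarrow> irreducible_pair \<pi>"
  by (auto simp: irreducible_pair_def perm_pair_def)

text \<open>Every arrow is, up to the exchange of the two rows, a top arrow.\<close>

lemma arrow_cases_swap [consumes 1, case_names top swap]:
  assumes "rauzy_arrow \<pi> \<alpha> \<beta> \<pi>'"
    and "\<And>t b \<alpha> \<beta>. t \<alpha> = CARD('a) \<Longrightarrow> b \<beta> = CARD('a) \<Longrightarrow>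
      P (t, b) \<alpha> \<beta> (t, move_after b \<alpha> \<beta>)"
    and "\<And>\<pi> \<alpha> \<beta> \<pi>'. P (prod.swap \<pi>) \<alpha> \<beta> (prod.swap \<pi>') \<Longrightarrow> P \<pi> \<alpha> \<beta> \<pi>'"
  shows "P (\<pi> :: 'a::finite perm_pair) \<alpha> \<beta> \<pi>'"
  using assms(1)
proof cases
  case (top t b)
  then show ?thesis using assms(2) by auto
next
  case (bottom b t)
  then have "P (prod.swap \<pi>) \<alpha> \<beta> (prod.swap \<pi>')" using assms(2) by auto
  then show ?thesis by (rule assms(3))
qed

lemma irreducible_arrow:
  "rauzy_arrow \<pi> \<alpha> \<beta> \<pi>' \<Longrightarrow> irreducible_pair \<pi> \<Longrightarrow> irreducible_pair (\<pi>' :: 'a::finite perm_pair)"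
proof (induction rule: arrow_cases_swap)
  case (swap \<pi> \<alpha> \<beta> \<pi>')
  then show ?case by (simp add: swap_irreducible)
next
  case (top t b \<alpha> \<beta>)
  have pp: "perm_pair (t, b)" using top by (simp add: irreducible_pair_def)
  let ?b = "move_after b \<alpha> \<beta>"
  have "{\<xi>. t \<xi> \<le> k} \<noteq> {\<xi>. ?b \<xi> \<le> k}" if k: "1 \<le> k" "k < CARD('a)" for k
  proof
    assume eq: "{\<xi>. t \<xi> \<le> k} = {\<xi>. ?b \<xi> \<le> k}"
    \<comment> \<open>The winner is last in the top row, hence lies outside both sets, so the bottom positions up to \<open>k\<close> did not change.\<close>
  have "\<alpha> \<notin> {\<xi>. t \<xi> \<le> k}" using top k by simp
    then have "b \<alpha> > k" unfolding eq by (simp add: move_after_def)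
    then have "?b \<xi> \<le> k \<longleftrightarrow> b \<xi> \<le> k" for \<xi> by (auto simp: move_after_def)
    then show False using top k eq by (auto simp: irreducible_pair_def)
  qed
  then show ?case using pp top perm_move_after[of b \<beta> \<alpha>]
    by (simp add: irreducible_pair_def perm_pair_def)
qed

lemma irreducible_path:
  "rauzy_path \<pi> B \<pi>' \<Longrightarrow> irreducible_pair \<pi> \<Longrightarrow> irreducible_pair (\<pi>' :: 'a::finite perm_pair)"
  by (induction rule: rauzy_path.induct) (auto intro: irreducible_arrow)

lemma last_letters_distinct:
  assumes "irreducible_pair (t, b)" "CARD('a::finite) \<ge> 2" "t \<alpha> = CARD('a)" "b (\<beta>::'a) = CARD('a)"
  shows "\<alpha> \<noteq> \<beta>"
proof
  assume "\<alpha> = \<beta>"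
  have pp: "perm_pair (t, b)" using assms by (simp add: irreducible_pair_def)
  note p = perm_pairD[OF pp]
  have "t \<xi> < CARD('a) \<longleftrightarrow> \<xi> \<noteq> \<alpha>" "b \<xi> < CARD('a) \<longleftrightarrow> \<xi> \<noteq> \<beta>" for \<xi>
    using p(4)[of \<xi>] p(6)[of \<xi>] injD[OF p(1), of \<xi> \<alpha>] injD[OF p(2), of \<xi> \<beta>] assms
    by (auto simp: order.strict_iff_order)
  then have "{\<xi>. t \<xi> < CARD('a)} = {\<xi>. b \<xi> < CARD('a)}" using \<open>\<alpha> = \<beta>\<close> by simp
  moreover obtain k where "CARD('a) = Suc k" "1 \<le> k" using assms(2) by (cases "CARD('a)") auto
  ultimately have "{\<xi>. t \<xi> \<le> k} = {\<xi>. b \<xi> \<le> k}" "1 \<le> k" "k < CARD('a)"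
    by (simp_all add: less_Suc_eq_le)
  then show False using assms(1) by (simp add: irreducible_pair_def)
qed

lemma Omega_antisym: "Omega \<pi> $ \<xi> $ \<eta> = - Omega \<pi> $ \<eta> $ \<xi>"
  by (auto simp: Omega_def)

lemma transpose_Omega: "transpose (Omega \<pi>) = - Omega \<pi>"
  by (simp add: transpose_def vec_eq_iff) (metis Omega_antisym)

lemma transform_by_arrow_nth:
  fixes \<Omega> :: "real^'a::finite^'a"
  shows "(arrow_matrix \<alpha> \<beta> ** \<Omega> ** transpose (arrow_matrix \<alpha> \<beta>)) $ \<xi> $ \<eta> =
    \<Omega> $ \<xi> $ \<eta> + (if \<xi> = \<beta> then \<Omega> $ \<alpha> $ \<eta> else 0) + (if \<eta> = \<beta> then \<Omega> $ \<xi> $ \<alpha> else 0)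
    + (if \<xi> = \<beta> \<and> \<eta> = \<beta> then \<Omega> $ \<alpha> $ \<alpha> else 0)"
proof -
  have "(arrow_matrix \<alpha> \<beta> ** M) $ \<xi> $ \<eta> = M $ \<xi> $ \<eta> + (if \<xi> = \<beta> then M $ \<alpha> $ \<eta> else 0)"
    for M :: "real^'a^'a" and \<xi> \<eta>
    by (simp add: arrow_matrix_def matrix_add_rdistrib)
       (simp add: matrix_matrix_mult_def if_distrib[of "\<lambda>x. x * _"] cong: if_cong)
  moreover have "(M ** transpose (arrow_matrix \<alpha> \<beta>)) $ \<xi> $ \<eta>
      = M $ \<xi> $ \<eta> + (if \<eta> = \<beta> then M $ \<xi> $ \<alpha> else 0)" for M :: "real^'a^'a" and \<xi> \<eta>
    by (simp add: arrow_matrix_def transpose_add matrix_add_ldistrib)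
       (simp add: matrix_matrix_mult_def transpose_def if_distrib[of "\<lambda>x. _ * x"] cong: if_cong)
  ultimately show ?thesis by simp
qed

text \<open>The arrows act on the forms \<open>\<Omega>\<close> by congruence.\<close>

lemma arrow_Omega:
  assumes "rauzy_arrow \<pi> \<alpha> \<beta> \<pi>'" "irreducible_pair (\<pi> :: 'a::finite perm_pair)" "CARD('a) \<ge> 2"
  shows "arrow_matrix \<alpha> \<beta> ** Omega \<pi> ** transpose (arrow_matrix \<alpha> \<beta>) = Omega \<pi>'"
  using assms
proof (induction rule: arrow_cases_swap)
  case (swap \<pi> \<alpha> \<beta> \<pi>')
  then have eq: "arrow_matrix \<alpha> \<beta> ** - Omega \<pi> ** transpose (arrow_matrix \<alpha> \<beta>) = - Omega \<pi>'"
    by (simp add: swap_irreducible swap_Omega)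
  have "arrow_matrix \<alpha> \<beta> ** - Omega \<pi> ** transpose (arrow_matrix \<alpha> \<beta>)
      = - (arrow_matrix \<alpha> \<beta> ** Omega \<pi> ** transpose (arrow_matrix \<alpha> \<beta>))"
    unfolding vec_eq_iff transform_by_arrow_nth vector_uminus_component by simp
  with eq show ?case by simp
next
  case (top t b \<alpha> \<beta>)
  have pp: "perm_pair (t, b)" using top by (simp add: irreducible_pair_def)
  note p = perm_pairD[OF pp]
  have ne: "\<alpha> \<noteq> \<beta>" using last_letters_distinct top by metis
  have lt: "t \<xi> < t \<alpha>" if "\<xi> \<noteq> \<alpha>" for \<xi> using p(4)[of \<xi>] injD[OF p(1), of \<xi> \<alpha>] that top by force
  have lb: "b \<xi> < b \<beta>" if "\<xi> \<noteq> \<beta>" for \<xi> using p(6)[of \<xi>] injD[OF p(2), of \<xi> \<beta>] that top by force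
  have row: "Omega (t, b) $ \<beta> $ \<eta> + Omega (t, b) $ \<alpha> $ \<eta> = Omega (t, move_after b \<alpha> \<beta>) $ \<beta> $ \<eta>"
    if "\<eta> \<noteq> \<beta>" for \<eta>
    using lt[of \<eta>] lb[of \<eta>] lt[of \<beta>] lb[of \<alpha>] ne that injD[OF p(1), of \<eta> \<beta>]
      injD[OF p(2), of \<eta> \<alpha>]
    by (cases "\<eta> = \<alpha>") (auto simp: Omega_def move_after_def)
  let ?\<Omega> = "Omega (t, b)" and ?\<Omega>' = "Omega (t, move_after b \<alpha> \<beta>)"
  have diag: "Omega \<pi> $ \<zeta> $ \<zeta> = 0" for \<pi> :: "'a perm_pair" and \<zeta> by (simp add: Omega_def)
  have "(arrow_matrix \<alpha> \<beta> ** ?\<Omega> ** transpose (arrow_matrix \<alpha> \<beta>)) $ \<xi> $ \<eta> = ?\<Omega>' $ \<xi> $ \<eta>" for \<xi> \<eta>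
  proof (cases "\<xi> = \<beta>"; cases "\<eta> = \<beta>")
    assume "\<xi> = \<beta>" "\<eta> = \<beta>"
    then show ?thesis
      using Omega_antisym[of "(t, b)" \<alpha> \<beta>] by (simp add: transform_by_arrow_nth diag)
  next
    assume "\<xi> = \<beta>" "\<eta> \<noteq> \<beta>"
    then show ?thesis using row[of \<eta>] by (simp add: transform_by_arrow_nth)
  next
    assume "\<xi> \<noteq> \<beta>" "\<eta> = \<beta>"
    then show ?thesis
      using row[of \<xi>] Omega_antisym[of "(t, b)" \<xi> \<beta>] Omega_antisym[of "(t, b)" \<xi> \<alpha>]
        Omega_antisym[of "(t, move_after b \<alpha> \<beta>)" \<xi> \<beta>]
      by (simp add: transform_by_arrow_nth)
  next
    assume "\<xi> \<noteq> \<beta>" "\<eta> \<noteq> \<beta>"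
    then have "?\<Omega> $ \<xi> $ \<eta> = ?\<Omega>' $ \<xi> $ \<eta>" by (auto simp: Omega_def move_after_def)
    with \<open>\<xi> \<noteq> \<beta>\<close> \<open>\<eta> \<noteq> \<beta>\<close> show ?thesis by (simp add: transform_by_arrow_nth)
  qed
  then show ?case by (simp add: vec_eq_iff)
qed

section \<open>Cycles of moves with the same winner\<close>

text \<open>The row \<open>b\<close> after \<open>k\<close> rotation steps of the letters in positions greater than \<open>m\<close>, where
  \<open>k \<le> d - m\<close>. After \<open>d - m\<close> steps the row is \<open>b\<close> again.\<close>

definition rot :: "('a::finite \<Rightarrow> nat) \<Rightarrow> nat \<Rightarrow> nat \<Rightarrow> 'a \<Rightarrow> nat" where
  "rot b m k \<xi> = (if b \<xi> \<le> m then b \<xi> else if b \<xi> + k \<le> CARD('a) then b \<xi> + k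
     else b \<xi> + k - (CARD('a) - m))"

lemma rot_arrow:
  fixes t b :: "'a::finite \<Rightarrow> nat"
  assumes b: "bij_betw b UNIV {1..CARD('a)}" and "t \<alpha> = CARD('a)" and k: "k < CARD('a) - b \<alpha>"
    and \<beta>: "b \<beta> = CARD('a) - k"
  shows "rauzy_arrow (t, rot b (b \<alpha>) k) \<alpha> \<beta> (t, rot b (b \<alpha>) (Suc k))"
proof -
  have eq: "\<xi> = \<beta>" if "b \<xi> = CARD('a) - k" for \<xi>
    using that \<beta> b by (metis perm_iff injD)
  have le: "b \<xi> \<le> CARD('a)" for \<xi> using b by (auto simp: perm_iff')
  have "move_after (rot b (b \<alpha>) k) \<alpha> \<beta> \<xi> = rot b (b \<alpha>) (Suc k) \<xi>" for \<xi>
  proof (cases "b \<xi> = CARD('a) - k")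
    case True
    with eq have "\<xi> = \<beta>" by blast
    with k \<beta> show ?thesis by (auto simp: rot_def move_after_def)
  next
    case False
    with \<beta> have "\<xi> \<noteq> \<beta>" by auto
    with False k le[of \<xi>] show ?thesis by (auto simp: rot_def move_after_def)
  qed
  then have step: "move_after (rot b (b \<alpha>) k) \<alpha> \<beta> = rot b (b \<alpha>) (Suc k)" by blast
  have "rot b (b \<alpha>) k \<beta> = CARD('a)" using k \<beta> by (auto simp: rot_def)
  from rauzy_arrow.top[of t \<alpha> "rot b (b \<alpha>) k" \<beta>, OF assms(2) this] show ?thesis unfolding step .
qed

lemma rot_0: "bij_betw b UNIV {1..CARD('a::finite)} \<Longrightarrow> rot (b :: 'a \<Rightarrow> nat) m 0 = b"
  by (auto simp: rot_def fun_eq_iff perm_iff')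

text \<open>The indicator vector of the last \<open>k\<close> letters of a row, which are the losers of the first \<open>k\<close> moves
  of a rotation.\<close>

definition last_letters_indicator :: "('a::finite \<Rightarrow> nat) \<Rightarrow> nat \<Rightarrow> real^'a" where
  "last_letters_indicator b k = (\<chi> \<xi>. if b \<xi> > CARD('a) - k then 1 else 0)"

lemma last_letters_indicator_0: "bij_betw b UNIV {1..CARD('a::finite)} \<Longrightarrow> last_letters_indicator (b :: 'a \<Rightarrow> nat) 0 = 0"
  by (auto simp: last_letters_indicator_def vec_eq_iff perm_iff' not_less)

lemma last_letters_indicator_Suc:
  fixes b :: "'a::finite \<Rightarrow> nat"
  assumes b: "bij_betw b UNIV {1..CARD('a)}" and "k < CARD('a)" and \<beta>: "b \<beta> = CARD('a) - k"
  shows "last_letters_indicator b (Suc k) = axis \<beta> 1 + last_letters_indicator b k"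
proof -
  have "b \<xi> = CARD('a) - k \<longleftrightarrow> \<xi> = \<beta>" for \<xi> using \<beta> b by (metis perm_iff injD)
  moreover have "n > CARD('a) - Suc k \<longleftrightarrow> n = CARD('a) - k \<or> n > CARD('a) - k" for n
    using assms(2) by auto
  ultimately have "b \<xi> > CARD('a) - Suc k \<longleftrightarrow> \<xi> = \<beta> \<or> b \<xi> > CARD('a) - k" for \<xi>
    by blast
  then show ?thesis
    using \<beta> by (auto simp: last_letters_indicator_def vec_eq_iff axis_def)
qed

lemma rot_path:
  fixes t b :: "'a::finite \<Rightarrow> nat"
  assumes b: "bij_betw b UNIV {1..CARD('a)}" and \<alpha>: "t \<alpha> = CARD('a)" and k: "k \<le> CARD('a) - b \<alpha>"
  shows "rauzy_path (t, b) (mat 1 + outer (last_letters_indicator b k) (axis \<alpha> 1)) (t, rot b (b \<alpha>) k)"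
  using k
proof (induction k)
  case 0
  have "outer 0 (axis \<alpha> 1) = (0 :: real^'a^'a)" by (simp add: outer_def vec_eq_iff)
  then show ?case unfolding last_letters_indicator_0[OF b] rot_0[OF b] by (simp add: rauzy_path.refl)
next
  case (Suc k)
  then have k: "k < CARD('a) - b \<alpha>" "k < CARD('a)" by auto
  have "1 \<le> CARD('a) - k" using k by simp
  then obtain \<beta> where \<beta>: "b \<beta> = CARD('a) - k"
    using perm_at[OF b, of "CARD('a) - k"] by (metis diff_le_self)
  have "axis \<alpha> 1 \<bullet> last_letters_indicator b k = 0"
    using k by (simp add: inner_axis' last_letters_indicator_def)
  then have "outer (axis \<beta> 1) (axis \<alpha> 1) ** outer (last_letters_indicator b k) (axis \<alpha> 1) = 0"
    by (simp add: matrix_mult_outer outer_mult_vec) (simp add: outer_def vec_eq_iff)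
  then have eq: "arrow_matrix \<alpha> \<beta> ** (mat 1 + outer (last_letters_indicator b k) (axis \<alpha> 1))
    = mat 1 + outer (last_letters_indicator b (Suc k)) (axis \<alpha> 1)"
    by (simp add: last_letters_indicator_Suc[OF b k(2) \<beta>] arrow_matrix_outer matrix_add_ldistrib
        matrix_add_rdistrib outer_add_left)
  have "rauzy_arrow (t, rot b (b \<alpha>) k) \<alpha> \<beta> (t, rot b (b \<alpha>) (Suc k))"
    by (rule rot_arrow[where t = t and \<alpha> = \<alpha>, OF b \<alpha> k(1) \<beta>])
  from rauzy_path.step[OF Suc.IH this] show ?case using k unfolding eq by simp
qed

lemma rauzy_path_trans:
  "rauzy_path \<pi>' C \<pi>'' \<Longrightarrow> rauzy_path \<pi> B \<pi>' \<Longrightarrow> rauzy_path \<pi> (C ** B) \<pi>''"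
  by (induction rule: rauzy_path.induct)
     (auto simp: matrix_mul_assoc[symmetric] intro: rauzy_path.step)

lemma rot_path_between:
  fixes t b :: "'a::finite \<Rightarrow> nat"
  assumes "bij_betw b UNIV {1..CARD('a)}" and "t \<alpha> = CARD('a)" and "j \<le> k" "k \<le> CARD('a) - b \<alpha>"
  shows "\<exists>B. rauzy_path (t, rot b (b \<alpha>) j) B (t, rot b (b \<alpha>) k)"
  using assms(3,4)
proof (induction k rule: dec_induct)
  case base
  then show ?case by (auto intro: rauzy_path.refl)
next
  case (step k)
  have "1 \<le> CARD('a) - k" using step by simp
  then obtain \<beta> where "b \<beta> = CARD('a) - k"
    using perm_at[OF assms(1), of "CARD('a) - k"] by (metis diff_le_self)
  then have "rauzy_arrow (t, rot b (b \<alpha>) k) \<alpha> \<beta> (t, rot b (b \<alpha>) (Suc k))"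
    using step rot_arrow[where t = t and \<alpha> = \<alpha>, OF assms(1,2)] by simp
  with step show ?case by (meson rauzy_path.step Suc_leD)
qed

lemma rot_full:
  fixes b :: "'a::finite \<Rightarrow> nat"
  shows "bij_betw b UNIV {1..CARD('a)} \<Longrightarrow> rot b (b \<alpha>) (CARD('a) - b \<alpha>) = b"
  by (auto simp: rot_def fun_eq_iff perm_iff')

text \<open>A full rotation of the letters to the right of \<open>\<alpha>\<close>: the losers are the letters \<open>\<xi>\<close> with
  \<open>\<Omega>\<^sub>\<xi>\<^sub>\<alpha> = 1\<close>, so the matrix is a transvection.\<close>

lemma top_loop:
  fixes t b :: "'a::finite \<Rightarrow> nat"
  assumes "perm_pair (t, b)" and \<alpha>: "t \<alpha> = CARD('a)"
  shows "rauzy_path (t, b) (mat 1 + outer (Omega (t, b) *v axis \<alpha> 1) (axis \<alpha> 1)) (t, b)"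
proof -
  note p = perm_pairD[OF assms(1)]
  have b: "bij_betw b UNIV {1..CARD('a)}" using assms by (simp add: perm_pair_def)
  have "t \<xi> < t \<alpha>" if "\<xi> \<noteq> \<alpha>" for \<xi>
    using p(4)[of \<xi>] injD[OF p(1), of \<xi> \<alpha>] that \<alpha> by force
  then have "Omega (t, b) $ \<xi> $ \<alpha> = (if b \<xi> > b \<alpha> then 1 else 0)" for \<xi>
    by (cases "\<xi> = \<alpha>") (auto simp: Omega_def dest: less_asym)
  then have "last_letters_indicator b (CARD('a) - b \<alpha>) = Omega (t, b) *v axis \<alpha> 1"
    using p(6)[of \<alpha>] by (simp add: last_letters_indicator_def vec_eq_iff matrix_vector_mult_axis_nth)
  then show ?thesis
    using rot_path[where t = t and \<alpha> = \<alpha>, OF b \<alpha> order_refl] p(6)[of \<alpha>] by (simp add: rot_full[OF b])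
qed

text \<open>The remaining arrows of a rotation lead back, so the Rauzy diagram is strongly connected.\<close>

lemma arrow_return:
  "rauzy_arrow \<pi> \<alpha> \<beta> \<pi>' \<Longrightarrow> irreducible_pair (\<pi> :: 'a::finite perm_pair) \<Longrightarrow> CARD('a) \<ge> 2 \<Longrightarrow>
    \<exists>B. rauzy_path \<pi>' B \<pi>"
proof (induction rule: arrow_cases_swap)
  case (swap \<pi> \<alpha> \<beta> \<pi>')
  then obtain B where "rauzy_path (prod.swap \<pi>') B (prod.swap \<pi>)"
    by (auto simp: swap_irreducible)
  from swap_path[OF this] show ?case by auto
next
  case (top t b \<alpha> \<beta>)
  have pp: "perm_pair (t, b)" using top by (simp add: irreducible_pair_def)
  note p = perm_pairD[OF pp]
  have ne: "\<alpha> \<noteq> \<beta>" using last_letters_distinct top by metis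
  have b: "bij_betw b UNIV {1..CARD('a)}" using pp by (simp add: perm_pair_def)
  have lt: "b \<alpha> < CARD('a)" using p(6)[of \<alpha>] injD[OF p(2), of \<alpha> \<beta>] ne top by force
  have eq: "b \<xi> = CARD('a) \<Longrightarrow> \<xi> = \<beta>" for \<xi> using injD[OF p(2), of \<xi> \<beta>] top by simp
  have "move_after b \<alpha> \<beta> \<xi> = rot b (b \<alpha>) (Suc 0) \<xi>" for \<xi>
    using lt top(2) eq[of \<xi>] p(6)[of \<xi>]
    by (cases "b \<xi> = CARD('a)") (auto simp: rot_def move_after_def)
  then have "move_after b \<alpha> \<beta> = rot b (b \<alpha>) (Suc 0)" by blast
  moreover have "\<exists>B. rauzy_path (t, rot b (b \<alpha>) (Suc 0)) B (t, rot b (b \<alpha>) (CARD('a) - b \<alpha>))"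
    using lt by (intro rot_path_between[where t = t and \<alpha> = \<alpha>] b top(1)) auto
  ultimately show ?case by (simp only: rot_full[OF b])
qed

lemma path_return:
  "rauzy_path \<pi> B \<pi>' \<Longrightarrow> irreducible_pair (\<pi> :: 'a::finite perm_pair) \<Longrightarrow> CARD('a) \<ge> 2 \<Longrightarrow>
    \<exists>C. rauzy_path \<pi>' C \<pi>"
proof (induction rule: rauzy_path.induct)
  case refl
  then show ?case by (auto intro: rauzy_path.refl)
next
  case (step B \<pi>' \<alpha> \<beta> \<pi>'')
  obtain C where C: "rauzy_path \<pi>' C \<pi>" using step by blast
  obtain D where "rauzy_path \<pi>'' D \<pi>'"
    using arrow_return[OF step(2) irreducible_path[OF step(1)]] step by blast
  from rauzy_path_trans[OF C this] show ?case by blast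
qed

section \<open>The matrix group generated by the closed paths\<close>

text \<open>The group generated by the matrices of closed paths at \<open>\<pi>\<close>, acting on all of \<open>\<real>\<^sup>d\<close> instead of the
  homology space. The third clause closes it under inverses, as \<open>A B = 1\<close> for square matrices means that \<open>B\<close>
  is the inverse of \<open>A\<close>.\<close>

inductive rv_matrix :: "'a::finite perm_pair \<Rightarrow> real^'a^'a \<Rightarrow> bool" for \<pi> where
  loop: "rauzy_path \<pi> B \<pi> \<Longrightarrow> rv_matrix \<pi> B"
| mult: "rv_matrix \<pi> A \<Longrightarrow> rv_matrix \<pi> B \<Longrightarrow> rv_matrix \<pi> (A ** B)"
| inverse: "rv_matrix \<pi> A \<Longrightarrow> A ** B = mat 1 \<Longrightarrow> rv_matrix \<pi> B"

definition int_matrix :: "real^'n^'m \<Rightarrow> bool" where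
  "int_matrix A \<longleftrightarrow> (\<forall>i j. A $ i $ j \<in> \<int>)"

lemma int_matrix_mult: "int_matrix A \<Longrightarrow> int_matrix B \<Longrightarrow> int_matrix (A ** B)"
  by (auto simp: int_matrix_def matrix_matrix_mult_def intro!: Ints_sum Ints_mult)

lemma int_matrix_id: "int_matrix (mat 1)"
  by (auto simp: int_matrix_def mat_def)

lemma matrix_inverse_commute: "A ** B = mat 1 \<longleftrightarrow> B ** A = mat (1 :: real)" for A B :: "real^'n^'n"
  by (rule matrix_left_right_inverse)

lemma matrix_inverse_cancel:
  fixes A B C :: "real^'n^'n"
  assumes "A ** B = mat 1"
  shows "A ** (B ** C) = C" "B ** (A ** C) = C" "C ** A ** B = C" "C ** B ** A = C"
  using assms matrix_inverse_commute[of A B]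
  by (simp_all add: matrix_mul_assoc) (simp_all add: matrix_mul_assoc[symmetric])

lemma arrow_matrix_inverse:
  assumes "\<alpha> \<noteq> \<beta>"
  shows "arrow_matrix \<alpha> \<beta> ** (mat 1 + outer (- axis \<beta> 1) (axis \<alpha> 1)) = mat 1"
proof -
  have "arrow_matrix \<alpha> \<beta> *v - axis \<beta> 1 = - axis \<beta> 1"
    using assms by (simp add: arrow_matrix_outer matrix_vector_mult_add_rdistrib outer_mult_vec inner_axis_axis)
  then show ?thesis
    by (simp add: matrix_add_ldistrib matrix_mult_outer) (simp add: arrow_matrix_outer outer_minus_left)
qed

lemma arrow_ne:
  assumes "rauzy_arrow \<pi> \<alpha> \<beta> \<pi>'" "irreducible_pair (\<pi> :: 'a::finite perm_pair)" "CARD('a) \<ge> 2"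
  shows "\<alpha> \<noteq> \<beta>"
  using assms
proof cases
  case (top t b)
  then show ?thesis using last_letters_distinct[of t b \<alpha> \<beta>] assms by simp
next
  case (bottom b t)
  then show ?thesis using last_letters_distinct[of t b \<beta> \<alpha>] assms by auto
qed

lemma path_Omega:
  assumes "rauzy_path \<pi> B \<pi>'" "irreducible_pair (\<pi> :: 'a::finite perm_pair)" "CARD('a) \<ge> 2"
  shows "B ** Omega \<pi> ** transpose B = Omega \<pi>'"
  using assms
proof (induction rule: rauzy_path.induct)
  case (step B \<pi>' \<alpha> \<beta> \<pi>'')
  let ?A = "arrow_matrix \<alpha> \<beta>"
  have "?A ** B ** Omega \<pi> ** transpose (?A ** B) = ?A ** (B ** Omega \<pi> ** transpose B) ** transpose ?A"
    by (simp add: matrix_transpose_mul matrix_mul_assoc)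
  also have "\<dots> = Omega \<pi>''"
    using step arrow_Omega[OF step(2) irreducible_path[OF step(1)]] by simp
  finally show ?case .
qed simp

lemma path_int_matrix: "rauzy_path \<pi> B \<pi>' \<Longrightarrow> int_matrix B"
proof (induction rule: rauzy_path.induct)
  case (step B \<pi>' \<alpha> \<beta> \<pi>'')
  moreover have "int_matrix (arrow_matrix \<alpha> \<beta>)"
    by (auto simp: int_matrix_def arrow_matrix_def mat_def)
  ultimately show ?case by (simp add: int_matrix_mult)
qed (simp add: int_matrix_id)

lemma path_int_inverse:
  assumes "rauzy_path \<pi> B \<pi>'" "irreducible_pair (\<pi> :: 'a::finite perm_pair)" "CARD('a) \<ge> 2"
  shows "\<exists>C. int_matrix C \<and> B ** C = mat 1"
  using assms
proof (induction rule: rauzy_path.induct)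
  case refl
  then show ?case by (auto intro: exI[of _ "mat 1"] int_matrix_id)
next
  case (step B \<pi>' \<alpha> \<beta> \<pi>'')
  then obtain C where C: "int_matrix C" "B ** C = mat 1" by blast
  have ne: "\<alpha> \<noteq> \<beta>" using arrow_ne[OF step(2) irreducible_path[OF step(1)]] step by simp
  let ?D = "mat 1 + outer (- axis \<beta> 1) (axis \<alpha> 1) :: real^'a^'a"
  have "int_matrix ?D"
    by (auto simp: int_matrix_def mat_def outer_def axis_def)
  moreover have "arrow_matrix \<alpha> \<beta> ** B ** (C ** ?D) = mat 1"
    by (simp add: matrix_mul_assoc[symmetric] matrix_inverse_cancel[OF C(2)] arrow_matrix_inverse[OF ne])
  ultimately show ?case using C int_matrix_mult by blast
qed

lemma rv_matrix_properties:
  assumes "rv_matrix \<pi> A" "irreducible_pair (\<pi> :: 'a::finite perm_pair)" "CARD('a) \<ge> 2"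
  shows "int_matrix A \<and> (\<exists>C. int_matrix C \<and> A ** C = mat 1) \<and> A ** Omega \<pi> ** transpose A = Omega \<pi>"
  using assms
proof (induction rule: rv_matrix.induct)
  case (loop B)
  then show ?case using path_int_matrix path_int_inverse path_Omega by metis
next
  case (mult A B)
  then obtain C D where CD: "int_matrix C" "A ** C = mat 1" "int_matrix D" "B ** D = mat 1" by auto
  then have "int_matrix (D ** C) \<and> A ** B ** (D ** C) = mat 1"
    by (simp add: int_matrix_mult matrix_mul_assoc[symmetric] matrix_inverse_cancel[OF CD(4)])
  moreover have "A ** B ** Omega \<pi> ** transpose (A ** B) = A ** (B ** Omega \<pi> ** transpose B) ** transpose A"
    by (simp add: matrix_transpose_mul matrix_mul_assoc)
  ultimately show ?case using mult by (auto simp: int_matrix_mult)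
next
  case (inverse A B)
  then obtain C where C: "int_matrix C" "A ** C = mat 1" and A: "A ** Omega \<pi> ** transpose A = Omega \<pi>"
    and "int_matrix A" by auto
  have BA: "B ** A = mat 1" using inverse matrix_inverse_commute by blast
  then have "B = C" by (metis C(2) matrix_mul_assoc matrix_mul_lid matrix_mul_rid)
  have "B ** Omega \<pi> ** transpose B = B ** (A ** Omega \<pi> ** transpose A) ** transpose B"
    by (simp add: A)
  also have "\<dots> = (B ** A) ** Omega \<pi> ** transpose (B ** A)"
    by (simp add: matrix_transpose_mul matrix_mul_assoc)
  also have "\<dots> = Omega \<pi>" by (simp add: BA)
  finally show ?case using \<open>B = C\<close> C BA \<open>int_matrix A\<close> by blast
qed

text \<open>Conjugation by a path maps the group at its end to the group at its start, although the inverse of a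
  path is not a path: if \<open>C\<close> is the matrix of a return path, then \<open>P\<^sup>-\<^sup>1 M P = (C P)\<^sup>-\<^sup>1 (C M P)\<close>.\<close>

lemma rv_matrix_conj:
  assumes P: "rauzy_path \<pi> P \<pi>'" and irr: "irreducible_pair (\<pi> :: 'a::finite perm_pair)" "CARD('a) \<ge> 2"
    and Q: "P ** Q = mat 1"
  shows "rv_matrix \<pi>' M \<Longrightarrow> rv_matrix \<pi> (Q ** M ** P)"
proof (induction rule: rv_matrix.induct)
  case (loop M)
  obtain C where C: "rauzy_path \<pi>' C \<pi>" using path_return[OF P irr] by blast
  obtain D where D: "C ** D = mat 1"
    using path_int_inverse[OF C irreducible_path[OF P irr(1)] irr(2)] by blast
  have "rv_matrix \<pi> (C ** P)" "rv_matrix \<pi> (C ** (M ** P))"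
    using P C loop by (blast intro: rv_matrix.loop rauzy_path_trans)+
  moreover have "C ** P ** (Q ** D) = mat 1"
    by (simp add: matrix_mul_assoc[symmetric] matrix_inverse_cancel[OF Q] D)
  ultimately have "rv_matrix \<pi> ((Q ** D) ** (C ** (M ** P)))"
    by (blast intro: rv_matrix.intros)
  then show ?case by (simp add: matrix_mul_assoc[symmetric] matrix_inverse_cancel[OF D])
next
  case (mult A B)
  have "(Q ** A ** P) ** (Q ** B ** P) = Q ** (A ** B) ** P"
    by (simp add: matrix_mul_assoc[symmetric] matrix_inverse_cancel[OF Q])
  then show ?case using mult by (metis rv_matrix.mult)
next
  case (inverse A B)
  have "(Q ** A ** P) ** (Q ** B ** P) = Q ** (A ** B) ** P"
    by (simp add: matrix_mul_assoc[symmetric] matrix_inverse_cancel[OF Q])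
  also have "\<dots> = mat 1" using inverse Q matrix_inverse_commute[of P Q] by simp
  finally show ?case using inverse by (blast intro: rv_matrix.inverse)
qed

lemma rv_matrix_conj':
  assumes P: "rauzy_path \<pi> P \<pi>'" and irr: "irreducible_pair (\<pi> :: 'a::finite perm_pair)" "CARD('a) \<ge> 2"
    and Q: "P ** Q = mat 1"
  shows "rv_matrix \<pi> M \<Longrightarrow> rv_matrix \<pi>' (P ** M ** Q)"
proof (induction rule: rv_matrix.induct)
  case (loop M)
  obtain C where C: "rauzy_path \<pi>' C \<pi>" using path_return[OF P irr] by blast
  obtain D where D: "C ** D = mat 1"
    using path_int_inverse[OF C irreducible_path[OF P irr(1)] irr(2)] by blast
  have "rv_matrix \<pi>' (P ** C)" "rv_matrix \<pi>' (P ** (M ** C))"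
    using P C loop by (blast intro: rv_matrix.loop rauzy_path_trans)+
  moreover have "P ** C ** (D ** Q) = mat 1"
    by (simp add: matrix_mul_assoc[symmetric] matrix_inverse_cancel[OF D] Q)
  ultimately have "rv_matrix \<pi>' ((P ** (M ** C)) ** (D ** Q))"
    by (blast intro: rv_matrix.intros)
  then show ?case by (simp add: matrix_mul_assoc[symmetric] matrix_inverse_cancel[OF D])
next
  case (mult A B)
  have "(P ** A ** Q) ** (P ** B ** Q) = P ** (A ** B) ** Q"
    by (simp add: matrix_mul_assoc[symmetric] matrix_inverse_cancel[OF Q])
  then show ?case using mult by (metis rv_matrix.mult)
next
  case (inverse A B)
  have "(P ** A ** Q) ** (P ** B ** Q) = P ** (A ** B) ** Q"
    by (simp add: matrix_mul_assoc[symmetric] matrix_inverse_cancel[OF Q])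
  also have "\<dots> = mat 1" using inverse Q by simp
  finally show ?case using inverse by (blast intro: rv_matrix.inverse)
qed

section \<open>Transvections in the group\<close>

text \<open>It acts on the homology space as \<open>x \<mapsto> x + \<langle>\<Omega> u, x\<rangle> \<Omega> u\<close>, the transvection along \<open>\<Omega> u\<close>.\<close>

definition transvection_by :: "real^'a^'a \<Rightarrow> real^'a \<Rightarrow> real^'a^'a" where
  "transvection_by \<Omega> u = mat 1 + outer (\<Omega> *v u) u"

text \<open>The set \<open>U\<^sub>\<pi>\<close> of the vectors \<open>u\<close> whose transvection belongs to the group at \<open>\<pi>\<close>.\<close>

definition transvection_vectors :: "'a::finite perm_pair \<Rightarrow> (real^'a) set" where
  "transvection_vectors \<pi> = {u. rv_matrix \<pi> (transvection_by (Omega \<pi>) u)}"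

lemma inner_Omega: "u \<bullet> (Omega \<pi> *v v) = - ((Omega \<pi> *v u) \<bullet> v)"
proof -
  have "u \<bullet> (Omega \<pi> *v v) = (transpose (Omega \<pi>) *v u) \<bullet> v"
    by (metis dot_lmul_matrix inner_commute vector_transpose_matrix transpose_transpose)
  also have "\<dots> = - ((Omega \<pi> *v u) \<bullet> v)"
    by (simp add: transpose_Omega matrix_vector_mult_def inner_vec_def sum_negf)
  finally show ?thesis .
qed

lemma inner_Omega_self: "u \<bullet> (Omega \<pi> *v u) = 0"
  using inner_Omega[of u \<pi> u] by (simp add: inner_commute)

lemma transvection_inverse:
  "(mat 1 + outer (- (Omega \<pi> *v u)) u) ** transvection_by (Omega \<pi>) u = mat 1"
proof -
  have "outer (Omega \<pi> *v u) u ** outer (Omega \<pi> *v u) u = 0"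
    by (simp add: matrix_mult_outer outer_mult_vec inner_Omega_self) (simp add: outer_def vec_eq_iff)
  moreover have "outer (- (Omega \<pi> *v u)) u ** X = - (outer (Omega \<pi> *v u) u ** X)" for X :: "real^'a^'a"
    unfolding outer_mult_matrix by (rule outer_minus_left)
  ultimately show ?thesis
    unfolding transvection_by_def matrix_add_ldistrib matrix_add_rdistrib outer_minus_left by simp
qed

lemma transvection_conj:
  fixes P Q \<Omega> :: "real^'a^'a"
  assumes "P ** \<Omega> ** transpose P = \<Omega>'" "P ** Q = mat 1"
  shows "Q ** transvection_by \<Omega>' u ** P = transvection_by \<Omega> (transpose P *v u)"
proof -
  have QP: "Q ** P = mat 1" using assms matrix_inverse_commute by blast
  have "Q *v (\<Omega>' *v u) = (Q ** P) *v (\<Omega> *v (transpose P *v u))"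
    unfolding assms(1)[symmetric] matrix_vector_mul_assoc matrix_mul_assoc ..
  then show ?thesis
    by (simp add: transvection_by_def matrix_add_ldistrib matrix_add_rdistrib QP matrix_mult_outer
        outer_mult_matrix)
qed

lemma transvection_vectors_path:
  assumes P: "rauzy_path \<pi> P \<pi>'" and irr: "irreducible_pair (\<pi> :: 'a::finite perm_pair)" "CARD('a) \<ge> 2"
  shows "transpose P *v u \<in> transvection_vectors \<pi> \<longleftrightarrow> u \<in> transvection_vectors \<pi>'"
proof -
  obtain Q where Q: "P ** Q = mat 1" using path_int_inverse[OF assms] by blast
  note T = transvection_conj[OF path_Omega[OF assms] Q, of u]
  have "P ** (Q ** X ** P) ** Q = X" for X
    by (simp add: matrix_mul_assoc[symmetric] matrix_inverse_cancel[OF Q] Q)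
  with rv_matrix_conj[OF assms Q] rv_matrix_conj'[OF assms Q] T show ?thesis
    unfolding transvection_vectors_def mem_Collect_eq by metis
qed

lemma transvection_vectors_act:
  assumes M: "rv_matrix \<pi> M" and irr: "irreducible_pair (\<pi> :: 'a::finite perm_pair)" "CARD('a) \<ge> 2"
    and w: "w \<in> transvection_vectors \<pi>"
  shows "transpose M *v w \<in> transvection_vectors \<pi>"
proof -
  obtain Q where Q: "M ** Q = mat 1" and \<Omega>: "M ** Omega \<pi> ** transpose M = Omega \<pi>"
    using rv_matrix_properties[OF M irr] by blast
  have "rv_matrix \<pi> (Q ** transvection_by (Omega \<pi>) w ** M)"
    using M Q w by (auto simp: transvection_vectors_def intro: rv_matrix.intros)
  then show ?thesis by (simp add: transvection_conj[OF \<Omega> Q] transvection_vectors_def)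
qed

lemma transvection_vectors_add:
  assumes irr: "irreducible_pair (\<pi> :: 'a::finite perm_pair)" "CARD('a) \<ge> 2"
    and u: "u \<in> transvection_vectors \<pi>" and w: "w \<in> transvection_vectors \<pi>"
    and uw: "\<bar>w \<bullet> (Omega \<pi> *v u)\<bar> = 1"
  shows "w + u \<in> transvection_vectors \<pi>"
proof -
  let ?c = "w \<bullet> (Omega \<pi> *v u)"
  have tr: "transpose (mat 1 + outer x u) *v w = w + (w \<bullet> x) *\<^sub>R u" for x
    by (simp add: transpose_add transpose_outer matrix_vector_mult_add_rdistrib outer_mult_vec inner_commute)
  have T: "rv_matrix \<pi> (transvection_by (Omega \<pi>) u)" using u by (simp add: transvection_vectors_def)
  have T': "rv_matrix \<pi> (mat 1 + outer (- (Omega \<pi> *v u)) u)"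
    using rv_matrix.inverse[OF T] transvection_inverse matrix_inverse_commute by blast
  have "w + ?c *\<^sub>R u \<in> transvection_vectors \<pi>"
    using transvection_vectors_act[OF T irr w] unfolding transvection_by_def tr .
  moreover have "w + (- ?c) *\<^sub>R u \<in> transvection_vectors \<pi>"
    using transvection_vectors_act[OF T' irr w] unfolding tr by simp
  moreover have "?c = 1 \<or> ?c = - 1" using uw by linarith
  ultimately show ?thesis by auto
qed

lemma top_last_transvection:
  assumes "perm_pair (t, b)" "t \<alpha> = CARD('a::finite)"
  shows "axis (\<alpha>::'a) 1 \<in> transvection_vectors (t, b)"
  using rv_matrix.loop[OF top_loop[OF assms]] by (simp add: transvection_vectors_def transvection_by_def)

lemma bottom_last_transvection:
  assumes "perm_pair (t, b)" "b \<beta> = CARD('a::finite)"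
  shows "axis (\<beta>::'a) 1 \<in> transvection_vectors (t, b)"
proof -
  have "perm_pair (b, t)" using assms by (simp add: perm_pair_def)
  from swap_path[OF top_loop[OF this assms(2)]]
  have "rv_matrix (t, b) (mat 1 + outer (Omega (b, t) *v axis \<beta> 1) (axis \<beta> 1))"
    by (auto intro: rv_matrix.loop)
  moreover have "Omega (b, t) *v x = - (Omega (t, b) *v x)" for x
    using swap_Omega[of "(t, b)"] by (simp add: matrix_vector_mult_def sum_negf vec_eq_iff)
  ultimately show ?thesis
    using rv_matrix.inverse transvection_inverse by (metis mem_Collect_eq transvection_vectors_def)
qed

text \<open>The letters \<open>\<xi>\<close> with \<open>e\<^sub>\<xi> \<in> U\<^sub>\<pi>\<close>.\<close>

definition transvection_letters :: "'a::finite perm_pair \<Rightarrow> 'a set" where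
  "transvection_letters \<pi> = {\<xi>. axis \<xi> 1 \<in> transvection_vectors \<pi>}"

lemma inner_Omega_axis: "axis \<xi> 1 \<bullet> (Omega \<pi> *v axis \<eta> 1) = Omega \<pi> $ \<xi> $ \<eta>"
  by (simp add: inner_axis' matrix_vector_mult_axis_nth)

lemma last_letters_Omega:
  assumes "irreducible_pair (t, b)" "CARD('a::finite) \<ge> 2" "t \<alpha> = CARD('a)" "b (\<beta>::'a) = CARD('a)"
  shows "Omega (t, b) $ \<beta> $ \<alpha> = 1"
proof -
  have pp: "perm_pair (t, b)" using assms by (simp add: irreducible_pair_def)
  note p = perm_pairD[OF pp]
  have ne: "\<alpha> \<noteq> \<beta>" using last_letters_distinct[OF assms] .
  then have "t \<beta> < t \<alpha>" "b \<alpha> < b \<beta>"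
    using p(4)[of \<beta>] p(6)[of \<alpha>] injD[OF p(1), of \<beta> \<alpha>] injD[OF p(2), of \<alpha> \<beta>] assms by force+
  then show ?thesis by (simp add: Omega_def)
qed

text \<open>The key step: \<open>B\<^sup>T\<close> only moves \<open>e\<^sub>\<beta>\<close>, and both \<open>e\<^sub>\<beta>\<close> and its image \<open>e\<^sub>\<beta> + e\<^sub>\<alpha>\<close> lie in \<open>U\<^sub>\<pi>\<close>.\<close>

lemma transvection_letters_arrow:
  assumes arr: "rauzy_arrow \<pi> \<alpha> \<beta> \<pi>'" and irr: "irreducible_pair (\<pi> :: 'a::finite perm_pair)" "CARD('a) \<ge> 2"
  shows "transvection_letters \<pi>' = transvection_letters \<pi>" "\<alpha> \<in> transvection_letters \<pi>" "\<beta> \<in> transvection_letters \<pi>"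
proof -
  have pp: "perm_pair \<pi>" using irr by (simp add: irreducible_pair_def)
  have "axis \<alpha> 1 \<in> transvection_vectors \<pi> \<and> axis \<beta> 1 \<in> transvection_vectors \<pi> \<and>
    \<bar>axis \<beta> 1 \<bullet> (Omega \<pi> *v axis \<alpha> 1)\<bar> = 1"
    using arr
  proof cases
    case (top t b)
    then show ?thesis
      using pp irr top_last_transvection bottom_last_transvection last_letters_Omega[of t b \<alpha> \<beta>]
      by (auto simp: inner_Omega_axis)
  next
    case (bottom b t)
    then show ?thesis
      using pp irr top_last_transvection bottom_last_transvection last_letters_Omega[of t b \<beta> \<alpha>]
        Omega_antisym[of "(t, b)" \<alpha> \<beta>]
      by (auto simp: inner_Omega_axis)
  qed
  then have ab: "axis \<alpha> 1 \<in> transvection_vectors \<pi>" "axis \<beta> 1 \<in> transvection_vectors \<pi>"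
    "\<bar>axis \<beta> 1 \<bullet> (Omega \<pi> *v axis \<alpha> 1)\<bar> = 1" by blast+
  show "\<alpha> \<in> transvection_letters \<pi>" "\<beta> \<in> transvection_letters \<pi>"
    using ab by (auto simp: transvection_letters_def)
  have path: "rauzy_path \<pi> (arrow_matrix \<alpha> \<beta>) \<pi>'"
    using rauzy_path.step[OF rauzy_path.refl arr] by simp
  have tr: "transpose (arrow_matrix \<alpha> \<beta>) *v axis \<xi> 1 = axis \<xi> 1 + (if \<xi> = \<beta> then axis \<alpha> 1 else 0)" for \<xi>
    by (simp add: arrow_matrix_outer transpose_add transpose_outer matrix_vector_mult_add_rdistrib
        outer_mult_vec inner_axis_axis)
  have "axis \<beta> 1 + axis \<alpha> 1 \<in> transvection_vectors \<pi>"
    by (rule transvection_vectors_add[OF irr ab])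
  then have "axis \<xi> 1 \<in> transvection_vectors \<pi>' \<longleftrightarrow> axis \<xi> 1 \<in> transvection_vectors \<pi>" for \<xi>
    using transvection_vectors_path[OF path irr, of "axis \<xi> 1"] ab(2) unfolding tr
    by (auto split: if_splits)
  then show "transvection_letters \<pi>' = transvection_letters \<pi>"
    by (auto simp: transvection_letters_def)
qed

lemma transvection_letters_path:
  assumes "rauzy_path \<pi> B \<pi>'" "irreducible_pair (\<pi> :: 'a::finite perm_pair)" "CARD('a) \<ge> 2"
  shows "transvection_letters \<pi>' = transvection_letters \<pi>"
  using assms
proof (induction rule: rauzy_path.induct)
  case (step B \<pi>' \<alpha> \<beta> \<pi>'')
  then show ?case
    using transvection_letters_arrow(1)[OF step(2) irreducible_path[OF step(1)]] by simp
qed simp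

section \<open>Every letter comes last in some row\<close>

text \<open>During the rotation won by \<open>\<alpha>\<close>, every letter to its right in the other row comes last once.\<close>

lemma right_of_winner:
  fixes \<pi> :: "'a::finite perm_pair"
  assumes R: "rauzy_path \<pi> B (t, b)" and pp: "perm_pair (t, b)" and \<alpha>: "t \<alpha> = CARD('a)"
    and \<xi>: "b \<xi> > b \<alpha>"
  shows "\<exists>C t' b'. rauzy_path \<pi> C (t', b') \<and> b' \<xi> = CARD('a)"
proof -
  have b: "bij_betw b UNIV {1..CARD('a)}" using pp by (simp add: perm_pair_def)
  have le: "b \<xi> \<le> CARD('a)" using perm_pairD[OF pp] by blast
  let ?k = "CARD('a) - b \<xi>"
  have k: "?k \<le> CARD('a) - b \<alpha>" using \<xi> by simp
  have "rot b (b \<alpha>) ?k \<xi> = CARD('a)" using le \<xi> by (simp add: rot_def)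
  then show ?thesis using rauzy_path_trans[OF rot_path[where t = t and \<alpha> = \<alpha>, OF b \<alpha> k] R] by blast
qed

text \<open>Let \<open>N\<close> be the set of the letters that never come last. Along all paths they stay to the left of the
  winners, so they never move, nor does any letter to their left; hence the latter belong to
  \<open>N\<close> too. Thus \<open>N\<close> consists of the first letters of both rows, against irreducibility.\<close>

lemma every_letter_last:
  fixes \<pi> :: "'a::finite perm_pair"
  assumes irr: "irreducible_pair \<pi>" and d: "CARD('a) \<ge> 2"
  shows "\<exists>B t b. rauzy_path \<pi> B (t, b) \<and> (t \<xi> = CARD('a) \<or> b \<xi> = CARD('a))"
proof (rule ccontr)
  obtain t0 b0 where \<pi>: "\<pi> = (t0, b0)" by (cases \<pi>)
  define N where "N = {\<xi>. \<forall>B t b. rauzy_path \<pi> B (t, b) \<longrightarrow> t \<xi> \<noteq> CARD('a) \<and> b \<xi> \<noteq> CARD('a)}"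
  assume "\<not> ?thesis"
  then have "\<xi> \<in> N" by (auto simp: N_def)
  define kt where "kt = Max (t0 ` N)"
  define kb where "kb = Max (b0 ` N)"
  have "kt \<in> t0 ` N" "kb \<in> b0 ` N"
    unfolding kt_def kb_def using \<open>\<xi> \<in> N\<close> by (auto intro!: Max_in)
  then obtain \<nu>t \<nu>b where \<nu>: "\<nu>t \<in> N" "t0 \<nu>t = kt" "\<nu>b \<in> N" "b0 \<nu>b = kb" by auto
  have pp: "perm_pair (t, b)" if "rauzy_path \<pi> B (t, b)" for B t b
    using irreducible_path[OF that irr] by (simp add: irreducible_pair_def)
  have left_b: "b \<nu> < b \<alpha>" if "rauzy_path \<pi> B (t, b)" "t \<alpha> = CARD('a)" "\<nu> \<in> N" for B t b \<alpha> \<nu>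
  proof -
    have "\<nu> \<noteq> \<alpha>" using that by (auto simp: N_def)
    then have "b \<nu> \<noteq> b \<alpha>" using perm_pairD(2)[OF pp[OF that(1)]] by (auto dest: injD)
    moreover have "\<not> b \<nu> > b \<alpha>"
      using right_of_winner[OF that(1) pp[OF that(1)] that(2), of \<nu>] that(3) by (auto simp: N_def)
    ultimately show ?thesis by simp
  qed
  have left_t: "t \<nu> < t \<beta>" if that: "rauzy_path \<pi> B (t, b)" "b \<beta> = CARD('a)" "\<nu> \<in> N" for B t b \<beta> \<nu>
  proof -
    note last = that(2)
    have "\<nu> \<noteq> \<beta>" using that by (auto simp: N_def)
    then have "t \<nu> \<noteq> t \<beta>" using perm_pairD(1)[OF pp[OF that(1)]] by (auto dest: injD)
    moreover have "\<not> t \<nu> > t \<beta>"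
    proof
      assume less: "t \<nu> > t \<beta>"
      have "perm_pair (b, t)" using pp[OF that(1)] by (simp add: perm_pair_def)
      moreover have "rauzy_path (prod.swap \<pi>) B (b, t)" using swap_path[OF that(1)] by simp
      ultimately obtain C t' b' where "rauzy_path (prod.swap \<pi>) C (t', b')" "b' \<nu> = CARD('a)"
        using right_of_winner[of "prod.swap \<pi>" B b t \<beta> \<nu>] last less by blast
      from swap_path[OF this(1)] this(2) that(3) show False by (auto simp: N_def)
    qed
    ultimately show ?thesis by simp
  qed
  have fixed: "(\<forall>\<eta>. t0 \<eta> \<le> kt \<longrightarrow> fst \<pi>' \<eta> = t0 \<eta>) \<and> (\<forall>\<eta>. b0 \<eta> \<le> kb \<longrightarrow> snd \<pi>' \<eta> = b0 \<eta>)"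
    if "rauzy_path \<pi> B \<pi>'" for B \<pi>'
    using that
  proof (induction rule: rauzy_path.induct)
    case refl
    then show ?case by (simp add: \<pi>)
  next
    case (step B \<pi>' \<alpha> \<beta> \<pi>'')
    from step(2) show ?case
    proof cases
      case (top t b)
      have "b \<nu>b < b \<alpha>" using left_b[of B t b \<alpha> \<nu>b] step(1) top \<nu> by simp
      then have "kb < b \<alpha>" using step(3) \<nu> top by auto
      then show ?thesis using step(3) top by (auto simp: move_after_def)
    next
      case (bottom b t)
      have "t \<nu>t < t \<alpha>" using left_t[of B t b \<alpha> \<nu>t] step(1) bottom \<nu> by simp
      then have "kt < t \<alpha>" using step(3) \<nu> bottom by auto
      then show ?thesis using step(3) bottom by (auto simp: move_after_def)
    qed
  qed
  note p0 = perm_pairD[OF pp[of "mat 1" t0 b0, unfolded \<pi>, OF rauzy_path.refl]]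
  have kt_lt: "kt < t \<beta>" and kb_lt: "kb < b \<alpha>"
    if "rauzy_path \<pi> B (t, b)" "t \<alpha> = CARD('a)" "b \<beta> = CARD('a)" for B t b \<alpha> \<beta>
    using left_b[OF that(1,2) \<nu>(3)] left_t[OF that(1,3) \<nu>(1)] fixed[OF that(1)] \<nu> by auto
  have last: "\<exists>\<alpha> \<beta>. t \<alpha> = CARD('a) \<and> b \<beta> = CARD('a)" if "rauzy_path \<pi> B (t, b)" for B t b
    using pp[OF that] d perm_at[of t "CARD('a)"] perm_at[of b "CARD('a)"]
    by (metis Suc_1 Suc_leD fst_conv snd_conv le_refl perm_pair_def One_nat_def)
  have Nb: "\<eta> \<in> N" if "b0 \<eta> \<le> kb" for \<eta>
    unfolding N_def
  proof (intro CollectI allI impI)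
    fix B t b assume P: "rauzy_path \<pi> B (t, b)"
    obtain \<alpha> \<beta> where l: "t \<alpha> = CARD('a)" "b \<beta> = CARD('a)" using last[OF P] by blast
    have "b \<eta> < b \<alpha>" using kb_lt[OF P l] fixed[OF P] that by force
    moreover have "b \<alpha> \<le> CARD('a)" using perm_pairD[OF pp[OF P]] by blast
    moreover have "\<eta> \<noteq> \<alpha>" using calculation by auto
    ultimately show "t \<eta> \<noteq> CARD('a) \<and> b \<eta> \<noteq> CARD('a)"
      using l injD[OF perm_pairD(1)[OF pp[OF P]], of \<eta> \<alpha>] by auto
  qed
  have Nt: "\<eta> \<in> N" if "t0 \<eta> \<le> kt" for \<eta>
    unfolding N_def
  proof (intro CollectI allI impI)
    fix B t b assume P: "rauzy_path \<pi> B (t, b)"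
    obtain \<alpha> \<beta> where l: "t \<alpha> = CARD('a)" "b \<beta> = CARD('a)" using last[OF P] by blast
    have "t \<eta> < t \<beta>" using kt_lt[OF P l] fixed[OF P] that by force
    moreover have "t \<beta> \<le> CARD('a)" using perm_pairD[OF pp[OF P]] by blast
    moreover have "\<eta> \<noteq> \<beta>" using calculation by auto
    ultimately show "t \<eta> \<noteq> CARD('a) \<and> b \<eta> \<noteq> CARD('a)"
      using l injD[OF perm_pairD(2)[OF pp[OF P]], of \<eta> \<beta>] by auto
  qed
  have "t0 \<eta> \<le> kt" "b0 \<eta> \<le> kb" if "\<eta> \<in> N" for \<eta> using that by (simp_all add: kt_def kb_def)
  then have Neq: "N = {\<eta>. t0 \<eta> \<le> kt}" "N = {\<eta>. b0 \<eta> \<le> kb}" using Nb Nt by blast+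
  have bij: "bij_betw t0 UNIV {1..CARD('a)}" "bij_betw b0 UNIV {1..CARD('a)}"
    using irr by (simp_all add: \<pi> irreducible_pair_def perm_pair_def)
  have "kt \<le> CARD('a)" "kb \<le> CARD('a)" using \<nu> p0(4)[of \<nu>t] p0(6)[of \<nu>b] by simp_all
  then have k: "kt = kb" using card_initial[OF bij(1)] card_initial[OF bij(2)] Neq by metis
  obtain \<alpha> \<beta> where l: "t0 \<alpha> = CARD('a)" "b0 \<beta> = CARD('a)"
    using last[of "mat 1" t0 b0] rauzy_path.refl[of \<pi>] by (auto simp: \<pi>)
  have "kb < b0 \<alpha>" using kb_lt[of "mat 1" t0 b0] rauzy_path.refl[of \<pi>] l by (auto simp: \<pi>)
  then have "kb < CARD('a)" using p0(6)[of \<alpha>] by simp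
  moreover have "1 \<le> kb" using p0(5)[of \<nu>b] \<nu> by simp
  ultimately show False using irr Neq k by (auto simp: irreducible_pair_def \<pi>)
qed

lemma transvection_letters_UNIV:
  fixes \<pi> :: "'a::finite perm_pair"
  assumes irr: "irreducible_pair \<pi>" and d: "CARD('a) \<ge> 2"
  shows "axis \<xi> 1 \<in> transvection_vectors \<pi>"
proof -
  obtain B t b where P: "rauzy_path \<pi> B (t, b)" and l: "t \<xi> = CARD('a) \<or> b \<xi> = CARD('a)"
    using every_letter_last[OF assms] by blast
  have "perm_pair (t, b)" using irreducible_path[OF P irr] by (simp add: irreducible_pair_def)
  with l have "\<xi> \<in> transvection_letters (t, b)"
    by (auto simp: transvection_letters_def top_last_transvection bottom_last_transvection)
  then have "\<xi> \<in> transvection_letters \<pi>" unfolding transvection_letters_path[OF P assms] .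
  then show ?thesis by (simp add: transvection_letters_def)
qed

text \<open>Suppose that no inversion joins \<open>S\<close> and its complement, and let \<open>S\<close> contain the first top letter. The
  top letters before the first one outside \<open>S\<close> then precede all other letters in the bottom row as well.\<close>

lemma inversion_graph_connected:
  fixes \<pi> :: "'a::finite perm_pair"
  assumes irr: "irreducible_pair \<pi>" and S: "S \<noteq> {}" "S \<noteq> UNIV"
  shows "\<exists>\<xi> \<in> S. \<exists>\<eta> \<in> - S. Omega \<pi> $ \<xi> $ \<eta> \<noteq> 0"
proof (rule ccontr)
  obtain t b where \<pi>: "\<pi> = (t, b)" by (cases \<pi>)
  have pp: "perm_pair (t, b)" using irr by (simp add: irreducible_pair_def \<pi>)
  note p = perm_pairD[OF pp]
  have bij: "bij_betw t UNIV {1..CARD('a)}" "bij_betw b UNIV {1..CARD('a)}"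
    using pp by (simp_all add: perm_pair_def)
  assume none: "\<not> ?thesis"
  have ord0: "t \<xi> < t \<eta> \<longleftrightarrow> b \<xi> < b \<eta>" if "\<xi> \<in> S" "\<eta> \<notin> S" for \<xi> \<eta>
  proof -
    have "Omega (t, b) $ \<xi> $ \<eta> = 0" "\<xi> \<noteq> \<eta>" using none that by (auto simp: \<pi>)
    then have "t \<xi> \<noteq> t \<eta>" "b \<xi> \<noteq> b \<eta>" "\<not> (t \<xi> < t \<eta> \<and> b \<xi> > b \<eta>)" "\<not> (t \<xi> > t \<eta> \<and> b \<xi> < b \<eta>)"
      using p(1,2)[THEN injD, of \<xi> \<eta>] by (auto simp: Omega_def split: if_splits)
    then show ?thesis by linarith
  qed
  obtain \<zeta> where \<zeta>: "t \<zeta> = 1" using perm_at[OF bij(1), of 1] by auto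
  define S' where "S' = (if \<zeta> \<in> S then S else - S)"
  have ord: "t \<xi> < t \<eta> \<longleftrightarrow> b \<xi> < b \<eta>" if "\<xi> \<in> S'" "\<eta> \<notin> S'" for \<xi> \<eta>
    using that ord0[of \<xi> \<eta>] ord0[of \<eta> \<xi>] p(1,2)[THEN injD, of \<xi> \<eta>]
    by (auto simp: S'_def split: if_splits) (metis linorder_neqE_nat not_less_iff_gr_or_eq)+
  have "\<zeta> \<in> S'" "- S' \<noteq> {}" using S by (auto simp: S'_def)
  define y where "y = (ARG_MIN t y. y \<in> - S')"
  have y: "y \<notin> S'" and ymin: "t y \<le> t \<eta>" if "\<eta> \<notin> S'" for \<eta>
    using \<open>- S' \<noteq> {}\<close> arg_min_natI[of "\<lambda>y. y \<in> - S'" _ t] arg_min_nat_le[of "\<lambda>y. y \<in> - S'" \<eta> t] that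
    by (auto simp: y_def)
  have y: "y \<notin> S'" using \<open>- S' \<noteq> {}\<close> y by blast
  define T where "T = {\<xi>. t \<xi> < t y}"
  have TS: "T \<subseteq> S'" using ymin by (force simp: T_def)
  have below: "b \<xi> < b \<eta>" if "\<xi> \<in> T" "\<eta> \<notin> T" for \<xi> \<eta>
  proof (cases "\<eta> \<in> S'")
    case False
    then show ?thesis using ymin[OF False] ord[of \<xi> \<eta>] that TS by (auto simp: T_def)
  next
    case True
    have "b \<xi> < b y" using ord[of \<xi> y] that TS y by (auto simp: T_def)
    also have "b y \<le> b \<eta>" using ord[OF True y] that by (auto simp: T_def not_less)
    finally show ?thesis .
  qed
  have "\<zeta> \<in> T" using \<zeta> \<open>\<zeta> \<in> S'\<close> y p(3)[of y] p(1)[THEN injD, of \<zeta> y] by (auto simp: T_def order.strict_iff_order)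
  define k where "k = Max (b ` T)"
  have "k \<in> b ` T" unfolding k_def using \<open>\<zeta> \<in> T\<close> by (auto intro!: Max_in)
  then obtain \<nu> where \<nu>: "\<nu> \<in> T" "b \<nu> = k" by auto
  have Tb: "T = {\<xi>. b \<xi> \<le> k}"
  proof (rule subset_antisym)
    show "T \<subseteq> {\<xi>. b \<xi> \<le> k}" by (auto simp: k_def)
    show "{\<xi>. b \<xi> \<le> k} \<subseteq> T"
    proof
      fix \<xi> assume "\<xi> \<in> {\<xi>. b \<xi> \<le> k}"
      then show "\<xi> \<in> T" using below[OF \<nu>(1), of \<xi>] \<nu>(2) by force
    qed
  qed
  have y1: "t y \<ge> 2" using \<open>\<zeta> \<in> T\<close> \<zeta> by (simp add: T_def)
  have Tt: "T = {\<xi>. t \<xi> \<le> t y - 1}" using y1 by (auto simp: T_def)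
  have k: "k = t y - 1"
    using card_initial[OF bij(2), of k] card_initial[OF bij(1), of "t y - 1"] Tb Tt p(4)[of y] p(6)[of \<nu>] \<nu> by simp
  have "1 \<le> k" "k < CARD('a)" using k y1 p(4)[of y] by auto
  then show False using irr Tb Tt k unfolding irreducible_pair_def \<pi> by auto
qed

section \<open>Heights of the polygon vertices\<close>

text \<open>Injectivity is needed besides independence of the image in order to count the members of the family.\<close>

lemma independent_family:
  fixes u :: "'i \<Rightarrow> 'v::euclidean_space"
  assumes fin: "finite I" and zero: "\<And>a i. (\<Sum>i\<in>I. a i *\<^sub>R u i) = 0 \<Longrightarrow> i \<in> I \<Longrightarrow> a i = 0"
  shows "inj_on u I" "independent (u ` I)"
proof -
  show inj: "inj_on u I"
  proof (rule inj_onI, rule ccontr)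
    fix i j assume ij: "i \<in> I" "j \<in> I" "u i = u j" "i \<noteq> j"
    have "(\<Sum>k\<in>I. ((if k = i then 1 else 0) - (if k = j then 1 else 0)) *\<^sub>R u k) = 0"
      using ij fin by (simp add: scaleR_diff_left sum_subtractf if_distrib[of "\<lambda>x. x *\<^sub>R _"] cong: if_cong)
    from zero[OF this ij(1)] ij(4) show False by simp
  qed
  have "\<forall>v\<in>u ` I. c v = 0" if "(\<Sum>v\<in>u ` I. c v *\<^sub>R v) = 0" for c
  proof -
    have "(\<Sum>i\<in>I. c (u i) *\<^sub>R u i) = 0" using that by (simp add: sum.reindex[OF inj] o_def)
    from zero[OF this] show ?thesis by auto
  qed
  then show "independent (u ` I)" using fin by (simp add: independent_explicit)
qed

text \<open>The sum of the coordinates of \<open>u\<close> over the first \<open>i\<close> letters of a row, written as an inner product to make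
  linearity in \<open>u\<close> evident. This is the position of the \<open>i\<close>-th vertex of a boundary line whose sides
  are given by \<open>u\<close>.\<close>

definition height :: "('a::finite \<Rightarrow> nat) \<Rightarrow> nat \<Rightarrow> real^'a \<Rightarrow> real" where
  "height p i u = (\<chi> \<xi>. if p \<xi> \<le> i then 1 else 0) \<bullet> u"

lemma height_alt: "height p i u = (\<Sum>\<xi>\<in>UNIV. if p \<xi> \<le> i then u $ \<xi> else 0)"
  by (simp add: height_def inner_vec_def if_distrib[of "\<lambda>x. x * _"] cong: if_cong)

text \<open>The height of a polygon vertex, on the upper or on the lower boundary line.\<close>

definition vertex_height :: "'a::finite perm_pair \<Rightarrow> real^'a \<Rightarrow> bool \<times> nat \<Rightarrow> real" where
  "vertex_height \<pi> u x = height (if fst x then fst \<pi> else snd \<pi>) (snd x) u"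

lemma vertex_height_pair [simp]:
  "vertex_height \<pi> u (True, i) = height (fst \<pi>) i u"
  "vertex_height \<pi> u (False, i) = height (snd \<pi>) i u"
  by (simp_all add: vertex_height_def)

lemma height_step:
  assumes "bij_betw p UNIV {1..CARD('a::finite)}"
  shows "height p (p \<alpha>) u = height p (p \<alpha> - 1) u + u $ (\<alpha>::'a)"
proof -
  have p: "inj p" "\<And>\<xi>. 1 \<le> p \<xi>" using assms perm_iff by blast+
  have "(\<chi> \<xi>. if p \<xi> \<le> p \<alpha> then 1 else 0) = (\<chi> \<xi>. if p \<xi> \<le> p \<alpha> - 1 then 1 else 0) + (axis \<alpha> 1 :: real^'a)"
    using p(2)[of \<alpha>] injD[OF p(1), of _ \<alpha>] by (fastforce simp: vec_eq_iff axis_def)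
  then show ?thesis unfolding height_def by (simp add: inner_add_left inner_axis')
qed

lemma height_0:
  assumes "bij_betw p UNIV {1..CARD('a::finite)}"
  shows "height (p :: 'a \<Rightarrow> nat) 0 u = 0"
proof -
  have "1 \<le> p \<xi>" for \<xi> using assms perm_iff by blast
  then have "(if p \<xi> \<le> 0 then u $ \<xi> else 0) = 0" for \<xi> by (metis not_one_le_zero le_zero_eq)
  then show ?thesis by (simp add: height_alt del: le_zero_eq)
qed

lemma height_full:
  assumes "bij_betw p UNIV {1..CARD('a::finite)}"
  shows "height (p :: 'a \<Rightarrow> nat) CARD('a) u = (\<Sum>\<xi>\<in>UNIV. u $ \<xi>)"
proof -
  have "p \<xi> \<le> CARD('a)" for \<xi> using assms perm_iff by blast
  then show ?thesis by (simp add: height_alt)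
qed

lemma height_unique:
  fixes p :: "'a::finite \<Rightarrow> nat"
  assumes p: "bij_betw p UNIV {1..CARD('a)}" and "g 0 = 0"
    and "\<And>\<alpha>. u $ \<alpha> = g (p \<alpha>) - g (p \<alpha> - 1)" and "i \<le> CARD('a)"
  shows "height p i u = g i"
  using assms(4)
proof (induction i)
  case 0
  then show ?case using assms(2) by (simp add: height_0[OF p])
next
  case (Suc i)
  obtain \<alpha> where "p \<alpha> = Suc i" using perm_at[OF p, of "Suc i"] Suc.prems by auto
  then show ?case using height_step[OF p, of \<alpha> u] assms(3)[of \<alpha>] Suc by simp
qed

text \<open>The coordinate of \<open>\<Omega> u\<close> at \<open>\<alpha>\<close> is the difference of the heights of the left endpoints of the two sides
  labelled \<open>\<alpha>\<close>; the right endpoints have the same difference.\<close>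

lemma Omega_heights:
  assumes "perm_pair (t, b)"
  shows "(Omega (t, b) *v u) $ \<alpha> = height b (b \<alpha> - 1) u - height t (t \<alpha> - 1) u"
proof -
  note p = perm_pairD[OF assms]
  have "Omega (t, b) $ \<alpha> $ \<beta> * u $ \<beta>
      = (if b \<beta> \<le> b \<alpha> - 1 then u $ \<beta> else 0) - (if t \<beta> \<le> t \<alpha> - 1 then u $ \<beta> else 0)" for \<beta>
  proof -
    have "b \<beta> \<le> b \<alpha> - 1 \<longleftrightarrow> b \<beta> < b \<alpha>" "t \<beta> \<le> t \<alpha> - 1 \<longleftrightarrow> t \<beta> < t \<alpha>"
      using p(3)[of \<alpha>] p(5)[of \<alpha>] by linarith+
    moreover have "\<alpha> = \<beta> \<or> (b \<alpha> \<noteq> b \<beta> \<and> t \<alpha> \<noteq> t \<beta>)" using p(1,2) by (auto dest: injD)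
    ultimately show ?thesis by (auto simp: Omega_def)
  qed
  then show ?thesis by (simp add: matrix_vector_mult_def height_alt sum_subtractf)
qed

lemma vertex_height_gluing:
  assumes pp: "perm_pair \<pi>" and xy: "(x, y) \<in> vertex_gluing \<pi>"
  shows "vertex_height \<pi> u x = vertex_height \<pi> u y
    \<or> (\<exists>\<alpha>. vertex_height \<pi> u y - vertex_height \<pi> u x = (Omega \<pi> *v u) $ \<alpha>)"
proof -
  obtain t b where \<pi>: "\<pi> = (t, b)" by (cases \<pi>)
  have bij: "bij_betw t UNIV {1..CARD('a)}" "bij_betw b UNIV {1..CARD('a)}"
    using pp by (simp_all add: \<pi> perm_pair_def)
  have eq: "height b (b \<alpha> - 1) u - height t (t \<alpha> - 1) u = (Omega (t, b) *v u) $ \<alpha>"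
    "height b (b \<alpha>) u - height t (t \<alpha>) u = (Omega (t, b) *v u) $ \<alpha>" for \<alpha>
    using Omega_heights[of t b u \<alpha>] pp height_step[OF bij(1), of \<alpha> u] height_step[OF bij(2), of \<alpha> u]
    by (simp_all add: \<pi>)
  from xy consider "x = (True, 0)" "y = (False, 0)" | "x = (True, CARD('a))" "y = (False, CARD('a))"
    | \<alpha> where "x = (True, t \<alpha> - 1)" "y = (False, b \<alpha> - 1)" | \<alpha> where "x = (True, t \<alpha>)" "y = (False, b \<alpha>)"
    unfolding vertex_gluing_def \<pi> by auto
  then show ?thesis
  proof cases
    case 1
    then show ?thesis by (simp add: \<pi> height_0[OF bij(1)] height_0[OF bij(2)])
  next
    case 2
    then show ?thesis by (simp add: \<pi> height_full[OF bij(1)] height_full[OF bij(2)])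
  next
    case (3 \<alpha>)
    then show ?thesis using eq(1)[of \<alpha>] by (auto simp: \<pi>)
  next
    case (4 \<alpha>)
    then show ?thesis using eq(2)[of \<alpha>] by (auto simp: \<pi>)
  qed
qed

text \<open>The vector \<open>u\<close> whose vertex heights are \<open>f\<close>, provided that \<open>f\<close> is compatible with the gluing and
  vanishes at the left end of the polygon.\<close>

definition side_increments :: "'a::finite perm_pair \<Rightarrow> (bool \<times> nat \<Rightarrow> real) \<Rightarrow> real^'a" where
  "side_increments \<pi> f = (\<chi> \<alpha>. f (True, fst \<pi> \<alpha>) - f (True, fst \<pi> \<alpha> - 1))"

lemma side_increments_kernel:
  assumes pp: "perm_pair \<pi>" and glue: "\<And>x y. (x, y) \<in> vertex_gluing \<pi> \<Longrightarrow> f x = f y" and f0: "f (True, 0) = 0"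
  shows "x \<in> polygon_vertices \<pi> \<Longrightarrow> vertex_height \<pi> (side_increments \<pi> f) x = f x"
    and "Omega \<pi> *v side_increments \<pi> f = 0"
proof -
  obtain t b where \<pi>: "\<pi> = (t, b)" by (cases \<pi>)
  have bij: "bij_betw t UNIV {1..CARD('a)}" "bij_betw b UNIV {1..CARD('a)}"
    using pp by (simp_all add: \<pi> perm_pair_def)
  let ?u = "side_increments \<pi> f"
  have g: "f (True, 0) = f (False, 0)" "f (True, t \<alpha> - 1) = f (False, b \<alpha> - 1)" "f (True, t \<alpha>) = f (False, b \<alpha>)" for \<alpha>
    by (rule glue; force simp: vertex_gluing_def \<pi>)+
  have T: "height t i ?u = f (True, i)" if "i \<le> CARD('a)" for i
    using f0 that by (intro height_unique[OF bij(1), where g = "\<lambda>i. f (True, i)"]) (simp_all add: side_increments_def \<pi>)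
  have B: "height b i ?u = f (False, i)" if "i \<le> CARD('a)" for i
    using f0 that g by (intro height_unique[OF bij(2), where g = "\<lambda>i. f (False, i)"]) (simp_all add: side_increments_def \<pi>)
  show "vertex_height \<pi> ?u x = f x" if "x \<in> polygon_vertices \<pi>"
    using that T B by (cases x; cases "fst x") (auto simp: polygon_vertices_def \<pi>)
  have "(Omega (t, b) *v ?u) $ \<alpha> = 0" for \<alpha>
  proof -
    have "t \<alpha> - 1 \<le> CARD('a)" "b \<alpha> - 1 \<le> CARD('a)"
      using perm_pairD(4,6)[of t b \<alpha>] pp by (auto simp: \<pi>)
    then show ?thesis using Omega_heights[of t b ?u \<alpha>] pp T B g(2)[of \<alpha>] by (simp add: \<pi>)
  qed
  then show "Omega \<pi> *v ?u = 0" by (simp add: vec_eq_iff \<pi>)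
qed

lemma side_increments_height:
  assumes "perm_pair \<pi>"
  shows "side_increments \<pi> (vertex_height \<pi> u) = u"
proof -
  have bij: "bij_betw (fst \<pi>) UNIV {1..CARD('a)}" using assms by (simp add: perm_pair_def)
  show ?thesis using height_step[OF bij] by (simp add: side_increments_def vec_eq_iff)
qed

text \<open>An integral vector in the homology space belongs to the lattice.\<close>

lemma homology_lattice_saturated:
  assumes pp: "perm_pair \<pi>" and int: "\<And>\<alpha>. (Omega \<pi> *v u) $ \<alpha> \<in> \<int>"
  shows "Omega \<pi> *v u \<in> homology_lattice \<pi>"
proof -
  define f where "f x = frac (vertex_height \<pi> u x)" for x
  have bij: "bij_betw (fst \<pi>) UNIV {1..CARD('a)}" using assms by (simp add: perm_pair_def)
  have "f x = f y" if "(x, y) \<in> vertex_gluing \<pi>" for x y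
  proof -
    have "vertex_height \<pi> u y - vertex_height \<pi> u x \<in> \<int>"
      using vertex_height_gluing[OF pp that, of u] int by auto
    then obtain n where "vertex_height \<pi> u y - vertex_height \<pi> u x = of_int n" by (rule Ints_cases)
    then have "vertex_height \<pi> u y = vertex_height \<pi> u x + of_int n" by simp
    then show ?thesis by (simp add: f_def frac_def)
  qed
  moreover have "f (True, 0) = 0" by (simp add: f_def height_0[OF bij])
  ultimately have ker: "Omega \<pi> *v side_increments \<pi> f = 0" by (rule side_increments_kernel(2)[OF pp])
  have "(u - side_increments \<pi> f) $ \<alpha> \<in> \<int>" for \<alpha>
  proof -
    have "u $ \<alpha> = vertex_height \<pi> u (True, fst \<pi> \<alpha>) - vertex_height \<pi> u (True, fst \<pi> \<alpha> - 1)"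
      using height_step[OF bij, of \<alpha> u] by simp
    then show ?thesis by (simp add: side_increments_def f_def frac_def)
  qed
  moreover have "Omega \<pi> *v u = Omega \<pi> *v (u - side_increments \<pi> f)"
    by (simp add: matrix_vector_mult_diff_distrib ker)
  ultimately show ?thesis by (auto simp: homology_lattice_def)
qed

section \<open>The dimension of the homology space\<close>

text \<open>The identification of polygon vertices, whose classes are the vertices of the surface.\<close>

abbreviation vertex_equiv :: "'a::finite perm_pair \<Rightarrow> ((bool \<times> nat) \<times> (bool \<times> nat)) set" where
  "vertex_equiv \<pi> \<equiv> (vertex_gluing \<pi> \<union> (vertex_gluing \<pi>)\<inverse>)\<^sup>*"

lemma vertex_equiv_sym: "(x, y) \<in> vertex_equiv \<pi> \<Longrightarrow> (y, x) \<in> vertex_equiv \<pi>"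
  by (meson sym_Un_converse sym_rtrancl symD)

lemma vertex_equiv_cong:
  assumes "(x, y) \<in> vertex_equiv \<pi>" "\<And>x y. (x, y) \<in> vertex_gluing \<pi> \<Longrightarrow> f x = f y"
  shows "f x = f y"
  using assms(1) by (induction rule: rtrancl_induct) (auto dest: assms(2))

text \<open>The kernel has a basis indexed by the vertices of the surface other than the class \<open>c0\<close> of the left end,
  the basis vectors having as heights the indicator functions of the vertices.\<close>

lemma dim_kernel:
  assumes pp: "perm_pair (\<pi> :: 'a::finite perm_pair)"
  shows "int (dim {u. Omega \<pi> *v u = 0}) = int (card (surface_vertices \<pi>)) - 1"
proof -
  let ?R = "vertex_equiv \<pi>" and ?V = "surface_vertices \<pi>"
  have bij: "bij_betw (fst \<pi>) UNIV {1..CARD('a)}" using assms by (simp add: perm_pair_def)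
  define cls where "cls x = ?R `` {x}" for x
  have V: "?V = cls ` polygon_vertices \<pi>"
    by (auto simp: surface_vertices_def quotient_def cls_def)
  have fin: "finite ?V" unfolding V by (simp add: polygon_vertices_def)
  have cls_eq: "x \<in> cls y \<longleftrightarrow> cls x = cls y" for x y
    unfolding cls_def by (auto dest: vertex_equiv_sym intro: rtrancl_trans)
  define c0 where "c0 = cls (True, 0)"
  have c0: "c0 \<in> ?V" unfolding V c0_def by (auto simp: polygon_vertices_def)
  define I where "I = ?V - {c0}"
  have finI: "finite I" using fin by (simp add: I_def)
  define ind where "ind c x = (if cls x = c then 1 else 0 :: real)" for c and x :: "bool \<times> nat"
  define w where "w c = side_increments \<pi> (ind c)" for c
  have glue: "cls x = cls y" if "(x, y) \<in> vertex_gluing \<pi>" for x y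
    using that by (subst cls_eq[symmetric]) (auto simp: cls_def dest: vertex_equiv_sym)
  have w: "vertex_height \<pi> (w c) x = ind c x" "Omega \<pi> *v w c = 0" if "c \<in> I" "x \<in> polygon_vertices \<pi>" for c x
  proof -
    have glue_ind: "ind c x = ind c y" if "(x, y) \<in> vertex_gluing \<pi>" for x y
      unfolding ind_def glue[OF that] ..
    have "cls (True, 0) \<noteq> c" using that unfolding I_def c0_def by blast
    then have "ind c (True, 0) = 0" unfolding ind_def by (rule if_not_P)
    note k = side_increments_kernel[where f = "ind c", OF pp glue_ind this]
    show "vertex_height \<pi> (w c) x = ind c x" unfolding w_def by (rule k(1)[OF _ that(2)])
    show "Omega \<pi> *v w c = 0" unfolding w_def by (rule k(2))
  qed
  have poly0: "(True, 0) \<in> polygon_vertices \<pi>" by (simp add: polygon_vertices_def)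
  have lin: "vertex_height \<pi> (\<Sum>c\<in>I. a c *\<^sub>R w c) x = (\<Sum>c\<in>I. a c * ind c x)" if "x \<in> polygon_vertices \<pi>" for a x
  proof -
    have "vertex_height \<pi> (\<Sum>c\<in>I. a c *\<^sub>R w c) x = (\<Sum>c\<in>I. a c * vertex_height \<pi> (w c) x)"
      by (simp add: vertex_height_def height_def inner_sum_right)
    then show ?thesis using w(1)[OF _ that] by (simp cong: sum.cong)
  qed
  have single: "(\<Sum>c\<in>I. a c * ind c x) = (if cls x \<in> I then a (cls x) else 0)" for a x
    using finI by (simp add: ind_def if_distrib[of "\<lambda>z. _ * z"] cong: if_cong)
  have ind: "a c = 0" if "(\<Sum>c\<in>I. a c *\<^sub>R w c) = 0" "c \<in> I" for a c
  proof -
    obtain x where x: "x \<in> polygon_vertices \<pi>" "c = cls x" using \<open>c \<in> I\<close> by (auto simp: I_def V)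
    have "vertex_height \<pi> (\<Sum>c\<in>I. a c *\<^sub>R w c) x = a c"
      using x \<open>c \<in> I\<close> by (simp add: lin single)
    then show ?thesis using that(1) by (simp add: vertex_height_def height_def)
  qed
  have family: "inj_on w I" "independent (w ` I)"
    by (rule independent_family[OF finI]; erule ind; assumption)+
  have "{u. Omega \<pi> *v u = 0} \<subseteq> span (w ` I)"
  proof
    fix u assume "u \<in> {u. Omega \<pi> *v u = 0}"
    then have u: "Omega \<pi> *v u = 0" by simp
    have hg: "vertex_height \<pi> u x = vertex_height \<pi> u y" if "cls x = cls y" for x y
    proof (rule vertex_equiv_cong)
      show "(x, y) \<in> ?R" using that unfolding cls_def by blast
      show "vertex_height \<pi> u x = vertex_height \<pi> u y" if "(x, y) \<in> vertex_gluing \<pi>" for x y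
        using vertex_height_gluing[OF pp that, of u] by (auto simp: u)
    qed
    define a where "a c = vertex_height \<pi> u (SOME x. cls x = c)" for c
    have a: "a (cls x) = vertex_height \<pi> u x" for x
      unfolding a_def by (rule hg) (rule someI[of _ x], rule HOL.refl)
    have zero: "vertex_height \<pi> u x = 0" if "x \<in> polygon_vertices \<pi>" "cls x \<notin> I" for x
    proof -
      have "cls x = c0" using that by (auto simp: I_def V)
      then show ?thesis using hg[of x "(True, 0)"] by (simp add: c0_def height_0[OF bij])
    qed
    let ?s = "\<Sum>c\<in>I. a c *\<^sub>R w c"
    have "vertex_height \<pi> ?s x = vertex_height \<pi> u x" if "x \<in> polygon_vertices \<pi>" for x
      using that zero[OF that] by (simp add: lin single a)
    moreover have "(True, fst \<pi> \<alpha>) \<in> polygon_vertices \<pi>" "(True, fst \<pi> \<alpha> - 1) \<in> polygon_vertices \<pi>" for \<alpha>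
      using perm_pairD(4)[of "fst \<pi>" "snd \<pi>" \<alpha>] pp by (auto simp: polygon_vertices_def)
    ultimately have "side_increments \<pi> (vertex_height \<pi> ?s) = side_increments \<pi> (vertex_height \<pi> u)"
      by (simp add: side_increments_def vec_eq_iff del: vertex_height_pair)
    then have "u = ?s" by (simp add: side_increments_height[OF pp])
    moreover have "?s \<in> span (w ` I)" by (intro span_sum span_scale span_base imageI)
    ultimately show "u \<in> span (w ` I)" by metis
  qed
  moreover have "w ` I \<subseteq> {u. Omega \<pi> *v u = 0}" using w(2) poly0 by auto
  ultimately have "dim {u. Omega \<pi> *v u = 0} = card (w ` I)"
    using family(2) by (metis dim_unique)
  also have "\<dots> = card I" by (rule card_image[OF family(1)])
  also have "int \<dots> = int (card ?V) - 1"
    using c0 fin card_gt_0_iff[of ?V] by (auto simp: I_def card_Diff_singleton)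
  finally show ?thesis .
qed

lemma subspace_homology: "subspace (homology_space \<pi>)"
  unfolding homology_space_def by (rule linear_subspace_image) auto

lemma dim_homology:
  assumes pp: "perm_pair (\<pi> :: 'a::finite perm_pair)" and g: "has_genus \<pi> g"
  shows "dim (homology_space \<pi>) = 2 * g"
proof -
  \<comment> \<open>Since \<open>\<Omega>\<close> is antisymmetric, its kernel is the orthogonal complement of its image.\<close>
  have "(\<forall>x\<in>homology_space \<pi>. orthogonal x u) \<longleftrightarrow> Omega \<pi> *v u = 0" for u
  proof -
    have "orthogonal (Omega \<pi> *v v) u \<longleftrightarrow> v \<bullet> (Omega \<pi> *v u) = 0" for v
      using inner_Omega[of v \<pi> u] by (simp add: orthogonal_def)
    then have "(\<forall>x\<in>homology_space \<pi>. orthogonal x u) \<longleftrightarrow> (\<forall>v. v \<bullet> (Omega \<pi> *v u) = 0)"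
      by (simp add: homology_space_def)
    then show ?thesis by (metis inner_eq_zero_iff inner_zero_right)
  qed
  then have "dim {u. Omega \<pi> *v u = 0} + dim (homology_space \<pi>) = CARD('a)"
    using dim_subspace_orthogonal_to_vectors[OF subspace_homology[of \<pi>] subspace_UNIV] by simp
  then show ?thesis using dim_kernel[OF pp] g by (simp add: has_genus_def euler_char_def)
qed

section \<open>The intersection form\<close>

lemma intersection_form_Omega: "intersection_form \<pi> (Omega \<pi> *v u) (Omega \<pi> *v v) = u \<bullet> (Omega \<pi> *v v)"
proof -
  have "u' \<bullet> (Omega \<pi> *v v') = u \<bullet> (Omega \<pi> *v v)"
    if "Omega \<pi> *v u = Omega \<pi> *v u'" "Omega \<pi> *v v = Omega \<pi> *v v'" for u' v'
    using that inner_Omega[of u' \<pi> v] inner_Omega[of u \<pi> v] by simp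
  then show ?thesis unfolding intersection_form_def by (intro the_equality) blast+
qed

lemma iform_right: "y \<in> homology_space \<pi> \<Longrightarrow> intersection_form \<pi> (Omega \<pi> *v u) y = u \<bullet> y"
  by (auto simp: homology_space_def intersection_form_Omega)

lemma iform_left: "x \<in> homology_space \<pi> \<Longrightarrow> intersection_form \<pi> x (Omega \<pi> *v v) = - (x \<bullet> v)"
  by (auto simp: homology_space_def intersection_form_Omega inner_Omega)

lemma homology_spaceE:
  assumes "x \<in> homology_space \<pi>"
  obtains u where "x = Omega \<pi> *v u"
  using assms by (auto simp: homology_space_def)

lemmas homology_space_add = subspace_add[OF subspace_homology]
  and homology_space_diff = subspace_diff[OF subspace_homology]
  and homology_space_scale = subspace_scale[OF subspace_homology]
  and homology_space_sum = subspace_sum[OF subspace_homology]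

lemma iform_antisym:
  assumes "x \<in> homology_space \<pi>" "y \<in> homology_space \<pi>"
  shows "intersection_form \<pi> x y = - intersection_form \<pi> y x"
proof -
  obtain u where u: "x = Omega \<pi> *v u" using assms(1) by (rule homology_spaceE)
  show ?thesis using iform_right[OF assms(2), of u] iform_left[OF assms(2), of u] by (simp add: u inner_commute)
qed

lemma iform_linear:
  assumes H: "x \<in> homology_space \<pi>" "y \<in> homology_space \<pi>" "z \<in> homology_space \<pi>"
  shows "intersection_form \<pi> (x + y) z = intersection_form \<pi> x z + intersection_form \<pi> y z"
    "intersection_form \<pi> (x - y) z = intersection_form \<pi> x z - intersection_form \<pi> y z"
    "intersection_form \<pi> (c *\<^sub>R x) z = c * intersection_form \<pi> x z"
    "intersection_form \<pi> z (x + y) = intersection_form \<pi> z x + intersection_form \<pi> z y"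
    "intersection_form \<pi> z (x - y) = intersection_form \<pi> z x - intersection_form \<pi> z y"
    "intersection_form \<pi> z (c *\<^sub>R x) = c * intersection_form \<pi> z x"
proof -
  obtain w where w: "z = Omega \<pi> *v w" using H(3) by (rule homology_spaceE)
  have S: "x + y \<in> homology_space \<pi>" "x - y \<in> homology_space \<pi>" "c *\<^sub>R x \<in> homology_space \<pi>"
    using H by (simp_all add: homology_space_add homology_space_diff homology_space_scale)
  show "intersection_form \<pi> (x + y) z = intersection_form \<pi> x z + intersection_form \<pi> y z"
    "intersection_form \<pi> (x - y) z = intersection_form \<pi> x z - intersection_form \<pi> y z"
    "intersection_form \<pi> (c *\<^sub>R x) z = c * intersection_form \<pi> x z"
    "intersection_form \<pi> z (x + y) = intersection_form \<pi> z x + intersection_form \<pi> z y"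
    "intersection_form \<pi> z (x - y) = intersection_form \<pi> z x - intersection_form \<pi> z y"
    "intersection_form \<pi> z (c *\<^sub>R x) = c * intersection_form \<pi> z x"
    unfolding w using H S
    by (simp_all add: iform_left iform_right inner_add_left inner_add_right inner_diff_left inner_diff_right)
qed

lemma iform_sum:
  assumes "\<And>i. i \<in> I \<Longrightarrow> x i \<in> homology_space \<pi>" "z \<in> homology_space \<pi>"
  shows "intersection_form \<pi> (\<Sum>i\<in>I. a i *\<^sub>R x i) z = (\<Sum>i\<in>I. a i * intersection_form \<pi> (x i) z)"
    "intersection_form \<pi> z (\<Sum>i\<in>I. a i *\<^sub>R x i) = (\<Sum>i\<in>I. a i * intersection_form \<pi> z (x i))"
proof -
  obtain w where w: "z = Omega \<pi> *v w" using assms(2) by (rule homology_spaceE)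
  have S: "(\<Sum>i\<in>I. a i *\<^sub>R x i) \<in> homology_space \<pi>"
    using assms(1) by (intro homology_space_sum homology_space_scale)
  show "intersection_form \<pi> (\<Sum>i\<in>I. a i *\<^sub>R x i) z = (\<Sum>i\<in>I. a i * intersection_form \<pi> (x i) z)"
    unfolding w iform_left[OF S] using assms(1) by (simp add: iform_left inner_sum_left sum_negf cong: sum.cong)
  show "intersection_form \<pi> z (\<Sum>i\<in>I. a i *\<^sub>R x i) = (\<Sum>i\<in>I. a i * intersection_form \<pi> z (x i))"
    unfolding w iform_right[OF S] using assms(1) by (simp add: iform_right inner_sum_right cong: sum.cong)
qed

lemma iform_nondegenerate:
  assumes "x \<in> homology_space \<pi>" "\<And>y. y \<in> homology_space \<pi> \<Longrightarrow> intersection_form \<pi> x y = 0"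
  shows "x = 0"
proof -
  have "x \<bullet> v = 0" for v
    using iform_left[OF assms(1), of v] assms(2)[of "Omega \<pi> *v v"] by (simp add: homology_space_def)
  then show ?thesis by (metis inner_eq_zero_iff)
qed

lemma Omega_in: "Omega \<pi> *v u \<in> homology_space \<pi>"
  by (simp add: homology_space_def)

lemma iform_pairs:
  assumes fin: "finite K" and H: "\<And>k. k \<in> K \<Longrightarrow> e k \<in> homology_space \<pi> \<and> f k \<in> homology_space \<pi>"
    and z: "z \<in> homology_space \<pi>"
  shows "intersection_form \<pi> (\<Sum>k\<in>K. a k *\<^sub>R e k + b k *\<^sub>R f k) z =
    (\<Sum>k\<in>K. a k * intersection_form \<pi> (e k) z + b k * intersection_form \<pi> (f k) z)"
proof -
  have S: "(\<Sum>k\<in>K. a k *\<^sub>R e k) \<in> homology_space \<pi>" "(\<Sum>k\<in>K. b k *\<^sub>R f k) \<in> homology_space \<pi>"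
    using H by (auto intro!: homology_space_sum homology_space_scale)
  show ?thesis
    using iform_linear(1)[OF S z] H z by (simp add: sum.distrib iform_sum)
qed

section \<open>The integral lattice\<close>

lemma lattice_subset: "homology_lattice \<pi> \<subseteq> homology_space \<pi>"
  by (auto simp: homology_lattice_def homology_space_def)

lemma lattice_subsetD: "x \<in> homology_lattice \<pi> \<Longrightarrow> x \<in> homology_space \<pi>"
  using lattice_subset by blast

lemma Omega_int: "Omega \<pi> $ i $ j \<in> \<int>"
  by (simp add: Omega_def)

lemma Omega_axis_lattice: "Omega \<pi> *v axis \<alpha> 1 \<in> homology_lattice \<pi>"
  unfolding homology_lattice_def by (rule imageI) (auto simp: axis_def)

lemma lattice_int: "x \<in> homology_lattice \<pi> \<Longrightarrow> x $ \<alpha> \<in> \<int>"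
  by (auto simp: homology_lattice_def matrix_vector_mult_def intro!: Ints_sum Ints_mult Omega_int)

text \<open>By saturation, membership in the lattice is a condition on coordinates.\<close>

lemma lattice_iff:
  assumes "perm_pair \<pi>"
  shows "x \<in> homology_lattice \<pi> \<longleftrightarrow> x \<in> homology_space \<pi> \<and> (\<forall>\<alpha>. x $ \<alpha> \<in> \<int>)"
  using homology_lattice_saturated[OF assms] lattice_subset[of \<pi>] lattice_int[of x \<pi>]
  by (auto elim!: homology_spaceE)

lemma iform_int:
  assumes "x \<in> homology_lattice \<pi>" "y \<in> homology_lattice \<pi>"
  shows "intersection_form \<pi> x y \<in> \<int>"
proof -
  obtain u where u: "x = Omega \<pi> *v u" "\<And>\<alpha>. u $ \<alpha> \<in> \<int>" using assms(1) by (auto simp: homology_lattice_def)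
  have "intersection_form \<pi> x y = u \<bullet> y"
    unfolding u(1) by (rule iform_right[OF lattice_subsetD[OF assms(2)]])
  also have "\<dots> \<in> \<int>" using u(2) lattice_int[OF assms(2)] by (auto simp: inner_vec_def intro!: Ints_sum Ints_mult)
  finally show ?thesis .
qed

lemma lattice_combination:
  assumes pp: "perm_pair \<pi>"
  shows "x \<in> homology_lattice \<pi> \<Longrightarrow> y \<in> homology_lattice \<pi> \<Longrightarrow> x + y \<in> homology_lattice \<pi>"
    "x \<in> homology_lattice \<pi> \<Longrightarrow> y \<in> homology_lattice \<pi> \<Longrightarrow> x - y \<in> homology_lattice \<pi>"
    "x \<in> homology_lattice \<pi> \<Longrightarrow> c \<in> \<int> \<Longrightarrow> c *\<^sub>R x \<in> homology_lattice \<pi>"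
    "(\<And>i. i \<in> I \<Longrightarrow> w i \<in> homology_lattice \<pi>) \<Longrightarrow> (\<Sum>i\<in>I. w i) \<in> homology_lattice \<pi>"
  unfolding lattice_iff[OF pp]
  by (auto intro: homology_space_add homology_space_diff
      homology_space_scale homology_space_sum)

text \<open>Lattice vectors \<open>e k\<close> and \<open>f k\<close> with the intersection numbers of a symplectic basis.\<close>

definition hyperbolic_system ::
    "'a::finite perm_pair \<Rightarrow> 'i set \<Rightarrow> ('i \<Rightarrow> real^'a) \<Rightarrow> ('i \<Rightarrow> real^'a) \<Rightarrow> bool" where
  "hyperbolic_system \<pi> K e f \<longleftrightarrow> (\<forall>k\<in>K. e k \<in> homology_lattice \<pi> \<and> f k \<in> homology_lattice \<pi>) \<and>
    (\<forall>k\<in>K. \<forall>l\<in>K. intersection_form \<pi> (e k) (f l) = (if k = l then 1 else 0) \<and>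
       intersection_form \<pi> (e k) (e l) = 0 \<and> intersection_form \<pi> (f k) (f l) = 0)"

text \<open>The component of \<open>z\<close> orthogonal to a hyperbolic system.\<close>

definition complement_part ::
    "'a::finite perm_pair \<Rightarrow> 'i set \<Rightarrow> ('i \<Rightarrow> real^'a) \<Rightarrow> ('i \<Rightarrow> real^'a) \<Rightarrow> real^'a \<Rightarrow> real^'a" where
  "complement_part \<pi> K e f z = z - (\<Sum>k\<in>K. intersection_form \<pi> z (f k) *\<^sub>R e k
     + (- intersection_form \<pi> z (e k)) *\<^sub>R f k)"

lemma complement_part:
  assumes pp: "perm_pair \<pi>" and h: "hyperbolic_system \<pi> K e f" and fin: "finite K"
    and z: "z \<in> homology_lattice \<pi>"
  shows "complement_part \<pi> K e f z \<in> homology_lattice \<pi>"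
    and "k \<in> K \<Longrightarrow> intersection_form \<pi> (complement_part \<pi> K e f z) (e k) = 0"
    and "k \<in> K \<Longrightarrow> intersection_form \<pi> (complement_part \<pi> K e f z) (f k) = 0"
    and "x \<in> homology_space \<pi> \<Longrightarrow> (\<And>k. k \<in> K \<Longrightarrow> intersection_form \<pi> x (e k) = 0) \<Longrightarrow>
      (\<And>k. k \<in> K \<Longrightarrow> intersection_form \<pi> x (f k) = 0) \<Longrightarrow>
      intersection_form \<pi> x (complement_part \<pi> K e f z) = intersection_form \<pi> x z"
proof -
  let ?s = "\<Sum>k\<in>K. intersection_form \<pi> z (f k) *\<^sub>R e k + (- intersection_form \<pi> z (e k)) *\<^sub>R f k"
  have L: "e k \<in> homology_lattice \<pi>" "f k \<in> homology_lattice \<pi>" if "k \<in> K" for k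
    using h that by (auto simp: hyperbolic_system_def)
  have H: "e k \<in> homology_space \<pi>" "f k \<in> homology_space \<pi>" if "k \<in> K" for k
    using L[OF that] by (auto intro: lattice_subsetD)
  have zH: "z \<in> homology_space \<pi>" using z by (auto intro: lattice_subsetD)
  have sL: "?s \<in> homology_lattice \<pi>"
    using L z by (intro lattice_combination[OF pp] Ints_minus iform_int) auto
  then have sH: "?s \<in> homology_space \<pi>" by (auto intro: lattice_subsetD)
  show "complement_part \<pi> K e f z \<in> homology_lattice \<pi>"
    unfolding complement_part_def by (rule lattice_combination(2)[OF pp z sL])
  have s: "intersection_form \<pi> ?s y = (\<Sum>k\<in>K. intersection_form \<pi> z (f k) * intersection_form \<pi> (e k) y
      + (- intersection_form \<pi> z (e k)) * intersection_form \<pi> (f k) y)" if "y \<in> homology_space \<pi>" for y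
    by (rule iform_pairs[OF fin _ that]) (use H in blast)
  show "intersection_form \<pi> (complement_part \<pi> K e f z) (e k) = 0" if "k \<in> K"
  proof -
    have "intersection_form \<pi> ?s (e k) = (\<Sum>l\<in>K. if l = k then intersection_form \<pi> z (e k) else 0)"
      unfolding s[OF H(1)[OF that]]
    proof (intro sum.cong HOL.refl)
      fix l assume "l \<in> K"
      then show "intersection_form \<pi> z (f l) * intersection_form \<pi> (e l) (e k) +
        - intersection_form \<pi> z (e l) * intersection_form \<pi> (f l) (e k) = (if l = k then intersection_form \<pi> z (e k) else 0)"
        using h that iform_antisym[OF H(2) H(1), of l k] by (auto simp: hyperbolic_system_def)
    qed
    then have "intersection_form \<pi> ?s (e k) = intersection_form \<pi> z (e k)" using fin that by simp
    then show ?thesis unfolding complement_part_def iform_linear(2)[OF zH sH H(1)[OF that]] by simp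
  qed
  show "intersection_form \<pi> (complement_part \<pi> K e f z) (f k) = 0" if "k \<in> K"
  proof -
    have "intersection_form \<pi> ?s (f k) = (\<Sum>l\<in>K. if l = k then intersection_form \<pi> z (f k) else 0)"
      unfolding s[OF H(2)[OF that]]
      by (intro sum.cong HOL.refl) (use h that in \<open>auto simp: hyperbolic_system_def\<close>)
    then have "intersection_form \<pi> ?s (f k) = intersection_form \<pi> z (f k)" using fin that by simp
    then show ?thesis unfolding complement_part_def iform_linear(2)[OF zH sH H(2)[OF that]] by simp
  qed
  show "intersection_form \<pi> x (complement_part \<pi> K e f z) = intersection_form \<pi> x z"
    if x: "x \<in> homology_space \<pi>" and "\<And>k. k \<in> K \<Longrightarrow> intersection_form \<pi> x (e k) = 0"
      "\<And>k. k \<in> K \<Longrightarrow> intersection_form \<pi> x (f k) = 0"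
  proof -
    have "intersection_form \<pi> (e k) x = 0" "intersection_form \<pi> (f k) x = 0" if "k \<in> K" for k
      using that x H[OF that] \<open>\<And>k. k \<in> K \<Longrightarrow> intersection_form \<pi> x (e k) = 0\<close>
        \<open>\<And>k. k \<in> K \<Longrightarrow> intersection_form \<pi> x (f k) = 0\<close> iform_antisym by fastforce+
    then have "intersection_form \<pi> ?s x = 0" unfolding s[OF x] by simp
    then show ?thesis
      unfolding complement_part_def iform_linear(5)[OF zH sH x] using iform_antisym[OF x sH] by simp
  qed
qed

text \<open>Let \<open>m\<close> be the least positive intersection number in the orthogonal complement \<open>L\<close> of the system,
  attained at \<open>x\<close> and \<open>y\<close>. All intersection numbers of \<open>x\<close> with \<open>L\<close>, and so all coordinates of \<open>x\<close>, are
  multiples of \<open>m\<close>; by saturation \<open>x / m\<close> is in the lattice, and it pairs to \<open>1\<close> with \<open>y\<close>.\<close>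

lemma hyperbolic_pair_exists:
  assumes pp: "perm_pair \<pi>" and h: "hyperbolic_system \<pi> K e f" and fin: "finite K"
    and nz: "w \<in> homology_lattice \<pi>" "complement_part \<pi> K e f w \<noteq> 0"
  shows "\<exists>x y. x \<in> homology_lattice \<pi> \<and> y \<in> homology_lattice \<pi> \<and> intersection_form \<pi> x y = 1 \<and>
    (\<forall>k\<in>K. intersection_form \<pi> x (e k) = 0 \<and> intersection_form \<pi> x (f k) = 0 \<and>
      intersection_form \<pi> y (e k) = 0 \<and> intersection_form \<pi> y (f k) = 0)"
proof -
  define L where "L = {z \<in> homology_lattice \<pi>. \<forall>k\<in>K. intersection_form \<pi> z (e k) = 0 \<and> intersection_form \<pi> z (f k) = 0}"
  have LL: "x \<in> homology_lattice \<pi>" "x \<in> homology_space \<pi>" if "x \<in> L" for x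
    using that by (auto simp: L_def intro: lattice_subsetD)
  have KH: "e k \<in> homology_space \<pi>" "f k \<in> homology_space \<pi>" if "k \<in> K" for k
    using h that by (auto simp: hyperbolic_system_def intro: lattice_subsetD)
  have proj: "complement_part \<pi> K e f z \<in> L" if "z \<in> homology_lattice \<pi>" for z
    using complement_part(1-3)[OF pp h fin that] by (simp add: L_def)
  have proj_form: "intersection_form \<pi> x (complement_part \<pi> K e f z) = intersection_form \<pi> x z"
    if "x \<in> L" "z \<in> homology_lattice \<pi>" for x z
    using complement_part(4)[OF pp h fin that(2) LL(2)[OF that(1)]] that(1) by (auto simp: L_def)
  have comb: "x - c *\<^sub>R y \<in> L" if "x \<in> L" "y \<in> L" "c \<in> \<int>" for x y c
  proof -
    have "x - c *\<^sub>R y \<in> homology_lattice \<pi>"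
      using that by (intro lattice_combination[OF pp] LL)
    moreover have "intersection_form \<pi> (x - c *\<^sub>R y) z = intersection_form \<pi> x z - c * intersection_form \<pi> y z"
      if "z \<in> homology_space \<pi>" for z
      using iform_linear(2)[of x \<pi> "c *\<^sub>R y" z] iform_linear(3)[of y \<pi> y z c] LL(2)[OF \<open>x \<in> L\<close>] LL(2)[OF \<open>y \<in> L\<close>] that
        homology_space_scale[OF LL(2)[OF \<open>y \<in> L\<close>], of c] by simp
    ultimately show ?thesis using that KH by (simp add: L_def)
  qed
  define A where "A = {n::nat. n > 0 \<and> (\<exists>x\<in>L. \<exists>y\<in>L. intersection_form \<pi> x y = real n)}"
  have "A \<noteq> {}"
  proof -
    let ?x = "complement_part \<pi> K e f w"
    have xL: "?x \<in> L" by (rule proj[OF nz(1)])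
    obtain \<alpha> where \<alpha>: "?x $ \<alpha> \<noteq> 0" using nz(2) by (auto simp: vec_eq_iff)
    let ?y = "complement_part \<pi> K e f (Omega \<pi> *v axis \<alpha> 1)"
    have yL: "?y \<in> L" by (rule proj[OF Omega_axis_lattice])
    have "intersection_form \<pi> ?x ?y = - ?x $ \<alpha>"
      unfolding proj_form[OF xL Omega_axis_lattice] iform_left[OF LL(2)[OF xL]] by (simp add: inner_axis)
    then have ne: "intersection_form \<pi> ?x ?y \<noteq> 0" using \<alpha> by simp
    obtain n where n: "intersection_form \<pi> ?x ?y = real_of_int n"
      using iform_int[OF LL(1)[OF xL] LL(1)[OF yL]] by (rule Ints_cases)
    have "intersection_form \<pi> ?y ?x = real_of_int (- n)"
      using n iform_antisym[OF LL(2)[OF xL] LL(2)[OF yL]] by simp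
    with n ne xL yL have "nat \<bar>n\<bar> \<in> A" unfolding A_def by (cases "n > 0") auto
    then show ?thesis by blast
  qed
  define m where "m = (LEAST n. n \<in> A)"
  have "m \<in> A" unfolding m_def using \<open>A \<noteq> {}\<close> by (metis LeastI all_not_in_conv)
  have least: "m \<le> n" if "n \<in> A" for n unfolding m_def using that by (rule Least_le)
  from \<open>m \<in> A\<close> obtain x y where xy: "x \<in> L" "y \<in> L" "intersection_form \<pi> x y = real m" and m: "m > 0"
    by (auto simp: A_def)
  have dvd: "intersection_form \<pi> x z / real m \<in> \<int>" if "z \<in> L" for z
  proof -
    note zL = that
    obtain j where j: "intersection_form \<pi> x z = real_of_int j"
      using iform_int[OF LL(1)[OF xy(1)] LL(1)[OF zL]] by (rule Ints_cases)
    let ?q = "j div int m" and ?r = "j mod int m"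
    have zy: "z - of_int ?q *\<^sub>R y \<in> L" using that xy by (intro comb) auto
    have "intersection_form \<pi> x (z - of_int ?q *\<^sub>R y) = of_int j - of_int ?q * real m"
      using iform_linear(5)[of z \<pi> "of_int ?q *\<^sub>R y" x] iform_linear(6)[of y \<pi> y x "of_int ?q"]
        LL(2)[OF that] LL(2)[OF xy(1)] LL(2)[OF xy(2)]
        homology_space_scale[OF LL(2)[OF xy(2)], of "of_int ?q"] j xy(3) by simp
    also have "\<dots> = of_int (j - ?q * int m)" by simp
    also have "j - ?q * int m = ?r" by (simp add: minus_div_mult_eq_mod)
    finally have r: "intersection_form \<pi> x (z - of_int ?q *\<^sub>R y) = of_int ?r" .
    have "?r = 0"
    proof (rule ccontr)
      assume "?r \<noteq> 0"
      moreover have b: "0 \<le> ?r" "?r < int m" using m by simp_all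
      ultimately have "nat ?r \<in> A" unfolding A_def using r xy(1) zy by (auto intro!: bexI)
      from least[OF this] b show False by linarith
    qed
    then have "j = ?q * int m" using minus_div_mult_eq_mod[of j "int m"] by simp
    then have "real_of_int j = real_of_int ?q * real m" by (metis of_int_mult of_int_of_nat_eq)
    then show ?thesis using m j by simp
  qed
  let ?x = "(1 / real m) *\<^sub>R x"
  have xH: "?x \<in> homology_space \<pi>" using LL(2)[OF xy(1)] homology_space_scale by blast
  have "?x $ \<alpha> \<in> \<int>" for \<alpha>
  proof -
    let ?y = "complement_part \<pi> K e f (Omega \<pi> *v axis \<alpha> 1)"
    have "intersection_form \<pi> x ?y = - x $ \<alpha>"
      unfolding proj_form[OF xy(1) Omega_axis_lattice] iform_left[OF LL(2)[OF xy(1)]] by (simp add: inner_axis)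
    then have "?x $ \<alpha> = - (intersection_form \<pi> x ?y / real m)" by simp
    then show ?thesis using dvd[OF proj[OF Omega_axis_lattice]] by (metis Ints_minus)
  qed
  then have xL: "?x \<in> homology_lattice \<pi>" using xH lattice_iff[OF pp] by blast
  have sc: "intersection_form \<pi> ?x z = (1 / real m) * intersection_form \<pi> x z" if "z \<in> homology_space \<pi>" for z
    by (rule iform_linear(3)[OF LL(2)[OF xy(1)] that that])
  have "intersection_form \<pi> ?x y = 1" using sc[OF LL(2)[OF xy(2)]] xy(3) m by simp
  moreover have "\<forall>k\<in>K. intersection_form \<pi> ?x (e k) = 0 \<and> intersection_form \<pi> ?x (f k) = 0"
    using sc KH xy(1) by (simp add: L_def)
  ultimately show ?thesis using xL xy(2) by (auto simp: L_def)
qed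

lemma lattice_span: "span (homology_lattice \<pi>) = homology_space \<pi>"
proof (rule subset_antisym)
  show "span (homology_lattice \<pi>) \<subseteq> homology_space \<pi>"
    by (rule span_minimal[OF lattice_subset subspace_homology])
  show "homology_space \<pi> \<subseteq> span (homology_lattice \<pi>)"
  proof
    fix x assume "x \<in> homology_space \<pi>"
    then obtain u where "x = Omega \<pi> *v u" by (rule homology_spaceE)
    also have "\<dots> = (\<Sum>\<alpha>\<in>UNIV. u $ \<alpha> *\<^sub>R (Omega \<pi> *v axis \<alpha> 1))"
      by (simp add: vec_eq_iff matrix_vector_mult_axis_nth) (simp add: matrix_vector_mult_def mult.commute)
    also have "\<dots> \<in> span (homology_lattice \<pi>)"
      by (intro span_sum span_scale span_base Omega_axis_lattice)
    finally show "x \<in> span (homology_lattice \<pi>)" .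
  qed
qed

lemma hyperbolic_system_exists:
  fixes \<pi> :: "'a::finite perm_pair"
  assumes pp: "perm_pair \<pi>" and g: "has_genus \<pi> g" and "finite K" and "card K \<le> g"
  shows "\<exists>e f. hyperbolic_system \<pi> (K :: 'i set) e f"
  using assms(3,4)
proof (induction K rule: finite_induct)
  case empty
  then show ?case by (simp add: hyperbolic_system_def)
next
  case (insert k K)
  then obtain e f where h: "hyperbolic_system \<pi> K e f" by fastforce
  have "dim (e ` K \<union> f ` K) \<le> card (e ` K \<union> f ` K)"
    using insert(1) by (intro dim_le_card span_superset) simp
  also have "\<dots> \<le> card (e ` K) + card (f ` K)" by (rule card_Un_le)
  also have "\<dots> \<le> card K + card K" by (intro add_mono card_image_le insert(1))
  also have "\<dots> < 2 * g" using insert by simp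
  finally have dim: "dim (span (e ` K \<union> f ` K)) < dim (homology_space \<pi>)"
    by (simp add: dim_homology[OF pp g])
  have "\<not> homology_lattice \<pi> \<subseteq> span (e ` K \<union> f ` K)"
  proof
    assume "homology_lattice \<pi> \<subseteq> span (e ` K \<union> f ` K)"
    then have "homology_space \<pi> \<subseteq> span (e ` K \<union> f ` K)"
      by (metis lattice_span span_minimal subspace_span)
    from dim_subset[OF this] dim show False by linarith
  qed
  then obtain w where w: "w \<in> homology_lattice \<pi>" "w \<notin> span (e ` K \<union> f ` K)" by blast
  have "complement_part \<pi> K e f w \<noteq> 0"
  proof
    assume "complement_part \<pi> K e f w = 0"
    then have "w = (\<Sum>k\<in>K. intersection_form \<pi> w (f k) *\<^sub>R e k + (- intersection_form \<pi> w (e k)) *\<^sub>R f k)"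
      by (simp add: complement_part_def)
    also have "\<dots> \<in> span (e ` K \<union> f ` K)"
      by (intro span_sum span_add span_scale span_base) auto
    finally show False using w by simp
  qed
  from hyperbolic_pair_exists[OF pp h insert(1) w(1) this] obtain x y where
    xy: "x \<in> homology_lattice \<pi>" "y \<in> homology_lattice \<pi>" "intersection_form \<pi> x y = 1"
    and orth: "\<And>k. k \<in> K \<Longrightarrow> intersection_form \<pi> x (e k) = 0 \<and> intersection_form \<pi> x (f k) = 0 \<and>
      intersection_form \<pi> y (e k) = 0 \<and> intersection_form \<pi> y (f k) = 0" by blast
  have H: "x \<in> homology_space \<pi>" "y \<in> homology_space \<pi>"
    "\<And>k. k \<in> K \<Longrightarrow> e k \<in> homology_space \<pi>" "\<And>k. k \<in> K \<Longrightarrow> f k \<in> homology_space \<pi>"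
    using xy h by (auto simp: hyperbolic_system_def intro: lattice_subsetD)
  have self: "intersection_form \<pi> z z = 0" if "z \<in> homology_space \<pi>" for z
    using iform_antisym[OF that that] by simp
  have orth': "intersection_form \<pi> (e k) x = 0 \<and> intersection_form \<pi> (f k) x = 0 \<and>
      intersection_form \<pi> (e k) y = 0 \<and> intersection_form \<pi> (f k) y = 0" if "k \<in> K" for k
    using orth[OF that] iform_antisym[OF H(3)[OF that] H(1)] iform_antisym[OF H(3)[OF that] H(2)]
      iform_antisym[OF H(4)[OF that] H(1)] iform_antisym[OF H(4)[OF that] H(2)] by simp
  let ?e = "e(k := x)" and ?f = "f(k := y)"
  have "hyperbolic_system \<pi> (insert k K) ?e ?f"
    unfolding hyperbolic_system_def
  proof (intro conjI ballI)
    fix i assume i: "i \<in> insert k K"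
    then show "?e i \<in> homology_lattice \<pi>" "?f i \<in> homology_lattice \<pi>"
      using h xy(1,2) unfolding hyperbolic_system_def by auto
    fix j assume j: "j \<in> insert k K"
    have all: "intersection_form \<pi> (?e i) (?f j) = (if i = j then 1 else 0) \<and>
      intersection_form \<pi> (?e i) (?e j) = 0 \<and> intersection_form \<pi> (?f i) (?f j) = 0"
    proof (cases "i = k"; cases "j = k")
      assume "i = k" "j = k"
      then show ?thesis using xy(3) self[OF H(1)] self[OF H(2)] by simp
    next
      assume "i = k" "j \<noteq> k"
      then show ?thesis using orth[of j] j by simp
    next
      assume "i \<noteq> k" "j = k"
      then show ?thesis using orth'[of i] i by simp
    next
      assume "i \<noteq> k" "j \<noteq> k"
      then show ?thesis using h i j unfolding hyperbolic_system_def by simp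
    qed
    then show "intersection_form \<pi> (?e i) (?f j) = (if i = j then 1 else 0)"
      "intersection_form \<pi> (?e i) (?e j) = 0" "intersection_form \<pi> (?f i) (?f j) = 0" by blast+
  qed
  then show ?case by blast
qed

lemma symplectic_lattice_basis_exists:
  fixes \<pi> :: "'a::finite perm_pair"
  assumes pp: "perm_pair \<pi>" and g: "has_genus \<pi> g" and card: "CARD('g::finite) = g"
  shows "\<exists>e :: 'g + 'g \<Rightarrow> real^'a. symplectic_lattice_basis \<pi> e"
proof -
  obtain a b where h: "hyperbolic_system \<pi> (UNIV :: 'g set) a b"
    using hyperbolic_system_exists[OF pp g, of "UNIV :: 'g set"] card by auto
  define e where "e = case_sum a b"
  have L: "e i \<in> homology_lattice \<pi>" for i
    using h by (cases i) (auto simp: e_def hyperbolic_system_def)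
  have H: "e i \<in> homology_space \<pi>" for i using L by (auto intro: lattice_subsetD)
  have J: "intersection_form \<pi> (e i) (e j) = symplectic_J $ i $ j" for i j
  proof -
    have "intersection_form \<pi> (b k) (a l) = (if k = l then - 1 else 0)" for k l
      using iform_antisym[OF H[of "Inr k"] H[of "Inl l"]] h by (auto simp: e_def hyperbolic_system_def)
    then show ?thesis using h
      by (cases i; cases j) (auto simp: e_def hyperbolic_system_def symplectic_J_def)
  qed
  have zero: "c j = 0" if "(\<Sum>i\<in>UNIV. c i *\<^sub>R e i) = 0" for c :: "'g + 'g \<Rightarrow> real" and j
  proof -
    have "0 = intersection_form \<pi> (\<Sum>i\<in>UNIV. c i *\<^sub>R e i) (e k)" for k
      unfolding that using iform_linear(3)[OF H H H, of 0] by simp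
    also have "\<dots> k = (\<Sum>i\<in>UNIV. c i * symplectic_J $ i $ k)" for k
      using iform_sum(1)[where I = UNIV and x = e and a = c and z = "e k", OF H H] by (simp add: J)
    finally have S: "(\<Sum>i\<in>UNIV. c i * symplectic_J $ i $ k) = 0" for k by simp
    have split: "(\<Sum>i\<in>UNIV. F i) = (\<Sum>k\<in>UNIV. F (Inl k)) + (\<Sum>k\<in>UNIV. F (Inr k))" for F :: "'g + 'g \<Rightarrow> real"
      unfolding UNIV_sum by (subst sum.union_disjoint) (auto simp: sum.reindex)
    show ?thesis
    proof (cases j)
      case (Inl k)
      show ?thesis using S[of "Inr k"]
        by (simp add: split Inl symplectic_J_def if_distrib[of "\<lambda>x. _ * x"] cong: if_cong)
    next
      case (Inr k)
      show ?thesis using S[of "Inl k"]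
        by (simp add: split Inr symplectic_J_def if_distrib[of "\<lambda>x. _ * x"] cong: if_cong)
    qed
  qed
  have "inj e" by (rule independent_family(1)[OF finite[of UNIV]]) (rule zero)
  have "independent (range e)" by (rule independent_family(2)[OF finite[of UNIV]]) (rule zero)
  have "dim (homology_space \<pi>) \<le> card (range e)"
    using card_image[OF \<open>inj e\<close>] card by (simp add: dim_homology[OF pp g])
  then have "homology_space \<pi> \<subseteq> span (range e)"
    using H \<open>independent (range e)\<close> by (intro card_ge_dim_independent) auto
  have "{\<Sum>i\<in>UNIV. c i *\<^sub>R e i | c. \<forall>i. c i \<in> \<int>} = homology_lattice \<pi>"
  proof (rule subset_antisym)
    show "{\<Sum>i\<in>UNIV. c i *\<^sub>R e i | c. \<forall>i. c i \<in> \<int>} \<subseteq> homology_lattice \<pi>"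
      using L by (auto intro!: lattice_combination[OF pp])
    show "homology_lattice \<pi> \<subseteq> {\<Sum>i\<in>UNIV. c i *\<^sub>R e i | c. \<forall>i. c i \<in> \<int>}"
    proof
      fix z assume z: "z \<in> homology_lattice \<pi>"
      let ?z = "complement_part \<pi> UNIV a b z"
      note cp = complement_part[OF pp h finite z]
      have zH: "?z \<in> homology_space \<pi>" using cp(1) by (auto intro: lattice_subsetD)
      have ze: "intersection_form \<pi> ?z (e i) = 0" for i using cp(2,3) by (cases i) (auto simp: e_def)
      have "?z = 0"
      proof (rule iform_nondegenerate[OF zH])
        fix y assume "y \<in> homology_space \<pi>"
        then have "y \<in> span (range e)" using \<open>homology_space \<pi> \<subseteq> span (range e)\<close> by blast
        then have "y \<in> homology_space \<pi> \<and> intersection_form \<pi> ?z y = 0"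
        proof (induction rule: span_induct_alt)
          case base
          then show ?case using subspace_0[OF subspace_homology] iform_linear(6)[OF zH zH zH, of 0] by simp
        next
          case (step c x y)
          then obtain i where "x = e i" by blast
          then show ?case
            using step ze[of i] H[of i] iform_linear(4)[of "c *\<^sub>R e i" \<pi> y ?z]
              iform_linear(6)[OF H[of i] H zH, of c] zH
            by (simp add: homology_space_add homology_space_scale)
        qed
        then show "intersection_form \<pi> ?z y = 0" by blast
      qed
      define c where "c = case_sum (\<lambda>k. intersection_form \<pi> z (b k)) (\<lambda>k. - intersection_form \<pi> z (a k))"
      have "z = (\<Sum>k\<in>UNIV. intersection_form \<pi> z (b k) *\<^sub>R a k + (- intersection_form \<pi> z (a k)) *\<^sub>R b k)"
        using \<open>?z = 0\<close> by (simp add: complement_part_def)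
      also have "\<dots> = (\<Sum>i\<in>UNIV. c i *\<^sub>R e i)"
        unfolding UNIV_sum
        by (subst sum.union_disjoint) (auto simp: sum.reindex sum_subtractf sum_negf c_def e_def)
      finally have "z = (\<Sum>i\<in>UNIV. c i *\<^sub>R e i)" .
      moreover have "c i \<in> \<int>" for i
      proof (cases i)
        case (Inl k)
        then show ?thesis using iform_int[OF z L[of "Inr k"]] by (simp add: c_def e_def)
      next
        case (Inr k)
        then show ?thesis using iform_int[OF z L[of "Inl k"]] by (simp add: c_def e_def)
      qed
      ultimately show "z \<in> {\<Sum>i\<in>UNIV. c i *\<^sub>R e i | c. \<forall>i. c i \<in> \<int>}" by blast
    qed
  qed
  then have "symplectic_lattice_basis \<pi> e"
    using \<open>inj e\<close> \<open>independent (range e)\<close> J by (simp add: symplectic_lattice_basis_def)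
  then show ?thesis by blast
qed

section \<open>Symplectic transvections\<close>

text \<open>The standard symplectic form.\<close>

abbreviation sp :: "real^('g::finite + 'g) \<Rightarrow> real^('g + 'g) \<Rightarrow> real" where
  "sp x y \<equiv> x \<bullet> (symplectic_J *v y)"

lemma J_antisym: "symplectic_J $ i $ j = - symplectic_J $ j $ i"
  by (cases i; cases j) (auto simp: symplectic_J_def)

lemma sp_antisym: "sp x y = - sp y x"
proof -
  have "sp x y = (\<Sum>i\<in>UNIV. \<Sum>j\<in>UNIV. x $ i * symplectic_J $ i $ j * y $ j)" for x y :: "real^('g::finite + 'g)"
    by (simp add: inner_vec_def matrix_vector_mult_def sum_distrib_left mult.assoc)
  note e = this
  have J: "y $ i * symplectic_J $ i $ j * x $ j = - (x $ j * symplectic_J $ j $ i * y $ i)" for i j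
    using J_antisym[of i j] by simp
  have "sp y x = (\<Sum>j\<in>UNIV. \<Sum>i\<in>UNIV. y $ i * symplectic_J $ i $ j * x $ j)"
    unfolding e by (rule sum.swap)
  then show ?thesis unfolding J e by (simp add: sum_negf)
qed

lemma sp_self: "sp x x = 0"
  using sp_antisym[of x x] by simp

lemma sp_linear:
  "sp (x + y) z = sp x z + sp y z" "sp z (x + y) = sp z x + sp z y"
  "sp (c *\<^sub>R x) z = c * sp x z" "sp z (c *\<^sub>R x) = c * sp z x"
  "sp (x - y) z = sp x z - sp y z" "sp z (x - y) = sp z x - sp z y"
  "sp 0 z = 0" "sp z 0 = 0"
  by (simp_all add: inner_add_left inner_add_right matrix_vector_right_distrib inner_diff_left
      inner_diff_right matrix_vector_mult_diff_distrib matrix_vector_mult_scaleR)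

lemma sp_axis: "sp (axis i 1) (axis j 1) = symplectic_J $ i $ j"
  by (simp add: inner_axis' matrix_vector_mult_axis_nth)

text \<open>The matrix of \<open>x \<mapsto> x + t \<langle>c, x\<rangle> c\<close> for the standard symplectic form.\<close>

definition transvection :: "real \<Rightarrow> real^('g::finite + 'g) \<Rightarrow> real^('g + 'g)^('g + 'g)" where
  "transvection t c = mat 1 + t *\<^sub>R outer c (- (symplectic_J *v c))"

lemma transvection_apply: "transvection t c *v x = x + (t * sp c x) *\<^sub>R c"
proof -
  have "(- (symplectic_J *v c)) \<bullet> x = sp c x"
    using sp_antisym[of c x] by (simp add: inner_commute)
  then show ?thesis
    by (simp add: transvection_def matrix_vector_mult_add_rdistrib scaleR_matrix_vector_assoc[symmetric] outer_mult_vec)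
qed

lemma Sp_real_iff: "M \<in> carrier Sp_real \<longleftrightarrow> (\<forall>x y. sp (M *v x) (M *v y) = sp x y)"
proof -
  have e: "sp (M *v x) (M *v y) = x \<bullet> ((transpose M ** symplectic_J ** M) *v y)" for x y
    by (metis dot_lmul_matrix matrix_vector_mul_assoc vector_transpose_matrix inner_commute)
  have "A = B" if "\<forall>x y. x \<bullet> (A *v y) = x \<bullet> (B *v y)" for A B :: "real^('a+'a)^('a+'a)"
    using that by (metis vector_eq_ldot matrix_eq)
  then show ?thesis unfolding e by (auto simp: Sp_real_def)
qed

lemma transvection_Sp: "transvection t c \<in> carrier Sp_real"
  unfolding Sp_real_iff transvection_apply
proof (intro allI)
  fix x y
  show "sp (x + (t * sp c x) *\<^sub>R c) (y + (t * sp c y) *\<^sub>R c) = sp x y"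
    using sp_antisym[of x c] by (simp add: sp_linear sp_self)
qed

lemma transvection_add: "transvection s c ** transvection t c = transvection (s + t) c"
  by (simp add: matrix_eq matrix_vector_mul_assoc[symmetric] transvection_apply sp_linear sp_self
      algebra_simps)

lemma transvection_0: "transvection 0 c = mat 1" "transvection t 0 = mat 1"
  by (simp_all add: matrix_eq transvection_apply)

lemma transvection_scale: "transvection t (s *\<^sub>R c) = transvection (t * s\<^sup>2) c"
  by (simp add: matrix_eq transvection_apply sp_linear power2_eq_square mult_ac)

lemma transvection_conj_transvection:
  "transvection r d ** transvection t c ** transvection (- r) d = transvection t (c + (r * sp d c) *\<^sub>R d)"
proof -
  have "transvection r d *v (transvection t c *v (transvection (- r) d *v x)) =
    transvection t (c + (r * sp d c) *\<^sub>R d) *v x" for x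
    using sp_antisym[of c d]
    by (simp add: transvection_apply sp_linear sp_self algebra_simps)
  then show ?thesis by (simp add: matrix_eq matrix_vector_mul_assoc[symmetric])
qed

section \<open>Transvections generate the symplectic group\<close>

text \<open>Products of transvections along vectors orthogonal to \<open>F\<close>; they fix \<open>F\<close> pointwise.\<close>

inductive_set transvections_fixing :: "(real^('g::finite + 'g)) set \<Rightarrow> (real^('g + 'g)^('g + 'g)) set"
  for F where
  one: "mat 1 \<in> transvections_fixing F"
| step: "S \<in> transvections_fixing F \<Longrightarrow> (\<And>x. x \<in> F \<Longrightarrow> sp c x = 0) \<Longrightarrow>
    transvection t c ** S \<in> transvections_fixing F"

lemma Sp_real_mult: "A \<in> carrier Sp_real \<Longrightarrow> B \<in> carrier Sp_real \<Longrightarrow> A ** B \<in> carrier Sp_real"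
  by (simp add: Sp_real_iff matrix_vector_mul_assoc[symmetric])

lemma transvections_fixing_props:
  assumes "S \<in> transvections_fixing F"
  shows "S \<in> carrier Sp_real" "x \<in> F \<Longrightarrow> S *v x = x"
    "(\<And>t c. transvection t c \<in> H) \<Longrightarrow> (\<And>A B. A \<in> H \<Longrightarrow> B \<in> H \<Longrightarrow> A ** B \<in> H) \<Longrightarrow> S ** M \<in> H \<Longrightarrow> M \<in> H"
  using assms
proof (induction arbitrary: x M)
  case one
  { case 1 then show ?case by (simp add: Sp_real_iff) }
  { case 2 then show ?case by simp }
  { case 3 then show ?case by simp }
next
  case (step S c t)
  { case 1 then show ?case using step by (simp add: Sp_real_mult transvection_Sp) }
  { case 2 then show ?case using step by (simp add: matrix_vector_mul_assoc[symmetric] transvection_apply) }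
  { case 3
    then have "transvection (- t) c ** (transvection t c ** S ** M) \<in> H" by blast
    then have "S ** M \<in> H"
      by (simp add: matrix_mul_assoc transvection_add transvection_0)
    then show ?case using step.IH(3) 3 by blast }
qed

lemma transvections_fixing_trans:
  assumes "S \<in> transvections_fixing F" "T \<in> transvections_fixing F"
  shows "S ** T \<in> transvections_fixing F"
  using assms by (induction) (auto simp: matrix_mul_assoc[symmetric] intro: transvections_fixing.step)

lemma transvections_reach1:
  assumes "sp u v \<noteq> 0" "\<And>x. x \<in> F \<Longrightarrow> sp (v - u) x = 0"
  shows "\<exists>S\<in>transvections_fixing F. S *v u = v"
proof -
  let ?t = "1 / sp v u"
  have ne: "sp v u \<noteq> 0" using assms sp_antisym[of u v] by simp
  have "transvection ?t (v - u) ** mat 1 \<in> transvections_fixing F"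
    using assms by (intro transvections_fixing.intros) auto
  moreover have "transvection ?t (v - u) *v u = v"
    using ne by (simp add: transvection_apply sp_linear sp_self)
  ultimately show ?thesis by auto
qed

lemma transvections_reach2:
  assumes "sp u w \<noteq> 0" "sp w v \<noteq> 0" "\<And>x. x \<in> F \<Longrightarrow> sp (w - u) x = 0" "\<And>x. x \<in> F \<Longrightarrow> sp (v - w) x = 0"
  shows "\<exists>S\<in>transvections_fixing F. S *v u = v"
proof -
  obtain S T where "S \<in> transvections_fixing F" "S *v u = w" "T \<in> transvections_fixing F" "T *v w = v"
    using transvections_reach1[of u w F] transvections_reach1[of w v F] assms by blast
  then show ?thesis
    by (intro bexI[of _ "T ** S"]) (simp_all add: transvections_fixing_trans matrix_vector_mul_assoc[symmetric])
qed

text \<open>The standard symplectic basis.\<close>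

abbreviation e_vec :: "'g::finite \<Rightarrow> real^('g + 'g)" where "e_vec k \<equiv> axis (Inl k) 1"
abbreviation f_vec :: "'g::finite \<Rightarrow> real^('g + 'g)" where "f_vec k \<equiv> axis (Inr k) 1"

lemma sp_ef: "sp (e_vec k) (f_vec l) = (if k = l then 1 else 0)"
  "sp (f_vec k) (e_vec l) = (if k = l then -1 else 0)"
  "sp (e_vec k) (e_vec l) = 0" "sp (f_vec k) (f_vec l) = 0"
  unfolding sp_axis by (simp_all add: symplectic_J_def)

text \<open>Induction on a finite set containing the indices \<open>k\<close> for which \<open>e\<^sub>k\<close> or \<open>f\<^sub>k\<close> is moved: transvections that fix all
  pairs already fixed carry \<open>M e\<^sub>k\<close> to \<open>e\<^sub>k\<close>, and then, fixing \<open>e\<^sub>k\<close> too, \<open>M f\<^sub>k\<close> to \<open>f\<^sub>k\<close>.\<close>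

lemma Sp_real_in_transvections:
  fixes H :: "(real^('g::finite + 'g)^('g + 'g)) set"
  assumes tv: "\<And>t c. transvection t c \<in> H" and mult: "\<And>A B. A \<in> H \<Longrightarrow> B \<in> H \<Longrightarrow> A ** B \<in> H"
  shows "carrier Sp_real \<subseteq> H"
proof -
  have main: "M \<in> H" if "finite A" "M \<in> carrier Sp_real"
    "\<And>k. k \<notin> A \<Longrightarrow> M *v e_vec k = e_vec k \<and> M *v f_vec k = f_vec k" for A :: "'g set" and M
    using that
  proof (induction A arbitrary: M rule: finite_induct)
    case empty
    have "M *v axis i 1 = axis i 1" for i using empty by (cases i) auto
    then have "M $ j $ i = mat 1 $ j $ i" for i j
      by (metis matrix_vector_mult_axis_nth matrix_vector_mul_lid)
    then have "M = mat 1" by (simp add: vec_eq_iff)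
    then show ?case using tv[of 0 0] by (simp add: transvection_0)
  next
    case (insert k A)
    define F where "F = (e_vec ` (- insert k A) \<union> f_vec ` (- insert k A) :: (real^('g + 'g)) set)"
    have F: "sp (e_vec k) x = 0" "sp (f_vec k) x = 0" "M *v x = x" if "x \<in> F" for x
      using that insert.prems(2) by (auto simp: F_def sp_ef split: if_splits)
    have M: "sp (M *v x) (M *v y) = sp x y" for x y using insert.prems(1) by (simp add: Sp_real_iff)
    let ?u = "M *v e_vec k"
    let ?v = "M *v f_vec k"
    have MF: "sp ?u x = 0" "sp ?v x = 0" if "x \<in> F" for x
      using F[OF that] M[of "e_vec k" x] M[of "f_vec k" x] by simp_all
    have uv: "sp ?u ?v = 1" by (simp add: M sp_ef)
    have "\<exists>S\<in>transvections_fixing F. S *v ?u = e_vec k"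
    proof -
      \<comment> \<open>One of \<open>f\<^sub>k\<close>, \<open>M f\<^sub>k\<close> and their sum is orthogonal to neither \<open>M e\<^sub>k\<close> nor \<open>e\<^sub>k\<close>.\<close>
      have "\<exists>w. sp ?u w \<noteq> 0 \<and> sp w (e_vec k) \<noteq> 0 \<and> (\<forall>x\<in>F. sp w x = 0)"
      proof (cases "sp ?u (f_vec k) = 0")
        case False
        then show ?thesis using F by (intro exI[of _ "f_vec k"]) (simp add: sp_ef)
      next
        case u0: True
        show ?thesis
        proof (cases "sp ?v (e_vec k) = 0")
          case False
          then show ?thesis using MF uv by (intro exI[of _ ?v]) simp
        next
          case True
          then show ?thesis using u0 F MF uv
            by (intro exI[of _ "f_vec k + ?v"]) (simp add: sp_ef sp_linear)
        qed
      qed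
      then obtain w where "sp ?u w \<noteq> 0" "sp w (e_vec k) \<noteq> 0" "\<And>x. x \<in> F \<Longrightarrow> sp w x = 0" by blast
      then show ?thesis using F MF by (intro transvections_reach2[of _ w]) (simp_all add: sp_linear)
    qed
    then obtain S where S: "S \<in> transvections_fixing F" "S *v ?u = e_vec k" by blast
    note Sp = transvections_fixing_props[OF S(1)]
    define M1 where "M1 = S ** M"
    have M1: "sp (M1 *v x) (M1 *v y) = sp x y" "M1 \<in> carrier Sp_real" "M1 *v e_vec k = e_vec k" for x y
      using Sp_real_mult[OF Sp(1) insert.prems(1)] S(2)
      by (simp_all add: Sp_real_iff M1_def matrix_vector_mul_assoc[symmetric])
    have M1F: "M1 *v x = x" if "x \<in> insert (e_vec k) F" for x
      using that M1 Sp(2) F by (auto simp: M1_def matrix_vector_mul_assoc[symmetric])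
    let ?w = "M1 *v f_vec k"
    have w: "sp ?w x = sp (f_vec k) x" if "x \<in> insert (e_vec k) F" for x
      using M1(1)[of "f_vec k" x] M1F[OF that] by simp
    have we: "sp ?w (e_vec k) = - 1" using w by (simp add: sp_ef)
    have "\<exists>S\<in>transvections_fixing (insert (e_vec k) F). S *v ?w = f_vec k"
    proof (cases "sp ?w (f_vec k) = 0")
      case False
      then show ?thesis using w by (intro transvections_reach1) (simp_all add: sp_linear)
    next
      case True
      have "sp (e_vec k) x = 0" if "x \<in> insert (e_vec k) F" for x
        using that F by (auto simp: sp_ef)
      then show ?thesis using w True we
        by (intro transvections_reach2[of _ "e_vec k + f_vec k"]) (simp_all add: sp_linear sp_ef)
    qed
    then obtain T where T: "T \<in> transvections_fixing (insert (e_vec k) F)" "T *v ?w = f_vec k" by blast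
    note Tp = transvections_fixing_props[OF T(1)]
    have "T ** M1 \<in> H"
    proof (rule insert.IH)
      show "T ** M1 \<in> carrier Sp_real" by (intro Sp_real_mult Tp(1) M1(2))
      have fx: "T ** M1 *v x = x" if "x \<in> insert (e_vec k) F" for x
        using Tp(2)[OF that] M1F[OF that] by (simp add: matrix_vector_mul_assoc[symmetric])
      show "T ** M1 *v e_vec l = e_vec l \<and> T ** M1 *v f_vec l = f_vec l" if "l \<notin> A" for l
      proof (cases "l = k")
        case True
        then show ?thesis using fx T(2) by (simp add: matrix_vector_mul_assoc[symmetric])
      next
        case False
        then have "e_vec l \<in> F" "f_vec l \<in> F" using that by (auto simp: F_def)
        then show ?thesis using fx by blast
      qed
    qed
    then have "M1 \<in> H" using Tp(3)[of H M1] tv mult by blast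
    then show ?case unfolding M1_def using Sp(3)[of H M] tv mult by blast
  qed
  show ?thesis
  proof
    fix M :: "real^('g + 'g)^('g + 'g)" assume "M \<in> carrier Sp_real"
    then show "M \<in> H" by (rule main[of UNIV, rotated]) simp_all
  qed
qed

section \<open>Zariski closures\<close>

text \<open>The common zeros of all polynomials that vanish on \<open>G\<close>.\<close>

definition zariski_closure :: "'v::real_normed_vector set \<Rightarrow> 'v set" where
  "zariski_closure G = {x. \<forall>p. real_polynomial_function p \<and> (\<forall>g\<in>G. p g = 0) \<longrightarrow> p x = 0}"

lemma zariski_closure_subset: "G \<subseteq> zariski_closure G"
  by (auto simp: zariski_closure_def)

lemma zariski_closure_minimal:
  assumes "zariski_closed Z" "G \<subseteq> Z"
  shows "zariski_closure G \<subseteq> Z"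
proof -
  obtain P where P: "\<And>p. p \<in> P \<Longrightarrow> real_polynomial_function p" "Z = {x. \<forall>p\<in>P. p x = 0}"
    using assms(1) unfolding zariski_closed_def by blast
  have "p x = 0" if "x \<in> zariski_closure G" "p \<in> P" for x p
    using that P(1)[OF that(2)] P(2) assms(2) unfolding zariski_closure_def by blast
  then show ?thesis using P(2) by blast
qed

lemma zariski_closure_mult:
  fixes G :: "(real^'n^'n) set"
  assumes mult: "\<And>A B. A \<in> G \<Longrightarrow> B \<in> G \<Longrightarrow> A ** B \<in> G"
    and A: "A \<in> zariski_closure G" and B: "B \<in> zariski_closure G"
  shows "A ** B \<in> zariski_closure G"
proof -
  have lin: "bounded_linear (\<lambda>X :: real^'n^'n. C ** X)" "bounded_linear (\<lambda>X :: real^'n^'n. X ** C)" for C :: "real^'n^'n"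
  proof -
    have scale: "C ** (r *\<^sub>R X) = r *\<^sub>R (C ** X)" "(r *\<^sub>R X) ** C = r *\<^sub>R (X ** C)"
      for r and X :: "real^'n^'n"
      by (simp_all add: matrix_matrix_mult_def vec_eq_iff sum_distrib_left mult.assoc mult.left_commute)
    have "linear (\<lambda>X :: real^'n^'n. C ** X)" "linear (\<lambda>X :: real^'n^'n. X ** C)"
      by (auto intro!: linearI simp: matrix_add_ldistrib matrix_add_rdistrib scale)
    then show "bounded_linear (\<lambda>X :: real^'n^'n. C ** X)" "bounded_linear (\<lambda>X :: real^'n^'n. X ** C)"
      by (simp_all add: linear_conv_bounded_linear)
  qed
  have left: "C ** X \<in> zariski_closure G" if "C \<in> G" "X \<in> zariski_closure G" for C X
    unfolding zariski_closure_def
  proof (intro CollectI allI impI)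
    fix p :: "real^'n^'n \<Rightarrow> real" assume p: "real_polynomial_function p \<and> (\<forall>g\<in>G. p g = 0)"
    then have "real_polynomial_function (p \<circ> (\<lambda>X. C ** X))"
      by (intro real_polynomial_function_compose polynomial_function_bounded_linear lin) auto
    moreover have "\<forall>g\<in>G. (p \<circ> (\<lambda>X. C ** X)) g = 0" using p mult that by auto
    ultimately show "p (C ** X) = 0" using that(2) by (auto simp: zariski_closure_def)
  qed
  show ?thesis
    unfolding zariski_closure_def
  proof (intro CollectI allI impI)
    fix p :: "real^'n^'n \<Rightarrow> real" assume p: "real_polynomial_function p \<and> (\<forall>g\<in>G. p g = 0)"
    then have "real_polynomial_function (p \<circ> (\<lambda>X. X ** B))"
      by (intro real_polynomial_function_compose polynomial_function_bounded_linear lin) auto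
    moreover have "\<forall>g\<in>G. (p \<circ> (\<lambda>X. X ** B)) g = 0"
      using p left B by (auto simp: zariski_closure_def)
    ultimately show "p (A ** B) = 0" using A by (auto simp: zariski_closure_def)
  qed
qed

text \<open>A polynomial curve lies in the closure as soon as infinitely many of its points do.\<close>

lemma zariski_closure_curve:
  fixes \<gamma> :: "real \<Rightarrow> 'v::euclidean_space"
  assumes \<gamma>: "polynomial_function \<gamma>" and inf: "infinite {t. \<gamma> t \<in> zariski_closure G}"
  shows "\<gamma> t \<in> zariski_closure G"
  unfolding zariski_closure_def
proof (intro CollectI allI impI)
  fix p :: "'v \<Rightarrow> real" assume p: "real_polynomial_function p \<and> (\<forall>g\<in>G. p g = 0)"
  then have "real_polynomial_function (p \<circ> \<gamma>)" using \<gamma> by blast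
  then obtain a n where a: "p \<circ> \<gamma> = (\<lambda>x. \<Sum>i\<le>n. a i * x ^ i)"
    using real_polynomial_function_imp_sum by blast
  have pa: "p (\<gamma> x) = (\<Sum>i\<le>n. a i * x ^ i)" for x using fun_cong[OF a, of x] by simp
  have "{t. \<gamma> t \<in> zariski_closure G} \<subseteq> {x. (\<Sum>i\<le>n. a i * x ^ i) = 0}"
    using p by (auto simp: pa[symmetric] zariski_closure_def)
  then have "infinite {x. (\<Sum>i\<le>n. a i * x ^ i) = 0}" using inf finite_subset by blast
  then have "\<forall>i\<le>n. a i = 0" using polyfun_finite_roots by blast
  then show "p (\<gamma> t) = 0" by (simp add: pa)
qed

lemma transvection_mem_closure:
  assumes T: "transvection 1 c \<in> G" and one: "mat 1 \<in> G" and mult: "\<And>A B. A \<in> G \<Longrightarrow> B \<in> G \<Longrightarrow> A ** B \<in> G"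
  shows "transvection t c \<in> zariski_closure G"
proof (rule zariski_closure_curve)
  have "transvection (real n) c \<in> G" for n
  proof (induction n)
    case (Suc n)
    then have "transvection 1 c ** transvection (real n) c \<in> G" by (rule mult[OF T])
    then show ?case by (simp add: transvection_add)
  qed (simp add: transvection_0 one)
  then have "range real \<subseteq> {t. transvection t c \<in> zariski_closure G}"
    using zariski_closure_subset by blast
  moreover have "infinite (range real)"
    by (simp add: finite_image_iff inj_on_def)
  ultimately show "infinite {t. transvection t c \<in> zariski_closure G}" using finite_subset by blast
  show "polynomial_function (\<lambda>t. transvection t c)"
    unfolding transvection_def
    by (intro polynomial_function_add polynomial_function_const polynomial_function_mult polynomial_function_id)
qed

section \<open>Density of groups generated by transvections\<close>

text \<open>Let \<open>V\<close> be the set of the vectors \<open>c\<close> all of whose transvections, with arbitrary real parameter, are in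
  the closure. Among the subspaces contained in \<open>V\<close> and containing some \<open>c0 \<in> C\<close>, let \<open>W\<close> have maximal
  dimension. Were \<open>C\<close> not contained in \<open>W\<close>, some \<open>d \<in> C - W\<close> would be non-orthogonal to \<open>W\<close>, and \<open>W + \<real> d\<close>
  would be contained in \<open>V\<close> as well.\<close>

lemma transvections_dense:
  fixes G :: "(real^('g::finite + 'g)^('g + 'g)) set"
  assumes one: "mat 1 \<in> G" and mult: "\<And>A B. A \<in> G \<Longrightarrow> B \<in> G \<Longrightarrow> A ** B \<in> G"
    and C: "\<And>c. c \<in> C \<Longrightarrow> transvection 1 c \<in> G" and span: "span C = UNIV" and ne: "C \<noteq> {}"
    and conn: "\<And>S. S \<subseteq> C \<Longrightarrow> S \<noteq> {} \<Longrightarrow> S \<noteq> C \<Longrightarrow> \<exists>c\<in>S. \<exists>d\<in>C - S. sp c d \<noteq> 0"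
  shows "carrier Sp_real \<subseteq> zariski_closure G"
proof -
  let ?H = "zariski_closure G"
  note Hmult = zariski_closure_mult[OF mult]
  define V where "V = {c. \<forall>t. transvection t c \<in> ?H}"
  have CV: "C \<subseteq> V" using transvection_mem_closure[OF C one mult] by (auto simp: V_def)
  have scale: "s *\<^sub>R c \<in> V" if "c \<in> V" for s c
    using that by (simp add: V_def transvection_scale)
  have add: "c + s *\<^sub>R d \<in> V" if "c \<in> V" "d \<in> V" "sp d c \<noteq> 0" for c d s
    unfolding V_def
  proof (intro CollectI allI)
    fix t
    let ?r = "s / sp d c"
    have "transvection ?r d ** transvection t c ** transvection (- ?r) d \<in> ?H"
      using that by (intro Hmult) (auto simp: V_def)
    then show "transvection t (c + s *\<^sub>R d) \<in> ?H"
      unfolding transvection_conj_transvection using that(3) by simp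
  qed
  have limit: "c \<in> V" if lim: "\<And>\<epsilon>. \<epsilon> \<noteq> 0 \<Longrightarrow> c + \<epsilon> *\<^sub>R d \<in> V" for c d
    unfolding V_def
  proof (intro CollectI allI)
    fix t
    have "polynomial_function (\<lambda>\<epsilon>. transvection t (c + \<epsilon> *\<^sub>R d))"
      unfolding transvection_def outer_add_left outer_add_right outer_scale_left outer_scale_right
        matrix_vector_right_distrib matrix_vector_mult_scaleR minus_add_distrib scaleR_minus_right[symmetric]
      by (intro polynomial_function_add polynomial_function_const polynomial_function_mult polynomial_function_id)
    moreover have "- {0} \<subseteq> {\<epsilon>. transvection t (c + \<epsilon> *\<^sub>R d) \<in> ?H}"
      using lim by (auto simp: V_def)
    then have "infinite {\<epsilon>. transvection t (c + \<epsilon> *\<^sub>R d) \<in> ?H}"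
      using finite_subset infinite_UNIV_char_0[where 'a = real] by (metis finite_compl finite.emptyI finite.insertI)
    ultimately have "transvection t (c + 0 *\<^sub>R d) \<in> ?H" by (rule zariski_closure_curve)
    then show "transvection t c \<in> ?H" by simp
  qed
  obtain c0 where c0: "c0 \<in> C" using ne by blast
  let ?P = "\<lambda>W. subspace W \<and> W \<subseteq> V \<and> c0 \<in> W"
  have "span {c0} \<subseteq> V" using scale CV c0 by (auto simp: span_singleton)
  then have "?P (span {c0})" by (auto intro: span_base)
  moreover have "\<forall>W. ?P W \<longrightarrow> dim W < Suc (DIM(real^('g + 'g)))"
    using dim_subset_UNIV[where 'a = "real^('g + 'g)"] unfolding less_Suc_eq_le by blast
  ultimately have "\<exists>W. ?P W \<and> (\<forall>W'. ?P W' \<longrightarrow> dim W' \<le> dim W)"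
    by (rule Lattices_Big.ex_has_greatest_nat)
  then obtain W where W: "?P W" and max: "\<And>W'. ?P W' \<Longrightarrow> dim W' \<le> dim W" by blast
  have "C \<subseteq> W"
  proof (rule ccontr)
    assume "\<not> C \<subseteq> W"
    then obtain c d where cd: "c \<in> W" "d \<in> C" "d \<notin> W" "sp c d \<noteq> 0"
      using conn[of "C \<inter> W"] c0 W by blast
    have "sp d c \<noteq> 0" using cd(4) sp_antisym[of c d] by simp
    have sW: "span W = W" using W by (simp add: span_eq_iff)
    have "span (insert d W) \<subseteq> V"
    proof
      fix x assume "x \<in> span (insert d W)"
      then obtain s where "x - s *\<^sub>R d \<in> W" using sW by (metis span_breakdown_eq)
      then obtain w where w: "w \<in> W" "x = w + s *\<^sub>R d" by (metis diff_add_cancel)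
      show "x \<in> V"
      proof (cases "sp d w = 0")
        case False
        then show ?thesis using w add W cd CV by blast
      next
        case True
        show ?thesis
        \<comment> \<open>Here \<open>w\<close> is orthogonal to \<open>d\<close>, but \<open>w + \<epsilon> c\<close> is not.\<close>
        proof (rule limit[of x c])
          fix \<epsilon> :: real assume "\<epsilon> \<noteq> 0"
          have "w + \<epsilon> *\<^sub>R c \<in> W" using w cd W by (simp add: subspace_add subspace_scale)
          moreover have "sp d (w + \<epsilon> *\<^sub>R c) \<noteq> 0"
            using True \<open>sp d c \<noteq> 0\<close> \<open>\<epsilon> \<noteq> 0\<close> by (simp add: sp_linear)
          ultimately have "(w + \<epsilon> *\<^sub>R c) + s *\<^sub>R d \<in> V" using add W cd CV by blast
          then show "x + \<epsilon> *\<^sub>R c \<in> V" by (simp add: w algebra_simps)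
        qed
      qed
    qed
    moreover have "c0 \<in> span (insert d W)" using W by (simp add: span_base)
    ultimately have "dim (span (insert d W)) \<le> dim W" using max[of "span (insert d W)"] by blast
    then show False using cd sW by (simp add: dim_insert)
  qed
  then have "V = UNIV" using W span by (metis span_minimal top.extremum_uniqueI order_trans)
  then have "transvection t c \<in> ?H" for t c by (auto simp: V_def)
  then show ?thesis by (rule Sp_real_in_transvections) (rule Hmult)
qed

section \<open>The group in symplectic coordinates\<close>

text \<open>As \<open>B \<Omega> = \<Omega> C\<^sup>T\<close> for the inverse \<open>C\<close> of \<open>B\<close>, which is integral, \<open>B\<close> preserves the homology space, the
  lattice and the form.\<close>

lemma rv_matrix_homology:
  assumes B: "rv_matrix \<pi> B" and irr: "irreducible_pair (\<pi> :: 'a::finite perm_pair)" "CARD('a) \<ge> 2"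
  shows "x \<in> homology_space \<pi> \<Longrightarrow> B *v x \<in> homology_space \<pi>"
    and "x \<in> homology_lattice \<pi> \<Longrightarrow> B *v x \<in> homology_lattice \<pi>"
    and "x \<in> homology_space \<pi> \<Longrightarrow> y \<in> homology_space \<pi> \<Longrightarrow>
      intersection_form \<pi> (B *v x) (B *v y) = intersection_form \<pi> x y"
proof -
  obtain C where C: "int_matrix C" "B ** C = mat 1" and \<Omega>: "B ** Omega \<pi> ** transpose B = Omega \<pi>"
    using rv_matrix_properties[OF assms] by blast
  have "transpose B ** transpose C = mat 1"
    using C(2) matrix_inverse_commute[of B C] by (metis matrix_transpose_mul transpose_mat)
  then have "B ** Omega \<pi> = B ** Omega \<pi> ** (transpose B ** transpose C)" by simp
  also have "\<dots> = Omega \<pi> ** transpose C" using \<Omega> by (simp add: matrix_mul_assoc)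
  finally have BO: "B *v (Omega \<pi> *v u) = Omega \<pi> *v (transpose C *v u)" for u
    unfolding matrix_vector_mul_assoc by (rule arg_cong)
  show "B *v x \<in> homology_space \<pi>" if "x \<in> homology_space \<pi>"
  proof -
    from that obtain u where "x = Omega \<pi> *v u" by (rule homology_spaceE)
    then show ?thesis by (simp only: BO Omega_in)
  qed
  show "B *v x \<in> homology_lattice \<pi>" if "x \<in> homology_lattice \<pi>"
  proof -
    from that obtain u where u: "x = Omega \<pi> *v u" "\<And>\<alpha>. u $ \<alpha> \<in> \<int>" by (auto simp: homology_lattice_def)
    have "(transpose C *v u) $ \<alpha> \<in> \<int>" for \<alpha>
      using C(1) u(2) by (auto simp: int_matrix_def matrix_vector_mult_def transpose_def intro!: Ints_sum Ints_mult)
    then have "Omega \<pi> *v (transpose C *v u) \<in> homology_lattice \<pi>"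
      unfolding homology_lattice_def by blast
    then show ?thesis unfolding u(1) BO .
  qed
  show "intersection_form \<pi> (B *v x) (B *v y) = intersection_form \<pi> x y"
    if "x \<in> homology_space \<pi>" "y \<in> homology_space \<pi>"
  proof -
    from that obtain u v where uv: "x = Omega \<pi> *v u" "y = Omega \<pi> *v v" by (auto elim!: homology_spaceE)
    have "intersection_form \<pi> (B *v x) (B *v y) = (transpose C *v u) \<bullet> (B *v (Omega \<pi> *v v))"
      unfolding uv BO intersection_form_Omega ..
    also have "\<dots> = u \<bullet> (C *v (B *v (Omega \<pi> *v v)))"
      by (simp add: dot_lmul_matrix)
    also have "C *v (B *v (Omega \<pi> *v v)) = Omega \<pi> *v v"
      using C(2) matrix_inverse_commute[of B C] by (simp add: matrix_vector_mul_assoc matrix_mul_assoc)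
    finally show ?thesis by (simp add: uv intersection_form_Omega)
  qed
qed

abbreviation restricted :: "'a::finite perm_pair \<Rightarrow> real^'a^'a \<Rightarrow> real^'a \<Rightarrow> real^'a" where
  "restricted \<pi> B \<equiv> restrict (\<lambda>x. B *v x) (homology_space \<pi>)"

lemma restricted_Bij:
  assumes B: "rv_matrix \<pi> B" and irr: "irreducible_pair (\<pi> :: 'a::finite perm_pair)" "CARD('a) \<ge> 2"
  shows "restricted \<pi> B \<in> carrier (BijGroup (homology_space \<pi>))"
proof -
  obtain C where C: "B ** C = mat 1" using rv_matrix_properties[OF assms] by blast
  have rC: "rv_matrix \<pi> C" by (rule rv_matrix.inverse[OF B C])
  have CB: "C ** B = mat 1" using C matrix_inverse_commute by blast
  have "bij_betw (restricted \<pi> B) (homology_space \<pi>) (homology_space \<pi>)"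
    by (rule bij_betw_byWitness[where f' = "\<lambda>x. C *v x"])
       (auto simp: rv_matrix_homology(1)[OF B irr] rv_matrix_homology(1)[OF rC irr] matrix_vector_mul_assoc C CB)
  then show ?thesis by (simp add: BijGroup_def Bij_def)
qed

lemma restricted_mult:
  assumes "rv_matrix \<pi> A" "rv_matrix \<pi> B" and irr: "irreducible_pair (\<pi> :: 'a::finite perm_pair)" "CARD('a) \<ge> 2"
  shows "restricted \<pi> A \<otimes>\<^bsub>BijGroup (homology_space \<pi>)\<^esub> restricted \<pi> B = restricted \<pi> (A ** B)"
  using restricted_Bij[OF assms(1) irr] restricted_Bij[OF assms(2) irr] rv_matrix_homology(1)[OF assms(2) irr]
  by (auto simp: BijGroup_def compose_def fun_eq_iff matrix_vector_mul_assoc)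

lemma restricted_one: "\<one>\<^bsub>BijGroup (homology_space \<pi>)\<^esub> = restricted \<pi> (mat 1)"
  by (simp add: BijGroup_def)

lemma restricted_inverse:
  assumes "rv_matrix \<pi> A" "A ** B = mat 1" and irr: "irreducible_pair (\<pi> :: 'a::finite perm_pair)" "CARD('a) \<ge> 2"
  shows "inv\<^bsub>BijGroup (homology_space \<pi>)\<^esub> restricted \<pi> A = restricted \<pi> B"
proof (rule group.inv_equality[OF group_BijGroup])
  have B: "rv_matrix \<pi> B" by (rule rv_matrix.inverse[OF assms(1,2)])
  show "restricted \<pi> B \<otimes>\<^bsub>BijGroup (homology_space \<pi>)\<^esub> restricted \<pi> A = \<one>\<^bsub>BijGroup (homology_space \<pi>)\<^esub>"
    unfolding restricted_mult[OF B assms(1) irr] restricted_one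
    using assms(2) matrix_inverse_commute[of A B] by simp
  show "restricted \<pi> A \<in> carrier (BijGroup (homology_space \<pi>))"
    "restricted \<pi> B \<in> carrier (BijGroup (homology_space \<pi>))"
    by (intro restricted_Bij assms B irr)+
qed

lemma rauzy_veech_group_eq:
  assumes irr: "irreducible_pair (\<pi> :: 'a::finite perm_pair)" "CARD('a) \<ge> 2"
  shows "rauzy_veech_group \<pi> = restricted \<pi> ` {B. rv_matrix \<pi> B}"
proof (rule subset_antisym)
  let ?G = "BijGroup (homology_space \<pi>)"
  let ?S = "{restrict (\<lambda>x. B *v x) (homology_space \<pi>) | B. rauzy_path \<pi> B \<pi>}"
  show "rauzy_veech_group \<pi> \<subseteq> restricted \<pi> ` {B. rv_matrix \<pi> B}"
  proof
    fix h assume "h \<in> rauzy_veech_group \<pi>"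
    then have "h \<in> generate ?G ?S" by (simp add: rauzy_veech_group_def)
    then show "h \<in> restricted \<pi> ` {B. rv_matrix \<pi> B}"
    proof (induction rule: generate.induct)
      case one
      have "rv_matrix \<pi> (mat 1)" by (rule rv_matrix.loop[OF rauzy_path.refl])
      then show ?case unfolding restricted_one by blast
    next
      case (incl h)
      then show ?case by (blast intro: rv_matrix.loop)
    next
      case (inv h)
      then obtain B where B: "h = restricted \<pi> B" "rauzy_path \<pi> B \<pi>" by blast
      obtain C where C: "B ** C = mat 1" using path_int_inverse[OF B(2) irr] by blast
      have rB: "rv_matrix \<pi> B" by (rule rv_matrix.loop[OF B(2)])
      show ?case
        unfolding B(1) restricted_inverse[OF rB C irr] using rv_matrix.inverse[OF rB C] by blast
    next
      case (eng h1 h2)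
      then obtain A B where "h1 = restricted \<pi> A" "rv_matrix \<pi> A" "h2 = restricted \<pi> B" "rv_matrix \<pi> B" by blast
      then show ?case using restricted_mult[of \<pi> A B] rv_matrix.mult[of \<pi> A B] irr by auto
    qed
  qed
  have S: "?S \<subseteq> carrier ?G" using restricted_Bij[OF rv_matrix.loop irr] by blast
  show "restricted \<pi> ` {B. rv_matrix \<pi> B} \<subseteq> rauzy_veech_group \<pi>"
  proof (rule image_subsetI)
    fix B assume "B \<in> {B. rv_matrix \<pi> B}"
    then have "rv_matrix \<pi> B" by simp
    then have "restricted \<pi> B \<in> generate ?G ?S"
    proof (induction rule: rv_matrix.induct)
      case (loop B)
      then show ?case by (intro generate.incl) blast
    next
      case (mult A B)
      show ?case using generate.eng[OF mult.IH] unfolding restricted_mult[OF mult.hyps irr] .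
    next
      case (inverse A B)
      show ?case
        using group.generate_m_inv_closed[OF group_BijGroup S inverse.IH] unfolding restricted_inverse[OF inverse.hyps irr] .
    qed
    then show "restricted \<pi> B \<in> rauzy_veech_group \<pi>" by (simp add: rauzy_veech_group_def)
  qed
qed

text \<open>An irreducible pair with a symplectic basis of its lattice. For \<open>d = 1\<close> irreducibility is vacuous and the
  only arrow has the same winner and loser, hence the bound on \<open>d\<close>.\<close>

locale symplectic_coordinates =
  fixes \<pi> :: "'a::finite perm_pair" and e :: "'g::finite + 'g \<Rightarrow> real^'a"
  assumes irr: "irreducible_pair \<pi>" and card: "CARD('a) \<ge> 2" and basis: "symplectic_lattice_basis \<pi> e"
begin

text \<open>The vector with the coordinates \<open>x\<close> in the basis \<open>e\<close>.\<close>

definition E :: "real^('g + 'g) \<Rightarrow> real^'a" where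
  "E x = (\<Sum>i\<in>UNIV. x $ i *\<^sub>R e i)"

lemma linear_E: "linear E"
  by (rule linearI) (simp_all add: E_def scaleR_add_left sum.distrib scaleR_sum_right)

lemma E_axis: "E (axis i 1) = e i"
  by (simp add: E_def axis_def if_distrib[of "\<lambda>x. x *\<^sub>R _"] cong: if_cong)

lemma E_cancel: "E x = E y \<longleftrightarrow> x = y"
proof -
  have "z = 0" if "E z = 0" for z
  proof -
    have inj: "inj e" and "independent (range e)" using basis by (simp_all add: symplectic_lattice_basis_def)
    have "(\<Sum>v\<in>range e. (z $ inv_into UNIV e v) *\<^sub>R v) = (\<Sum>i\<in>UNIV. z $ i *\<^sub>R e i)"
      using inj by (subst sum.reindex) simp_all
    also have "\<dots> = 0" using that by (simp add: E_def)
    finally have "\<forall>v\<in>range e. z $ inv_into UNIV e v = 0"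
      using \<open>independent (range e)\<close>[unfolded independent_explicit, THEN conjunct2,
          THEN spec, of "\<lambda>v. z $ inv_into UNIV e v"] by blast
    then show "z = 0" using inj by (simp add: vec_eq_iff)
  qed
  from this[of "x - y"] show ?thesis by (auto simp: linear_diff[OF linear_E])
qed

lemma lattice_eq: "{\<Sum>i\<in>UNIV. c i *\<^sub>R e i | c. \<forall>i. c i \<in> \<int>} = homology_lattice \<pi>"
  using basis by (simp add: symplectic_lattice_basis_def)

lemma e_lattice: "e i \<in> homology_lattice \<pi>"
proof -
  have "e i = (\<Sum>j\<in>UNIV. (if j = i then 1 else 0) *\<^sub>R e j)"
    by (simp add: if_distrib[of "\<lambda>x. x *\<^sub>R _"] cong: if_cong)
  moreover have "\<forall>j. (if j = i then 1 else 0 :: real) \<in> \<int>" by simp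
  ultimately have "\<exists>c. e i = (\<Sum>j\<in>UNIV. c j *\<^sub>R e j) \<and> (\<forall>j. c j \<in> \<int>)" by (intro exI[of _ "\<lambda>j. if j = i then 1 else 0"] conjI)
  then have "e i \<in> {\<Sum>i\<in>UNIV. c i *\<^sub>R e i | c. \<forall>i. c i \<in> \<int>}" by blast
  then show ?thesis unfolding lattice_eq .
qed

lemma lattice_E:
  assumes "x \<in> homology_lattice \<pi>"
  obtains c where "x = E c" "\<And>i. c $ i \<in> \<int>"
proof -
  have "x \<in> {\<Sum>i\<in>UNIV. c i *\<^sub>R e i | c. \<forall>i. c i \<in> \<int>}"
    using assms unfolding lattice_eq .
  then obtain c where "x = (\<Sum>i\<in>UNIV. c i *\<^sub>R e i)" "\<forall>i. c i \<in> \<int>" by blast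
  then show thesis by (intro that[of "\<chi> i. c i"]) (simp_all add: E_def)
qed

lemma range_E: "range E = homology_space \<pi>"
proof (rule subset_antisym)
  have "E x \<in> homology_space \<pi>" for x
    unfolding E_def by (intro homology_space_sum homology_space_scale lattice_subsetD e_lattice)
  then show "range E \<subseteq> homology_space \<pi>" by blast
  have "homology_lattice \<pi> \<subseteq> range E" by (rule subsetI, erule lattice_E) blast
  moreover have "subspace (range E)" using linear_subspace_image[OF linear_E] by simp
  ultimately show "homology_space \<pi> \<subseteq> range E" using span_minimal lattice_span by metis
qed

lemma E_homology: "E x \<in> homology_space \<pi>"
  using range_E by blast

lemma form_E: "intersection_form \<pi> (E x) (E y) = sp x y"
proof -
  have eH: "e i \<in> homology_space \<pi>" for i by (rule lattice_subsetD[OF e_lattice])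
  have J: "intersection_form \<pi> (e i) (e j) = symplectic_J $ i $ j" for i j
    using basis by (simp add: symplectic_lattice_basis_def)
  have "intersection_form \<pi> (E x) (E y) = (\<Sum>i\<in>UNIV. x $ i * intersection_form \<pi> (e i) (E y))"
    unfolding E_def[of x] by (rule iform_sum(1)[OF eH E_homology])
  also have "\<dots> = (\<Sum>i\<in>UNIV. x $ i * (\<Sum>j\<in>UNIV. y $ j * intersection_form \<pi> (e i) (e j)))"
    unfolding E_def by (simp only: iform_sum(2)[OF eH eH])
  finally show ?thesis by (simp add: J inner_vec_def matrix_vector_mult_def mult.commute)
qed

lemma E_columns: "E (M *v x) = (\<Sum>j\<in>UNIV. x $ j *\<^sub>R (\<Sum>i\<in>UNIV. M $ i $ j *\<^sub>R e i))"
proof -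
  have "E (M *v x) = (\<Sum>i\<in>UNIV. \<Sum>j\<in>UNIV. (M $ i $ j * x $ j) *\<^sub>R e i)"
    by (simp add: E_def matrix_vector_mult_def scaleR_sum_left)
  also have "\<dots> = (\<Sum>j\<in>UNIV. \<Sum>i\<in>UNIV. (M $ i $ j * x $ j) *\<^sub>R e i)" by (rule sum.swap)
  finally show ?thesis by (simp add: scaleR_sum_right mult.commute)
qed

lemma matrix_E: "B *v E x = (\<Sum>j\<in>UNIV. x $ j *\<^sub>R (B *v e j))"
  by (simp add: E_def linear_sum[OF matrix_vector_mul_linear] matrix_vector_mult_scaleR)

lemma rauzy_veech_matrices_iff:
  "M \<in> rauzy_veech_matrices \<pi> e \<longleftrightarrow> (\<exists>B. rv_matrix \<pi> B \<and> (\<forall>x. B *v E x = E (M *v x)))"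
proof -
  have "(\<forall>j. restricted \<pi> B (e j) = (\<Sum>i\<in>UNIV. M $ i $ j *\<^sub>R e i)) \<longleftrightarrow> (\<forall>x. B *v E x = E (M *v x))" for B
  proof -
    have r: "restricted \<pi> B (e j) = B *v e j" for j
      using lattice_subsetD[OF e_lattice] by simp
    have ax: "E (M *v axis j 1) = (\<Sum>i\<in>UNIV. M $ i $ j *\<^sub>R e i)" for j
      by (simp add: E_def matrix_vector_mult_axis_nth)
    show ?thesis unfolding r
    proof
      assume "\<forall>j. B *v e j = (\<Sum>i\<in>UNIV. M $ i $ j *\<^sub>R e i)"
      then show "\<forall>x. B *v E x = E (M *v x)" by (simp add: E_columns matrix_E)
    next
      assume "\<forall>x. B *v E x = E (M *v x)"
      then show "\<forall>j. B *v e j = (\<Sum>i\<in>UNIV. M $ i $ j *\<^sub>R e i)" using E_axis ax by metis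
    qed
  qed
  then show ?thesis
    unfolding rauzy_veech_matrices_def rauzy_veech_group_eq[OF irr card] by auto
qed

lemma coordinate_matrix_exists:
  assumes "rv_matrix \<pi> B"
  obtains M where "M \<in> rauzy_veech_matrices \<pi> e" "\<And>x. B *v E x = E (M *v x)"
proof -
  have "\<forall>j. \<exists>c. B *v e j = E c"
    using rv_matrix_homology(1)[OF assms irr card lattice_subsetD[OF e_lattice]] range_E by blast
  then obtain c where c: "\<And>j. B *v e j = E (c j)" by metis
  define M where "M = (\<chi> i j. c j $ i)"
  have "B *v E x = E (M *v x)" for x
    unfolding E_columns matrix_E c by (simp add: M_def E_def)
  with assms show thesis by (intro that[of M]) (auto simp: rauzy_veech_matrices_iff)
qed

lemma rauzy_veech_matrices_Sp_int: "rauzy_veech_matrices \<pi> e \<subseteq> carrier Sp_int"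
proof
  fix M assume "M \<in> rauzy_veech_matrices \<pi> e"
  then obtain B where B: "rv_matrix \<pi> B" and M: "\<And>x. B *v E x = E (M *v x)"
    unfolding rauzy_veech_matrices_iff by blast
  have "sp (M *v x) (M *v y) = sp x y" for x y
    unfolding form_E[symmetric] M[symmetric]
    by (rule rv_matrix_homology(3)[OF B irr card E_homology E_homology])
  then have "M \<in> carrier Sp_real" by (simp add: Sp_real_iff)
  moreover have "M $ i $ j \<in> \<int>" for i j
  proof -
    have "B *v e j \<in> homology_lattice \<pi>" by (rule rv_matrix_homology(2)[OF B irr card e_lattice])
    then obtain c where c: "B *v e j = E c" "\<And>i. c $ i \<in> \<int>" using lattice_E by metis
    have "E c = E (M *v axis j 1)" using c(1) M[of "axis j 1"] by (simp add: E_axis)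
    then have "c = M *v axis j 1" by (simp add: E_cancel)
    then show ?thesis using c(2)[of i] by (simp add: matrix_vector_mult_axis_nth)
  qed
  ultimately show "M \<in> carrier Sp_int" by (simp add: Sp_int_def)
qed

lemma rauzy_veech_matrices_one: "mat 1 \<in> rauzy_veech_matrices \<pi> e"
  unfolding rauzy_veech_matrices_iff
  by (rule exI[of _ "mat 1"]) (simp add: rv_matrix.loop[OF rauzy_path.refl])

lemma rauzy_veech_matrices_mult:
  assumes "M \<in> rauzy_veech_matrices \<pi> e" "N \<in> rauzy_veech_matrices \<pi> e"
  shows "M ** N \<in> rauzy_veech_matrices \<pi> e"
proof -
  obtain A where A: "rv_matrix \<pi> A" "\<And>x. A *v E x = E (M *v x)"
    using assms(1) unfolding rauzy_veech_matrices_iff by blast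
  obtain B where B: "rv_matrix \<pi> B" "\<And>x. B *v E x = E (N *v x)"
    using assms(2) unfolding rauzy_veech_matrices_iff by blast
  have "A ** B *v E x = E (M ** N *v x)" for x
    unfolding matrix_vector_mul_assoc[symmetric] A(2) B(2) ..
  then show ?thesis using rv_matrix.mult[OF A(1) B(1)] by (auto simp: rauzy_veech_matrices_iff)
qed

lemma rauzy_veech_matrices_subgroup: "subgroup (rauzy_veech_matrices \<pi> e) Sp_int"
proof
  show "rauzy_veech_matrices \<pi> e \<subseteq> carrier Sp_int" by (rule rauzy_veech_matrices_Sp_int)
  show "x \<otimes>\<^bsub>Sp_int\<^esub> y \<in> rauzy_veech_matrices \<pi> e"
    if "x \<in> rauzy_veech_matrices \<pi> e" "y \<in> rauzy_veech_matrices \<pi> e" for x y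
    using rauzy_veech_matrices_mult[OF that] by (simp add: Sp_int_def Sp_real_def)
  show "\<one>\<^bsub>Sp_int\<^esub> \<in> rauzy_veech_matrices \<pi> e"
    using rauzy_veech_matrices_one by (simp add: Sp_int_def Sp_real_def)
  show "inv\<^bsub>Sp_int\<^esub> M \<in> rauzy_veech_matrices \<pi> e" if "M \<in> rauzy_veech_matrices \<pi> e" for M
  proof -
    from that obtain B where B: "rv_matrix \<pi> B" and M: "\<And>x. B *v E x = E (M *v x)"
      unfolding rauzy_veech_matrices_iff by blast
    obtain C where C: "B ** C = mat 1" using rv_matrix_properties[OF B irr card] by blast
    obtain N where N: "N \<in> rauzy_veech_matrices \<pi> e" "\<And>x. C *v E x = E (N *v x)"
      using coordinate_matrix_exists[OF rv_matrix.inverse[OF B C]] by blast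
    have "E (M ** N *v x) = E x" for x
      using C by (simp add: matrix_vector_mul_assoc[symmetric] M[symmetric] N(2)[symmetric])
        (simp add: matrix_vector_mul_assoc)
    then have MN: "M ** N = mat 1" by (simp add: E_cancel matrix_eq)
    have NM: "N ** M = mat 1" using MN matrix_inverse_commute by blast
    have "inv\<^bsub>Sp_int\<^esub> M = N"
      unfolding m_inv_def
    proof (rule the_equality)
      show "N \<in> carrier Sp_int \<and> M \<otimes>\<^bsub>Sp_int\<^esub> N = \<one>\<^bsub>Sp_int\<^esub> \<and> N \<otimes>\<^bsub>Sp_int\<^esub> M = \<one>\<^bsub>Sp_int\<^esub>"
        using N(1) rauzy_veech_matrices_Sp_int MN NM by (auto simp: Sp_int_def Sp_real_def)
      fix y assume "y \<in> carrier Sp_int \<and> M \<otimes>\<^bsub>Sp_int\<^esub> y = \<one>\<^bsub>Sp_int\<^esub> \<and> y \<otimes>\<^bsub>Sp_int\<^esub> M = \<one>\<^bsub>Sp_int\<^esub>"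
      then have "y ** M = mat 1" by (simp add: Sp_int_def Sp_real_def)
      then show "y = N" by (metis MN matrix_mul_assoc matrix_mul_lid matrix_mul_rid)
    qed
    then show ?thesis using N(1) by simp
  qed
qed

lemma rauzy_veech_matrices_dense: "zariski_dense_in (rauzy_veech_matrices \<pi> e) (carrier Sp_real)"
proof -
  have "\<forall>\<xi>. \<exists>c. Omega \<pi> *v axis \<xi> 1 = E c" using Omega_in[of \<pi>] range_E by blast
  then obtain c where c: "\<And>\<xi>. E (c \<xi>) = Omega \<pi> *v axis \<xi> 1" by metis
  have tv: "transvection 1 (c \<xi>) \<in> rauzy_veech_matrices \<pi> e" for \<xi>
  proof -
    have "transvection_by (Omega \<pi>) (axis \<xi> 1) *v E x = E (transvection 1 (c \<xi>) *v x)" for x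
    proof -
      have "axis \<xi> 1 \<bullet> E x = sp (c \<xi>) x"
        unfolding form_E[symmetric] c by (rule iform_right[OF E_homology, symmetric])
      then show ?thesis
        by (simp add: transvection_by_def transvection_apply matrix_vector_mult_add_rdistrib outer_mult_vec
            linear_add[OF linear_E] linear_scale[OF linear_E] c)
    qed
    moreover have "rv_matrix \<pi> (transvection_by (Omega \<pi>) (axis \<xi> 1))"
      using transvection_letters_UNIV[OF irr card, of \<xi>] by (simp add: transvection_vectors_def)
    ultimately show ?thesis by (auto simp: rauzy_veech_matrices_iff)
  qed
  have sp_c: "sp (c \<xi>) (c \<eta>) = Omega \<pi> $ \<xi> $ \<eta>" for \<xi> \<eta>
    unfolding form_E[symmetric] c intersection_form_Omega by (rule inner_Omega_axis)
  have "carrier Sp_real \<subseteq> zariski_closure (rauzy_veech_matrices \<pi> e)"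
  proof (rule transvections_dense[where C = "range c"])
    show "span (range c) = UNIV"
    proof (intro subset_antisym subset_UNIV subsetI)
      fix x
      obtain u where "E x = Omega \<pi> *v u" using E_homology by (rule homology_spaceE)
      also have "\<dots> = (\<Sum>\<xi>\<in>UNIV. u $ \<xi> *\<^sub>R (Omega \<pi> *v axis \<xi> 1))"
        by (simp add: vec_eq_iff matrix_vector_mult_axis_nth) (simp add: matrix_vector_mult_def mult.commute)
      also have "\<dots> = E (\<Sum>\<xi>\<in>UNIV. u $ \<xi> *\<^sub>R c \<xi>)"
        by (simp add: linear_sum[OF linear_E] linear_scale[OF linear_E] c)
      finally have "x = (\<Sum>\<xi>\<in>UNIV. u $ \<xi> *\<^sub>R c \<xi>)" by (simp add: E_cancel)
      also have "\<dots> \<in> span (range c)" by (intro span_sum span_scale span_base rangeI)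
      finally show "x \<in> span (range c)" .
    qed
    fix S assume S: "S \<subseteq> range c" "S \<noteq> {}" "S \<noteq> range c"
    have "\<exists>\<xi>\<in>c -` S. \<exists>\<eta>\<in>- (c -` S). Omega \<pi> $ \<xi> $ \<eta> \<noteq> 0"
      by (rule inversion_graph_connected[OF irr]) (use S in auto)
    then obtain \<xi> \<eta> where "c \<xi> \<in> S" "c \<eta> \<notin> S" "sp (c \<xi>) (c \<eta>) \<noteq> 0" by (auto simp: sp_c)
    then show "\<exists>c'\<in>S. \<exists>d\<in>range c - S. sp c' d \<noteq> 0" by blast
  qed (auto intro: rauzy_veech_matrices_one rauzy_veech_matrices_mult tv)
  moreover have "rauzy_veech_matrices \<pi> e \<subseteq> carrier Sp_real"
    using rauzy_veech_matrices_Sp_int by (auto simp: Sp_int_def)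
  ultimately show ?thesis
    using zariski_closure_minimal unfolding zariski_dense_in_def by blast
qed

end

theorem corollary1:
  fixes g :: nat and R :: "'a::finite perm_pair set" and \<pi> :: "'a perm_pair"
  assumes "g \<ge> 2" and "CARD('g::finite) = g"
    and "rauzy_class R" and "\<pi> \<in> R" and "has_genus \<pi> g"
  shows "(\<exists>e :: 'g + 'g \<Rightarrow> real^'a. symplectic_lattice_basis \<pi> e) \<and>
    (\<forall>e :: 'g + 'g \<Rightarrow> real^'a. symplectic_lattice_basis \<pi> e \<longrightarrow>
       subgroup (rauzy_veech_matrices \<pi> e) Sp_int \<and>
       zariski_dense_in (rauzy_veech_matrices \<pi> e) (carrier Sp_real))"
proof -
  have irr: "irreducible_pair \<pi>"
    using assms(3,4) irreducible_path unfolding rauzy_class_def by blast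
  then have pp: "perm_pair \<pi>" by (simp add: irreducible_pair_def)
  have "2 * g \<le> CARD('a)"
    using dim_homology[OF pp assms(5)] dim_subset_UNIV[of "homology_space \<pi>"] by simp
  then have card: "CARD('a) \<ge> 2" using assms(1) by simp
  have "subgroup (rauzy_veech_matrices \<pi> e) Sp_int \<and>
      zariski_dense_in (rauzy_veech_matrices \<pi> e) (carrier Sp_real)"
    if "symplectic_lattice_basis \<pi> e" for e :: "'g + 'g \<Rightarrow> real^'a"
  proof -
    interpret symplectic_coordinates \<pi> e by unfold_locales (fact irr card that)+
    show ?thesis using rauzy_veech_matrices_subgroup rauzy_veech_matrices_dense by blast
  qed
  then show ?thesis using symplectic_lattice_basis_exists[OF pp assms(5,2)] by blast
qed

end
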